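(* Let $f=(f_1,\ldots,f_n)$ have the model property, let $M_Z=(M_{Z_1},\ldots,M_{Z_n})$ be the associated multiplication operators on $\mathbb H^2(f)$, and let $T=(T_1,\ldots,T_n)$ be an $n$-tuple of operators in $B(\mathcal H)^n$. Then the following statements are equivalent: (i) $T$ is a pure $n$-tuple of operators in $\mathbb B_f(\mathcal H)$; (ii) there exist a Hilbert space $\mathcal D$ and a co-invariant subspace $\mathcal M\subseteq\mathbb H^2(f)\otimes\mathcal D$ under each operator $M_{Z_1}\otimes I_{\mathcal D},\ldots,M_{Z_n}\otimes I_{\mathcal D}$ such that the $n$-tuple $(T_1,\ldots,T_n)$ is unitarily equivalent to $$\big(P_{\mathcal M}(M_{Z_1}\otimes I_{\mathcal D})|_{\mathcal M},\ldots,P_{\mathcal M}(M_{Z_n}\otimes I_{\mathcal D})|_{\mathcal M}\big).$$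
   Context: Notation. $\mathbb F_n^+$ is the free semigroup on $g_1,\ldots,g_n$ with identity $g_0$ and length $|\cdot|$. For an $n$-tuple $X$ of elements of a unital algebra, $X_\alpha=X_{i_1}\cdots X_{i_k}$ if $\alpha=g_{i_1}\cdots g_{i_k}$, $X_{g_0}=I$; $[f(X)]_\alpha$ is the corresponding product of $f_1(X),\ldots,f_n(X)$. A tuple $X\in B(\mathcal H)^n$ is viewed as a row operator, so $\|X\|=\|\sum X_iX_i^*\|^{1/2}$; $[B(\mathcal H)^n]_\gamma=\{X:\|X\|<\gamma\}$. A free holomorphic function on $[B(\mathcal H)^n]_\gamma$ is a formal power series $\sum a_\alpha Z_\alpha$ in noncommuting indeterminates (complex coefficients) with radius of convergence $r$, $r^{-1}=\limsup_k(\sum_{|\alpha|=k}|a_\alpha|^2)^{1/2k}$, at least $\gamma$, identified with the map $X\mapsto\sum_k\sum_{|\alpha|=k}a_\alpha X_\alpha$ (norm convergence; $\mathcal H$ separable infinite-dimensional). $H^2_{\bf ball}$ is the Hilbert space of series with $\sum|a_\alpha|^2<\infty$ (the $Z_\alpha$ being orthonormal). Convergence sets. For an $n$-tuple $f$ of formal power series $f_j=\sum c^{(j)}_\alpha Z_\alpha$ and a Hilbert space $\mathcal H$: $\mathcal C_f^{SOT}(\mathcal H)$ is the set of $X\in B(\mathcal H)^n$ such that each series $f_j(X):=\sum_k\sum_{|\alpha|=k}c^{(j)}_\alpha X_\alpha$ is SOT-convergent; $\mathcal C_f^{rad}(\mathcal H)$ is the set of $X$ such that for some $\delta\in(0,1)$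 these series converge in norm at $rX$ for all $r\in(\delta,1)$ and $f_j(X):=\text{SOT-}\lim_{r\to1}f_j(rX)$ exists for each $j$. Model property. $f=(f_1,\ldots,f_n)$ has the model property if one of the following holds. (A) $f$ is an $n$-tuple of noncommutative polynomials for which there is an $n$-tuple $g$ of noncommutative polynomials with $f\circ g=g\circ f=\mathrm{id}$. Then $\{f_\alpha\}$ is a linear basis of $\mathbb C[Z_1,\ldots,Z_n]$ and $\mathbb H^2(f)$ is the completion of $\mathbb C[Z_1,\ldots,Z_n]$ for the inner product $\langle f_\alpha,f_\beta\rangle=\delta_{\alpha\beta}$. (S) $f$ is an $n$-tuple of formal power series with $f(0)=0$, nonzero radius of convergence and $\det J_f(0)\neq0$ ($J_f(0)_{ij}$ is the coefficient of $Z_j$ in $f_i$); $\mathbb H^2(f)$ is the Hilbert space of formal power series $\sum a_\alpha f_\alpha$, $\sum|a_\alpha|^2<\infty$, with $\{f_\alpha\}$ orthonormal; $Z_1,\ldots,Z_n\in\mathbb H^2(f)$; left multiplication $M_{Z_i}$ by $Z_i$ is bounded on $\mathbb H^2(f)$; and $M_Z=(M_{Z_1},\ldots,M_{Z_n})$ belongs to $\mathcal C_f^{SOT}(\mathbb H^2(f))$ or $\mathcal C_f^{rad}(\mathbb H^2(f))$ with $f_j(M_Z)=M_{f_j}$ (left multiplication by $f_j$), $j=1,\ldots,n$. (F) $f$ is an $n$-tuple of free holomorphic functions on some $[B(\mathcal H)^n]_\gamma$, $\gamma>0$, with range in $[B(\mathcal H)^n]_1$, such that $G\circ f\not\equiv0$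 for every nonzero free holomorphic $G$ on $[B(\mathcal H)^n]_1$; $\mathbb H^2(f)=\{G\circ f:G\in H^2_{\bf ball}\}$ with $\langle F\circ f,G\circ f\rangle=\langle F,G\rangle$; the coordinate functions $Z_1,\ldots,Z_n$ lie in $\mathbb H^2(f)$, left multiplications $M_{Z_i}$ by them are bounded on $\mathbb H^2(f)$, and $M_Z$ is in $\mathcal C_f^{SOT}(\mathbb H^2(f))$ or $\mathcal C_f^{rad}(\mathbb H^2(f))$ with $f_j(M_Z)=M_{f_j}$ for all $j$. In all cases $\{f_\alpha\}_{\alpha\in\mathbb F_n^+}$ is an orthonormal basis of $\mathbb H^2(f)$, and $M_Z$ is called the universal model. Writing $Z_i=\sum_\alpha a^{(i)}_\alpha f_\alpha$ in $\mathbb H^2(f)$, one has $M_{Z_i}f_\beta=\sum_\alpha a^{(i)}_\alpha f_{\alpha\beta}$, and $g_i:=\sum_\alpha a^{(i)}_\alpha Z_\alpha$ defines the inverse $g=(g_1,\ldots,g_n)$ of $f$ with respect to composition. Domain. $X\in B(\mathcal H)^n$ satisfies $g(f(X))=X$ if $X\in\mathcal C_f^{SOT}(\mathcal H)\cup\mathcal C_f^{rad}(\mathcal H)$ and either (for all $i$) $X_i=\sum_k\sum_{|\alpha|=k}a^{(i)}_\alpha[f(X)]_\alpha$ in the SOT, or (for all $i$) $X_i=\text{SOT-}\lim_{r\to1}\sum_k\sum_{|\alpha|=k}a^{(i)}_\alpha r^{|\alpha|}[f(X)]_\alpha$ (automatic in case (A)). Then $\mathbb B_f(\mathcal H):=\{X\in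 B(\mathcal H)^n:\ g(f(X))=X,\ \|f(X)\|\le1\}$. $T\in\mathbb B_f(\mathcal H)$ is pure if $\text{SOT-}\lim_{k\to\infty}\sum_{|\alpha|=k}[f(T)]_\alpha[f(T)]_\alpha^*=0$. A subspace is co-invariant under an operator if it is invariant under its adjoint. Two $n$-tuples $(A_i)\subset B(\mathcal H)$, $(B_i)\subset B(\mathcal K)$ are unitarily equivalent if there is a unitary $U:\mathcal H\to\mathcal K$ with $A_i=U^*B_iU$ for all $i$. $P_{\mathcal M}$ is the orthogonal projection onto $\mathcal M$. *)

theory Defs
  imports "HOL-Analysis.Analysis"
begin

section \<open>Complex Hilbert spaces and bounded operators\<close>

text \<open>HOL-Analysis only has real inner product spaces. A complex one is a real one with a
  complex scalar multiplication and a sesquilinear form, linear in the first argument, whose real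
  part is the given real inner product; norm and topology are the ones of \<^class>\<open>real_inner\<close>.\<close>

class complex_inner = real_inner +
  fixes scaleC :: "complex \<Rightarrow> 'a \<Rightarrow> 'a"  (infixr \<open>*\<^sub>C\<close> 75)
    and cinner :: "'a \<Rightarrow> 'a \<Rightarrow> complex"
  assumes scaleC_add_right: "c *\<^sub>C (x + y) = c *\<^sub>C x + c *\<^sub>C y"
    and scaleC_add_left: "(c + d) *\<^sub>C x = c *\<^sub>C x + d *\<^sub>C x"
    and scaleC_scaleC: "c *\<^sub>C (d *\<^sub>C x) = (c * d) *\<^sub>C x"
    and scaleR_eq_scaleC: "r *\<^sub>R x = of_real r *\<^sub>C x"
    and cinner_commute: "cinner x y = cnj (cinner y x)"
    and cinner_add_left: "cinner (x + y) z = cinner x z + cinner y z"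
    and cinner_scaleC_left: "cinner (c *\<^sub>C x) y = c * cinner x y"
    and inner_eq_Re_cinner: "inner x y = Re (cinner x y)"

class chilbert_space = complex_inner + complete_space

instantiation complex :: chilbert_space
begin
definition scaleC_complex :: "complex \<Rightarrow> complex \<Rightarrow> complex"
  where "scaleC_complex c x = c * x"
definition cinner_complex :: "complex \<Rightarrow> complex \<Rightarrow> complex"
  where "cinner_complex x y = x * cnj y"
instance
  by standard
    (auto simp: scaleC_complex_def cinner_complex_def algebra_simps scaleR_conv_of_real
      inner_complex_def)
end

lemma cinner_self: "cinner x x = of_real ((norm x)\<^sup>2)" for x :: "'a::complex_inner"
proof -
  have "Im (cinner x x) = 0"
    using arg_cong[OF cinner_commute[of x x], of Im] by simp
  moreover have "Re (cinner x x) = (norm x)\<^sup>2"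
    by (simp add: inner_eq_Re_cinner[symmetric] power2_norm_eq_inner)
  ultimately show ?thesis by (simp add: complex_eq_iff)
qed

lemma cinner_add_right: "cinner x (y + z) = cinner x y + cinner x z" for x :: "'a::complex_inner"
  by (metis cinner_add_left cinner_commute complex_cnj_add)

lemma cinner_scaleC_right: "cinner x (c *\<^sub>C y) = cnj c * cinner x y" for x :: "'a::complex_inner"
  by (metis cinner_scaleC_left cinner_commute complex_cnj_mult)

lemma norm_scaleC: "norm (c *\<^sub>C x) = norm c * norm x" for x :: "'a::complex_inner"
proof -
  have cc: "cnj c * c = (of_real (norm c))\<^sup>2"
    by (subst mult.commute) (simp only: complex_norm_square[symmetric] of_real_power)
  have "of_real ((norm (c *\<^sub>C x))\<^sup>2) = complex_of_real ((norm c * norm x)\<^sup>2)"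
    unfolding cinner_self[symmetric] cinner_scaleC_left cinner_scaleC_right mult.assoc[symmetric]
    by (simp add: cinner_self power_mult_distrib cc)
  then have "(norm (c *\<^sub>C x))\<^sup>2 = (norm c * norm x)\<^sup>2"
    using of_real_eq_iff by blast
  then show ?thesis by (simp add: power2_eq_iff_nonneg)
qed

lemma norm_cinner_le: "norm (cinner x y) \<le> norm x * norm y" for x :: "'a::complex_inner"
proof -
  define c where "c = cnj (sgn (cinner x y))"
  have *: "c * cinner x y = of_real (norm (cinner x y))"
  proof (cases "cinner x y = 0")
    case False
    have "cnj z * z = of_real (norm z * norm z)" for z :: complex
      by (metis complex_norm_square mult.commute power2_eq_square of_real_mult)
    then show ?thesis using False
      by (simp add: c_def sgn_eq field_simps)
  qed (simp add: c_def)
  have "norm (cinner x y) = Re (cinner (c *\<^sub>C x) y)"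
    by (simp add: cinner_scaleC_left *)
  also have "\<dots> = inner (c *\<^sub>C x) y" by (simp add: inner_eq_Re_cinner)
  also have "\<dots> \<le> norm (c *\<^sub>C x) * norm y" by (rule norm_cauchy_schwarz)
  also have "\<dots> \<le> 1 * norm x * norm y"
    unfolding norm_scaleC c_def by (intro mult_right_mono) (auto simp: norm_sgn)
  finally show ?thesis by simp
qed

definition bounded_clinear :: "('a::complex_inner \<Rightarrow> 'b::complex_inner) \<Rightarrow> bool"
  where "bounded_clinear A \<longleftrightarrow> bounded_linear A \<and> (\<forall>c x. A (c *\<^sub>C x) = c *\<^sub>C A x)"

definition cadj :: "('a::complex_inner \<Rightarrow> 'b::complex_inner) \<Rightarrow> 'b \<Rightarrow> 'a"
  where "cadj A = (THE B. \<forall>x y. cinner (B y) x = cinner y (A x))"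

definition csubspace :: "'a::complex_inner set \<Rightarrow> bool"
  where "csubspace M \<longleftrightarrow> 0 \<in> M \<and> (\<forall>x\<in>M. \<forall>y\<in>M. x + y \<in> M) \<and> (\<forall>c. \<forall>x\<in>M. c *\<^sub>C x \<in> M)"

definition closed_csubspace :: "'a::complex_inner set \<Rightarrow> bool"
  where "closed_csubspace M \<longleftrightarrow> csubspace M \<and> closed M"

definition cspan :: "'a::complex_inner set \<Rightarrow> 'a set"
  where "cspan S = \<Inter> {M. csubspace M \<and> S \<subseteq> M}"

definition orth_proj :: "'a::complex_inner set \<Rightarrow> 'a \<Rightarrow> 'a"
  where "orth_proj M x = (THE y. y \<in> M \<and> (\<forall>z\<in>M. cinner (x - y) z = 0))"

definition co_invariant :: "'a::complex_inner set \<Rightarrow> ('a \<Rightarrow> 'a) \<Rightarrow> bool"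
  where "co_invariant M A \<longleftrightarrow> (\<forall>x\<in>M. cadj A x \<in> M)"

text \<open>Unitary equivalence of a tuple on the whole space \<open>'h\<close> with a tuple of operators on the
  closed subspace \<open>M\<close>. A unitary from \<open>'h\<close> onto \<open>M\<close> is an isometry into the ambient space with
  range \<open>M\<close>; its adjoint restricts on \<open>M\<close> to the adjoint of the unitary. Only the values of
  \<open>B i\<close> on \<open>M\<close> matter.\<close>

definition unitarily_equivalent_on ::
    "('n \<Rightarrow> 'h::complex_inner \<Rightarrow> 'h) \<Rightarrow> 'k::complex_inner set \<Rightarrow> ('n \<Rightarrow> 'k \<Rightarrow> 'k) \<Rightarrow> bool"
  where "unitarily_equivalent_on A M B \<longleftrightarrow>
    (\<exists>U. bounded_clinear U \<and> (\<forall>x y. cinner (U x) (U y) = cinner x y) \<and> range U = M \<and>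
         (\<forall>i. A i = cadj U \<circ> B i \<circ> U))"

definition sot_lim ::
    "('a \<Rightarrow> 'h::complex_inner \<Rightarrow> 'h) \<Rightarrow> ('h \<Rightarrow> 'h) \<Rightarrow> 'a filter \<Rightarrow> bool"
  where "sot_lim A S F \<longleftrightarrow> bounded_clinear S \<and> (\<forall>x. ((\<lambda>k. A k x) \<longlongrightarrow> S x) F)"

definition sot_sums :: "(nat \<Rightarrow> 'h::complex_inner \<Rightarrow> 'h) \<Rightarrow> ('h \<Rightarrow> 'h) \<Rightarrow> bool"
  where "sot_sums A S \<longleftrightarrow> sot_lim (\<lambda>N x. \<Sum>k<N. A k x) S sequentially"

definition norm_sums :: "(nat \<Rightarrow> 'h::complex_inner \<Rightarrow> 'h) \<Rightarrow> ('h \<Rightarrow> 'h) \<Rightarrow> bool"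
  where "norm_sums A S \<longleftrightarrow>
    bounded_clinear S \<and> (\<lambda>N. onorm (\<lambda>x. (\<Sum>k<N. A k x) - S x)) \<longlonglongrightarrow> 0"

definition row_norm :: "('n::finite \<Rightarrow> 'h::complex_inner \<Rightarrow> 'h) \<Rightarrow> real"
  where "row_norm X = sqrt (onorm (\<lambda>x. \<Sum>i\<in>UNIV. X i (cadj (X i) x)))"


section \<open>Square-summable families\<close>

text \<open>\<open>('i, 'a) l2\<close> is the Hilbert space of square-summable families in \<open>'a\<close>. Two uses:
  \<open>('i, complex) l2\<close> is the sequence space over \<open>'i\<close>, and \<open>('i, 'd) l2\<close> is the Hilbert space
  tensor product of \<open>('i, complex) l2\<close> and \<open>'d\<close>, see \<open>tens\<close> below.\<close>

typedef (overloaded) ('i, 'a) l2 =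
  "{x :: 'i \<Rightarrow> 'a::complex_inner. (\<lambda>i. (norm (x i))\<^sup>2) summable_on UNIV}"
  by (rule exI[of _ "\<lambda>_. 0"]) simp

lemma l2_summable: "(\<lambda>i. (norm (Rep_l2 x i))\<^sup>2) summable_on UNIV"
  using Rep_l2[of x] by simp

lemma cinner_abs_summable:
  fixes x y :: "'i \<Rightarrow> 'a::complex_inner"
  assumes "(\<lambda>i. (norm (x i))\<^sup>2) summable_on UNIV" "(\<lambda>i. (norm (y i))\<^sup>2) summable_on UNIV"
  shows "(\<lambda>i. norm (cinner (x i) (y i))) summable_on UNIV"
proof (rule summable_on_comparison_test[OF summable_on_add[OF assms]])
  fix i
  have "2 * (norm (x i) * norm (y i)) \<le> (norm (x i))\<^sup>2 + (norm (y i))\<^sup>2"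
    using sum_squares_bound[of "norm (x i)" "norm (y i)"] by simp
  moreover have "0 \<le> norm (x i) * norm (y i)" by simp
  ultimately show "norm (cinner (x i) (y i)) \<le> (norm (x i))\<^sup>2 + (norm (y i))\<^sup>2"
    using norm_cinner_le[of "x i" "y i"] by linarith
qed auto

lemma cinner_summable: "(\<lambda>i. cinner (Rep_l2 x i) (Rep_l2 y i)) summable_on UNIV"
  by (rule abs_summable_summable, rule cinner_abs_summable) (rule l2_summable)+

lemma inner_summable: "(\<lambda>i. inner (Rep_l2 x i) (Rep_l2 y i)) summable_on UNIV"
  unfolding inner_eq_Re_cinner by (rule summable_on_Re[OF cinner_summable])

lemma l2_add_closed:
  fixes x y :: "'i \<Rightarrow> 'a::complex_inner"
  assumes "(\<lambda>i. (norm (x i))\<^sup>2) summable_on UNIV" "(\<lambda>i. (norm (y i))\<^sup>2) summable_on UNIV"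
  shows "(\<lambda>i. (norm (x i + y i))\<^sup>2) summable_on UNIV"
proof (rule summable_on_comparison_test)
  show "(\<lambda>i. 2 * ((norm (x i))\<^sup>2 + (norm (y i))\<^sup>2)) summable_on UNIV"
    by (intro summable_on_cmult_right summable_on_add assms)
  fix i
  have "(norm (x i + y i))\<^sup>2 \<le> (norm (x i) + norm (y i))\<^sup>2"
    by (intro power_mono norm_triangle_ineq) auto
  also have "\<dots> \<le> 2 * ((norm (x i))\<^sup>2 + (norm (y i))\<^sup>2)"
    using sum_squares_bound[of "norm (x i)" "norm (y i)"] by (simp add: power2_sum)
  finally show "(norm (x i + y i))\<^sup>2 \<le> 2 * ((norm (x i))\<^sup>2 + (norm (y i))\<^sup>2)" .
qed auto

lemma l2_scaleC_closed:
  fixes x :: "'i \<Rightarrow> 'a::complex_inner"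
  assumes "(\<lambda>i. (norm (x i))\<^sup>2) summable_on UNIV"
  shows "(\<lambda>i. (norm (c *\<^sub>C x i))\<^sup>2) summable_on UNIV"
  unfolding norm_scaleC power_mult_distrib by (intro summable_on_cmult_right assms)

lemma l2_scaleR_closed:
  fixes x :: "'i \<Rightarrow> 'a::complex_inner"
  assumes "(\<lambda>i. (norm (x i))\<^sup>2) summable_on UNIV"
  shows "(\<lambda>i. (norm (c *\<^sub>R x i))\<^sup>2) summable_on UNIV"
  unfolding scaleR_eq_scaleC by (rule l2_scaleC_closed[OF assms])

instantiation l2 :: (type, complex_inner) complex_inner
begin

definition zero_l2 :: "('a, 'b) l2" where "zero_l2 = Abs_l2 (\<lambda>_. 0)"
definition plus_l2 :: "('a, 'b) l2 \<Rightarrow> ('a, 'b) l2 \<Rightarrow> ('a, 'b) l2"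
  where "plus_l2 x y = Abs_l2 (\<lambda>i. Rep_l2 x i + Rep_l2 y i)"
definition scaleR_l2 :: "real \<Rightarrow> ('a, 'b) l2 \<Rightarrow> ('a, 'b) l2"
  where "scaleR_l2 r x = Abs_l2 (\<lambda>i. r *\<^sub>R Rep_l2 x i)"
definition scaleC_l2 :: "complex \<Rightarrow> ('a, 'b) l2 \<Rightarrow> ('a, 'b) l2"
  where "scaleC_l2 c x = Abs_l2 (\<lambda>i. c *\<^sub>C Rep_l2 x i)"
definition uminus_l2 :: "('a, 'b) l2 \<Rightarrow> ('a, 'b) l2"
  where "uminus_l2 x = (-1) *\<^sub>R x"
definition minus_l2 :: "('a, 'b) l2 \<Rightarrow> ('a, 'b) l2 \<Rightarrow> ('a, 'b) l2"
  where "minus_l2 x y = x + (- y)"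
definition inner_l2 :: "('a, 'b) l2 \<Rightarrow> ('a, 'b) l2 \<Rightarrow> real"
  where "inner_l2 x y = infsum (\<lambda>i. inner (Rep_l2 x i) (Rep_l2 y i)) UNIV"
definition cinner_l2 :: "('a, 'b) l2 \<Rightarrow> ('a, 'b) l2 \<Rightarrow> complex"
  where "cinner_l2 x y = infsum (\<lambda>i. cinner (Rep_l2 x i) (Rep_l2 y i)) UNIV"
definition norm_l2 :: "('a, 'b) l2 \<Rightarrow> real"
  where "norm_l2 x = sqrt (inner x x)"
definition sgn_l2 :: "('a, 'b) l2 \<Rightarrow> ('a, 'b) l2"
  where "sgn_l2 x = inverse (norm x) *\<^sub>R x"
definition dist_l2 :: "('a, 'b) l2 \<Rightarrow> ('a, 'b) l2 \<Rightarrow> real"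
  where "dist_l2 x y = norm (x - y)"
definition uniformity_l2 :: "(('a, 'b) l2 \<times> ('a, 'b) l2) filter"
  where "uniformity_l2 = (INF e\<in>{0 <..}. principal {(x, y). dist x y < e})"
definition open_l2 :: "('a, 'b) l2 set \<Rightarrow> bool"
  where "open_l2 S = (\<forall>x\<in>S. \<forall>\<^sub>F (x', y) in uniformity. x' = x \<longrightarrow> y \<in> S)"

lemma Rep_zero_l2: "Rep_l2 (0::('a, 'b) l2) = (\<lambda>_. 0)"
  by (simp add: zero_l2_def Abs_l2_inverse)
lemma Rep_plus_l2: "Rep_l2 (x + y :: ('a, 'b) l2) = (\<lambda>i. Rep_l2 x i + Rep_l2 y i)"
  by (simp add: plus_l2_def Abs_l2_inverse l2_add_closed l2_summable)
lemma Rep_scaleR_l2: "Rep_l2 (r *\<^sub>R x :: ('a, 'b) l2) = (\<lambda>i. r *\<^sub>R Rep_l2 x i)"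
  unfolding scaleR_l2_def using l2_scaleR_closed[OF l2_summable[of x]]
  by (subst Abs_l2_inverse) auto
lemma Rep_scaleC_l2: "Rep_l2 (c *\<^sub>C x :: ('a, 'b) l2) = (\<lambda>i. c *\<^sub>C Rep_l2 x i)"
  unfolding scaleC_l2_def using l2_scaleC_closed[OF l2_summable[of x]]
  by (subst Abs_l2_inverse) auto
lemma Rep_uminus_l2: "Rep_l2 (- x :: ('a, 'b) l2) = (\<lambda>i. - Rep_l2 x i)"
  by (simp add: uminus_l2_def Rep_scaleR_l2)
lemma Rep_minus_l2: "Rep_l2 (x - y :: ('a, 'b) l2) = (\<lambda>i. Rep_l2 x i - Rep_l2 y i)"
  by (simp add: minus_l2_def Rep_plus_l2 Rep_uminus_l2)
lemmas Rep_l2_simps =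
  Rep_zero_l2 Rep_plus_l2 Rep_scaleR_l2 Rep_scaleC_l2 Rep_uminus_l2 Rep_minus_l2

instance
proof
  fix x y z :: "('a, 'b) l2" and r s :: real and c d :: complex
  show "x + y + z = x + (y + z)" "x + y = y + x" "0 + x = x" "- x + x = 0" "x - y = x + - y"
    by (simp_all add: Rep_l2_inject[symmetric] Rep_l2_simps add_ac)
  show "r *\<^sub>R (x + y) = r *\<^sub>R x + r *\<^sub>R y" "(r + s) *\<^sub>R x = r *\<^sub>R x + s *\<^sub>R x"
    "r *\<^sub>R s *\<^sub>R x = (r * s) *\<^sub>R x" "1 *\<^sub>R x = x"
    by (simp_all add: Rep_l2_inject[symmetric] Rep_l2_simps algebra_simps)
  show "sgn x = inverse (norm x) *\<^sub>R x" by (rule sgn_l2_def)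
  show "dist x y = norm (x - y)" by (rule dist_l2_def)
  show "uniformity = (INF e\<in>{0<..}. principal {(x, y). dist (x::('a, 'b) l2) y < e})"
    by (rule uniformity_l2_def)
  show "open U = (\<forall>x\<in>U. \<forall>\<^sub>F (x', y) in uniformity. x' = x \<longrightarrow> y \<in> U)" for U :: "('a, 'b) l2 set"
    by (rule open_l2_def)
  show "inner x y = inner y x"
    unfolding inner_l2_def by (simp add: inner_commute)
  show "inner (x + y) z = inner x z + inner y z"
    unfolding inner_l2_def Rep_l2_simps inner_add_left
    by (rule infsum_add) (rule inner_summable)+
  show "inner (r *\<^sub>R x) y = r * inner x y"
    unfolding inner_l2_def Rep_l2_simps inner_scaleR_left
    by (rule infsum_cmult_right) (rule inner_summable)
  show "0 \<le> inner x x"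
    unfolding inner_l2_def by (rule infsum_nonneg) simp
  show "inner x x = 0 \<longleftrightarrow> x = 0"
  proof
    assume "inner x x = 0"
    then have "inner (Rep_l2 x i) (Rep_l2 x i) = 0" for i
      unfolding inner_l2_def
      by (intro nonneg_infsum_le_0D[OF _ inner_summable]) auto
    then show "x = 0" by (simp add: Rep_l2_inject[symmetric] Rep_l2_simps fun_eq_iff)
  qed (simp add: inner_l2_def Rep_l2_simps)
  show "norm x = sqrt (inner x x)" by (rule norm_l2_def)
  show "c *\<^sub>C (x + y) = c *\<^sub>C x + c *\<^sub>C y" "(c + d) *\<^sub>C x = c *\<^sub>C x + d *\<^sub>C x"
    "c *\<^sub>C d *\<^sub>C x = (c * d) *\<^sub>C x" "r *\<^sub>R x = complex_of_real r *\<^sub>C x"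
    by (simp_all add: Rep_l2_inject[symmetric] Rep_l2_simps scaleC_add_right scaleC_add_left
        scaleC_scaleC scaleR_eq_scaleC)
  show "cinner x y = cnj (cinner y x)"
    unfolding cinner_l2_def infsum_cnj[symmetric] cinner_commute[symmetric] ..
  show "cinner (x + y) z = cinner x z + cinner y z"
    unfolding cinner_l2_def Rep_l2_simps cinner_add_left
    by (rule infsum_add) (rule cinner_summable)+
  show "cinner (c *\<^sub>C x) y = c * cinner x y"
    unfolding cinner_l2_def Rep_l2_simps cinner_scaleC_left
    by (rule infsum_cmult_right) (rule cinner_summable)
  show "inner x y = Re (cinner x y)"
    unfolding cinner_l2_def inner_l2_def inner_eq_Re_cinner
    by (rule infsum_Re) (rule cinner_summable)
qed

end

lemma norm_l2_power2: "(norm x)\<^sup>2 = infsum (\<lambda>i. (norm (Rep_l2 x i))\<^sup>2) UNIV"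
  unfolding power2_norm_eq_inner inner_l2_def ..

lemma norm_l2_finite_le: "finite F \<Longrightarrow> (\<Sum>i\<in>F. (norm (Rep_l2 x i))\<^sup>2) \<le> (norm x)\<^sup>2"
  unfolding norm_l2_power2 by (rule finite_sum_le_infsum[OF l2_summable]) auto

lemma norm_Rep_l2_le: "norm (Rep_l2 x i) \<le> norm x"
  using norm_l2_finite_le[of "{i}" x] by (simp add: power2_le_iff_abs_le)

instance l2 :: (type, chilbert_space) chilbert_space
proof
  fix X :: "nat \<Rightarrow> ('a, 'b) l2"
  assume C: "Cauchy X"
  have "Cauchy (\<lambda>n. Rep_l2 (X n) i)" for i
  proof (rule metric_CauchyI)
    fix e :: real assume "0 < e"
    with C obtain M where M: "\<And>m n. m \<ge> M \<Longrightarrow> n \<ge> M \<Longrightarrow> dist (X m) (X n) < e"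
      unfolding Cauchy_def by meson
    then show "\<exists>M. \<forall>m\<ge>M. \<forall>n\<ge>M. dist (Rep_l2 (X m) i) (Rep_l2 (X n) i) < e"
      using norm_Rep_l2_le[of "X _ - X _" i] unfolding dist_norm Rep_minus_l2
      by (meson le_less_trans)
  qed
  then obtain y where y: "\<And>i. (\<lambda>n. Rep_l2 (X n) i) \<longlonglongrightarrow> y i"
    unfolding Cauchy_convergent_iff convergent_def by metis
  have fin: "(\<Sum>i\<in>F. (norm (Rep_l2 (X m) i - y i))\<^sup>2) \<le> e\<^sup>2"
    if M: "\<And>m n. m \<ge> M \<Longrightarrow> n \<ge> M \<Longrightarrow> dist (X m) (X n) < e" and "m \<ge> M" "finite F" for e M m F
  proof (rule tendsto_upperbound)
    show "(\<lambda>n. \<Sum>i\<in>F. (norm (Rep_l2 (X m) i - Rep_l2 (X n) i))\<^sup>2)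
        \<longlonglongrightarrow> (\<Sum>i\<in>F. (norm (Rep_l2 (X m) i - y i))\<^sup>2)"
      by (intro tendsto_intros y)
    show "\<forall>\<^sub>F n in sequentially. (\<Sum>i\<in>F. (norm (Rep_l2 (X m) i - Rep_l2 (X n) i))\<^sup>2) \<le> e\<^sup>2"
    proof (rule eventually_sequentiallyI)
      fix n assume "n \<ge> M"
      have "(\<Sum>i\<in>F. (norm (Rep_l2 (X m) i - Rep_l2 (X n) i))\<^sup>2) \<le> (norm (X m - X n))\<^sup>2"
        using norm_l2_finite_le[OF \<open>finite F\<close>, of "X m - X n"] by (simp add: Rep_minus_l2)
      also have "\<dots> \<le> e\<^sup>2"
        using M[OF \<open>m \<ge> M\<close> \<open>n \<ge> M\<close>] by (intro power_mono) (auto simp: dist_norm)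
      finally show "(\<Sum>i\<in>F. (norm (Rep_l2 (X m) i - Rep_l2 (X n) i))\<^sup>2) \<le> e\<^sup>2" .
    qed
  qed simp
  have summ: "(\<lambda>i. (norm (Rep_l2 (X m) i - y i))\<^sup>2) summable_on UNIV"
    if M: "\<And>m n. m \<ge> M \<Longrightarrow> n \<ge> M \<Longrightarrow> dist (X m) (X n) < e" and "m \<ge> M" for e M m
    by (rule nonneg_bdd_above_summable_on) (auto intro!: bdd_aboveI2[where M="e\<^sup>2"] fin[OF M \<open>m \<ge> M\<close>])
  have "\<exists>M. \<forall>m\<ge>M. \<forall>n\<ge>M. dist (X m) (X n) < 1"
    using C unfolding Cauchy_def by (meson zero_less_one)
  then obtain M1 where M1: "\<And>m n. m \<ge> M1 \<Longrightarrow> n \<ge> M1 \<Longrightarrow> dist (X m) (X n) < 1" by blast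
  have "(\<lambda>i. (norm (Rep_l2 (X M1) i + (-1) *\<^sub>R (Rep_l2 (X M1) i - y i)))\<^sup>2) summable_on UNIV"
    by (intro l2_add_closed l2_summable l2_scaleR_closed summ[of M1 1] M1) auto
  then have ysum: "(\<lambda>i. (norm (y i))\<^sup>2) summable_on UNIV" by simp
  define L where "L = Abs_l2 y"
  have RL: "Rep_l2 L = y" unfolding L_def using ysum by (simp add: Abs_l2_inverse)
  have "X \<longlonglongrightarrow> L"
  proof (rule metric_LIMSEQ_I)
    fix e :: real assume "0 < e"
    then have "e / 2 > 0" by simp
    then obtain M where M: "\<And>m n. m \<ge> M \<Longrightarrow> n \<ge> M \<Longrightarrow> dist (X m) (X n) < e / 2"
      using C unfolding Cauchy_def by meson
    have "dist (X m) L < e" if "m \<ge> M" for m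
    proof -
      have "(norm (X m - L))\<^sup>2 \<le> (e / 2)\<^sup>2"
        unfolding norm_l2_power2 Rep_minus_l2 RL
        by (rule infsum_le_finite_sums[OF summ[OF M that]]) (auto intro: fin[OF M that])
      then have "norm (X m - L) \<le> e / 2"
        using \<open>0 < e\<close> by (simp add: power2_le_iff_abs_le)
      then show ?thesis using \<open>0 < e\<close> by (simp add: dist_norm)
    qed
    then show "\<exists>no. \<forall>n\<ge>no. dist (X n) L < e" by blast
  qed
  then show "convergent X" by (rule convergentI)
qed

section \<open>Tensor products\<close>

text \<open>The next two lemmas are the characterization of the Hilbert space tensor product:
  inner products of elementary tensors factor, and elementary tensors are total.\<close>

definition tens :: "('i, complex) l2 \<Rightarrow> 'd::complex_inner \<Rightarrow> ('i, 'd) l2"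
  where "tens a d = Abs_l2 (\<lambda>i. Rep_l2 a i *\<^sub>C d)"

lemma Rep_tens: "Rep_l2 (tens a d) = (\<lambda>i. Rep_l2 a i *\<^sub>C d)"
proof -
  have "(\<lambda>i. (norm (Rep_l2 a i *\<^sub>C d))\<^sup>2) summable_on UNIV"
    unfolding norm_scaleC power_mult_distrib by (intro summable_on_cmult_left l2_summable)
  then show ?thesis by (simp add: tens_def Abs_l2_inverse)
qed

lemma cinner_tens: "cinner (tens a d) (tens b e) = cinner a b * cinner d e"
proof -
  have "cinner (tens a d) (tens b e)
      = infsum (\<lambda>i. cinner (Rep_l2 a i) (Rep_l2 b i) * cinner d e) UNIV"
    unfolding cinner_l2_def Rep_tens
    by (simp add: cinner_scaleC_left cinner_scaleC_right cinner_complex_def mult_ac)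
  also have "\<dots> = cinner a b * cinner d e"
    unfolding cinner_l2_def by (rule infsum_cmult_left) (rule cinner_summable)
  finally show ?thesis .
qed

lemma csubspace_sum:
  "csubspace M \<Longrightarrow> (\<And>i. i \<in> F \<Longrightarrow> x i \<in> M) \<Longrightarrow> (\<Sum>i\<in>F. x i) \<in> M"
  by (induction F rule: infinite_finite_induct) (auto simp: csubspace_def)

lemma Rep_l2_sum: "Rep_l2 (\<Sum>j\<in>F. x j) i = (\<Sum>j\<in>F. Rep_l2 (x j) i)"
  by (induction F rule: infinite_finite_induct) (auto simp: Rep_l2_simps)

definition tensor_space :: "'d::complex_inner set \<Rightarrow> ('i, 'd) l2 set"
  where "tensor_space D = closure (cspan {tens a d |a d. d \<in> D})"

lemma tensor_space_UNIV: "tensor_space (UNIV :: 'd::complex_inner set) = (UNIV :: ('i, 'd) l2 set)"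
proof -
  have "x \<in> tensor_space UNIV" for x :: "('i, 'd) l2"
    unfolding tensor_space_def closure_approachable
  proof (intro allI impI)
    fix e :: real assume "e > 0"
    define k where "k i = Abs_l2 (\<lambda>j::'i. if j = i then 1 else (0::complex))" for i
    have Rk: "Rep_l2 (k i) = (\<lambda>j. if j = i then 1 else 0)" for i
    proof -
      have "(\<lambda>j. (norm (if j = i then 1 else (0::complex)))\<^sup>2) summable_on UNIV"
        by (rule finite_nonzero_values_imp_summable_on) (rule finite_subset[of _ "{i}"], auto)
      then show ?thesis by (simp add: k_def Abs_l2_inverse)
    qed
    have "((\<lambda>i. (norm (Rep_l2 x i))\<^sup>2) has_sum (norm x)\<^sup>2) UNIV"
      unfolding norm_l2_power2 by (rule has_sum_infsum[OF l2_summable])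
    moreover have "e\<^sup>2 / 2 > 0" using \<open>e > 0\<close> by simp
    ultimately obtain F where F: "finite F"
      "dist (\<Sum>i\<in>F. (norm (Rep_l2 x i))\<^sup>2) ((norm x)\<^sup>2) \<le> e\<^sup>2 / 2"
      by (metis has_sum_finite_approximation)
    define y where "y = (\<Sum>i\<in>F. tens (k i) (Rep_l2 x i))"
    have Ry: "Rep_l2 y j = (if j \<in> F then Rep_l2 x j else 0)" for j
    proof -
      have sc: "(1::complex) *\<^sub>C v = v" "(0::complex) *\<^sub>C v = 0" for v :: 'd
        using scaleR_eq_scaleC[of 1 v] scaleR_eq_scaleC[of 0 v] by auto
      have "Rep_l2 y j = (\<Sum>i\<in>F. if j = i then Rep_l2 x i else 0)"
        unfolding y_def Rep_l2_sum Rep_tens Rk by (intro sum.cong) (auto simp: sc)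
      then show ?thesis using F(1) by simp
    qed
    have "y \<in> cspan {tens a d |a d. d \<in> UNIV}"
      unfolding cspan_def y_def by (auto intro!: csubspace_sum)
    moreover have "dist y x < e"
    proof -
      have "(norm (x - y))\<^sup>2 = infsum (\<lambda>i. (norm (Rep_l2 x i))\<^sup>2) (- F)"
        unfolding norm_l2_power2 Rep_minus_l2 Ry
        by (rule infsum_cong_neutral) auto
      also have "\<dots> = (norm x)\<^sup>2 - (\<Sum>i\<in>F. (norm (Rep_l2 x i))\<^sup>2)"
      proof -
        have "infsum (\<lambda>i. (norm (Rep_l2 x i))\<^sup>2) (F \<union> - F)
          = infsum (\<lambda>i. (norm (Rep_l2 x i))\<^sup>2) F + infsum (\<lambda>i. (norm (Rep_l2 x i))\<^sup>2) (- F)"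
          by (rule infsum_Un_disjoint)
            (auto intro: F(1) summable_on_subset_banach[OF l2_summable])
        then show ?thesis using F(1) by (simp add: norm_l2_power2)
      qed
      also have "\<dots> \<le> e\<^sup>2 / 2" using F(2) unfolding dist_real_def by linarith
      also have "\<dots> < e\<^sup>2" using \<open>e > 0\<close> by simp
      finally have "norm (x - y) < e" using \<open>e > 0\<close> by (simp add: power2_less_imp_less)
      then show ?thesis by (simp add: dist_norm norm_minus_commute)
    qed
    ultimately show "\<exists>y\<in>cspan {tens a d |a d. d \<in> UNIV}. dist y x < e" by blast
  qed
  then show ?thesis by blast
qed

text \<open>\<open>A \<otimes> I\<close> on the tensor product with the whole type \<open>'d\<close>. For a closed subspace \<open>D\<close> it is
  reduced by \<open>tensor_space D\<close>, and its restriction there is \<open>A\<close> tensored with the identity of \<open>D\<close>.\<close>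

definition tens_op ::
    "(('i, complex) l2 \<Rightarrow> ('i, complex) l2) \<Rightarrow> ('i, 'd::complex_inner) l2 \<Rightarrow> ('i, 'd) l2"
  where "tens_op A = (THE B. bounded_clinear B \<and> (\<forall>a d. B (tens a d) = tens (A a) d))"


section \<open>Noncommutative formal power series\<close>

text \<open>Words are lists over the finite index type \<open>'n\<close> (so \<open>n = CARD('n)\<close>), the empty list being
  \<open>g\<^sub>0\<close>; a formal power series is the family of its coefficients.\<close>

type_synonym 'n series = "'n list \<Rightarrow> complex"

definition nc_one :: "'n series"
  where "nc_one w = (if w = [] then 1 else 0)"

definition nc_var :: "'n \<Rightarrow> 'n series"
  where "nc_var i w = (if w = [i] then 1 else 0)"

definition nc_mult :: "'n series \<Rightarrow> 'n series \<Rightarrow> 'n series"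
  where "nc_mult p q w = (\<Sum>k\<le>length w. p (take k w) * q (drop k w))"

primrec nc_word :: "('n \<Rightarrow> 'n series) \<Rightarrow> 'n list \<Rightarrow> 'n series"
  where "nc_word f [] = nc_one"
  | "nc_word f (i # \<alpha>) = nc_mult (f i) (nc_word f \<alpha>)"

text \<open>The series \<open>\<Sum>\<^sub>\<alpha> a\<^sub>\<alpha> f\<^sub>\<alpha>\<close>, i.e. the substitution of \<open>f\<close> in \<open>\<Sum>\<^sub>\<alpha> a\<^sub>\<alpha> Z\<^sub>\<alpha>\<close>, formed coefficientwise.
  It is only used when \<open>a\<close> has finite support or \<open>f\<close> has zero constant terms; then each
  coefficient is a finite sum.\<close>

definition nc_subst :: "'n series \<Rightarrow> ('n \<Rightarrow> 'n series) \<Rightarrow> 'n series"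
  where "nc_subst a f w = (\<Sum>\<^sub>\<infinity>\<alpha>. a \<alpha> * nc_word f \<alpha> w)"

definition nc_polynomial :: "'n series \<Rightarrow> bool"
  where "nc_polynomial p \<longleftrightarrow> finite {w. p w \<noteq> 0}"

definition square_summable :: "'n series \<Rightarrow> bool"
  where "square_summable a \<longleftrightarrow> (\<lambda>\<alpha>. (norm (a \<alpha>))\<^sup>2) summable_on UNIV"

definition nc_radius :: "'n::finite series \<Rightarrow> ereal"
  where "nc_radius a = conv_radius (\<lambda>k. sqrt (\<Sum>\<alpha> | length \<alpha> = k. (norm (a \<alpha>))\<^sup>2))"


section \<open>Evaluation at operator tuples\<close>

primrec op_word :: "('n \<Rightarrow> 'h \<Rightarrow> 'h) \<Rightarrow> 'n list \<Rightarrow> 'h \<Rightarrow> 'h"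
  where "op_word X [] = id"
  | "op_word X (i # \<alpha>) = X i \<circ> op_word X \<alpha>"

definition nc_homog ::
    "'n::finite series \<Rightarrow> nat \<Rightarrow> ('n \<Rightarrow> 'h \<Rightarrow> 'h) \<Rightarrow> 'h::complex_inner \<Rightarrow> 'h"
  where "nc_homog c k X x = (\<Sum>\<alpha> | length \<alpha> = k. c \<alpha> *\<^sub>C op_word X \<alpha> x)"

definition value_SOT ::
    "('n::finite \<Rightarrow> 'n series) \<Rightarrow> ('n \<Rightarrow> 'h \<Rightarrow> 'h) \<Rightarrow> ('n \<Rightarrow> 'h::complex_inner \<Rightarrow> 'h) \<Rightarrow> bool"
  where "value_SOT f X F \<longleftrightarrow> (\<forall>j. sot_sums (\<lambda>k. nc_homog (f j) k X) (F j))"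

definition value_rad ::
    "('n::finite \<Rightarrow> 'n series) \<Rightarrow> ('n \<Rightarrow> 'h \<Rightarrow> 'h) \<Rightarrow> ('n \<Rightarrow> 'h::complex_inner \<Rightarrow> 'h) \<Rightarrow> bool"
  where "value_rad f X F \<longleftrightarrow> (\<exists>\<delta> G. 0 < \<delta> \<and> \<delta> < 1 \<and>
    (\<forall>r j. \<delta> < r \<and> r < 1 \<longrightarrow> norm_sums (\<lambda>k. nc_homog (f j) k (\<lambda>i x. r *\<^sub>R X i x)) (G r j)) \<and>
    (\<forall>j. sot_lim (\<lambda>r. G r j) (F j) (at_left (1::real))))"

definition conv_SOT :: "('n::finite \<Rightarrow> 'n series) \<Rightarrow> ('n \<Rightarrow> 'h::complex_inner \<Rightarrow> 'h) set"
  where "conv_SOT f = {X. (\<forall>i. bounded_clinear (X i)) \<and> (\<exists>F. value_SOT f X F)}"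

definition conv_rad :: "('n::finite \<Rightarrow> 'n series) \<Rightarrow> ('n \<Rightarrow> 'h::complex_inner \<Rightarrow> 'h) set"
  where "conv_rad f = {X. (\<forall>i. bounded_clinear (X i)) \<and> (\<exists>F. value_rad f X F)}"

text \<open>The tuple \<open>f(X)\<close>. If \<open>X\<close> is in both convergence sets, the two values agree by Abel's limit
  theorem; see \<open>value_unique\<close> below.\<close>

definition nc_calc ::
    "('n::finite \<Rightarrow> 'n series) \<Rightarrow> ('n \<Rightarrow> 'h \<Rightarrow> 'h) \<Rightarrow> 'n \<Rightarrow> 'h::complex_inner \<Rightarrow> 'h"
  where "nc_calc f X = (THE F. value_SOT f X F \<or> value_rad f X F)"

lemma abel_limit:
  fixes a :: "nat \<Rightarrow> 'v::real_normed_vector"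
  assumes a: "(\<lambda>N. \<Sum>k<N. a k) \<longlonglongrightarrow> s"
    and \<delta>: "0 < \<delta>" "\<delta> < 1"
    and G: "\<And>r. \<delta> < r \<Longrightarrow> r < 1 \<Longrightarrow> (\<lambda>N. \<Sum>k<N. r ^ k *\<^sub>R a k) \<longlonglongrightarrow> G r"
  shows "(G \<longlongrightarrow> s) (at_left 1)"
proof -
  define t where "t N = (\<Sum>k<N. a k) - s" for N
  have t0: "t \<longlonglongrightarrow> 0" unfolding t_def using a by (rule LIM_zero)
  then obtain B where B: "\<And>k. norm (t k) \<le> B"
    using convergent_imp_Bseq[of t] unfolding Bseq_def convergent_def by blast
  have B0: "0 \<le> B" using norm_ge_zero B order_trans by blast
  have parts: "(\<Sum>k<N. r ^ k *\<^sub>R a k) - s = (1 - r) *\<^sub>R (\<Sum>k<N. r ^ k *\<^sub>R t (Suc k)) + r ^ N *\<^sub>R t N"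
    for r N
  proof (induction N)
    case (Suc N)
    have aN: "a N = t (Suc N) - t N" by (simp add: t_def)
    have "(\<Sum>k<Suc N. r ^ k *\<^sub>R a k) - s = ((\<Sum>k<N. r ^ k *\<^sub>R a k) - s) + r ^ N *\<^sub>R a N"
      by simp
    then show ?case unfolding Suc aN by (simp add: algebra_simps)
  qed (simp add: t_def)
  have "\<forall>\<^sub>F r in at_left 1. dist (G r) s < e" if "e > 0" for e
  proof -
    have "e / 3 > 0" using that by simp
    from LIMSEQ_D[OF t0 this] obtain K where K: "\<And>k. k \<ge> K \<Longrightarrow> norm (t k) < e / 3"
      unfolding diff_0_right by blast
    have le: "norm (G r - s) \<le> (1 - r) * (K * B) + e / 3" if r: "\<delta> < r" "r < 1" for r
    proof (rule LIMSEQ_le)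
      show "(\<lambda>N. norm ((\<Sum>k<N. r ^ k *\<^sub>R a k) - s)) \<longlonglongrightarrow> norm (G r - s)"
        by (rule tendsto_norm[OF tendsto_diff[OF G[OF r] tendsto_const]])
      have "(\<lambda>N. (1 - r) * (K * B) + e / 3 + r ^ N * B) \<longlonglongrightarrow> (1 - r) * (K * B) + e / 3 + 0 * B"
        using r \<delta> by (intro tendsto_intros LIMSEQ_power_zero) auto
      then show "(\<lambda>N. (1 - r) * (K * B) + e / 3 + r ^ N * B) \<longlonglongrightarrow> (1 - r) * (K * B) + e / 3" by simp
      have "norm ((\<Sum>k<N. r ^ k *\<^sub>R a k) - s) \<le> (1 - r) * (K * B) + e / 3 + r ^ N * B" for N
      proof -
        have r0: "0 < r" using r \<delta> by simp
        have "norm (\<Sum>k<N. r ^ k *\<^sub>R t (Suc k)) \<le> (\<Sum>k<N. r ^ k * norm (t (Suc k)))"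
          using r0 by (intro order_trans[OF norm_sum] sum_mono) simp
        also have "\<dots> \<le> (\<Sum>k<N. (if k < K then B else 0) + r ^ k * (e / 3))"
        proof (rule sum_mono)
          fix k
          have p: "0 \<le> r ^ k" "r ^ k \<le> 1" using r r0 by (auto simp: power_le_one)
          show "r ^ k * norm (t (Suc k)) \<le> (if k < K then B else 0) + r ^ k * (e / 3)"
          proof (cases "k < K")
            case True
            have "r ^ k * norm (t (Suc k)) \<le> 1 * B"
              using p B B0 by (intro mult_mono) auto
            moreover have "0 \<le> r ^ k * (e / 3)" using p \<open>e > 0\<close> by simp
            ultimately show ?thesis using True by simp
          next
            case False
            then have "norm (t (Suc k)) \<le> e / 3" using K[of "Suc k"] by simp
            from mult_left_mono[OF this p(1)] show ?thesis using False by simp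
          qed
        qed
        also have "\<dots> = (\<Sum>k<N. if k < K then B else 0) + (\<Sum>k<N. r ^ k) * (e / 3)"
          by (simp only: sum.distrib sum_distrib_right)
        also have "(\<Sum>k<N. if k < K then B else 0) = card ({..<N} \<inter> {..<K}) * B"
        proof -
          have "(\<Sum>k<N. if k < K then B else 0) = (\<Sum>k\<in>{..<N} \<inter> {..<K}. B)"
            unfolding sum.inter_restrict[OF finite_lessThan] by (intro sum.cong) auto
          then show ?thesis by simp
        qed
        also have "\<dots> \<le> K * B"
          using B0 card_mono[of "{..<K}" "{..<N} \<inter> {..<K}"] by (intro mult_right_mono) auto
        finally have *: "norm (\<Sum>k<N. r ^ k *\<^sub>R t (Suc k)) \<le> K * B + (\<Sum>k<N. r ^ k) * (e / 3)"
          by simp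
        have geo: "(1 - r) * (\<Sum>k<N. r ^ k) \<le> 1"
          using r0 r by (simp add: sum_gp_strict)
        have "norm ((\<Sum>k<N. r ^ k *\<^sub>R a k) - s)
            \<le> (1 - r) * norm (\<Sum>k<N. r ^ k *\<^sub>R t (Suc k)) + r ^ N * norm (t N)"
          unfolding parts using r r0 by (intro norm_triangle_le) simp
        also have "\<dots> \<le> (1 - r) * (K * B + (\<Sum>k<N. r ^ k) * (e / 3)) + r ^ N * B"
          using r r0 B by (intro add_mono mult_left_mono *) auto
        also have "\<dots> = (1 - r) * (K * B) + ((1 - r) * (\<Sum>k<N. r ^ k)) * (e / 3) + r ^ N * B"
          by (simp only: distrib_left mult.assoc)
        also have "\<dots> \<le> (1 - r) * (K * B) + 1 * (e / 3) + r ^ N * B"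
          by (intro add_mono mult_right_mono order_refl geo) (use \<open>e > 0\<close> in simp)
        finally show ?thesis by simp
      qed
      then show "\<exists>N0. \<forall>N\<ge>N0. norm ((\<Sum>k<N. r ^ k *\<^sub>R a k) - s)
          \<le> (1 - r) * (K * B) + e / 3 + r ^ N * B" by blast
    qed
    have "((\<lambda>r. (1 - r) * (K * B) + e / 3) \<longlongrightarrow> (1 - 1) * (K * B) + e / 3) (at_left 1)"
      by (intro tendsto_add tendsto_mult tendsto_diff tendsto_const tendsto_ident_at)
    then have "\<forall>\<^sub>F r in at_left 1. (1 - r) * (K * B) + e / 3 < e"
      by (rule order_tendstoD(2)) (use that in simp)
    moreover have "\<forall>\<^sub>F r in at_left 1. \<delta> < r \<and> r < 1"
      using eventually_at_left_real[OF \<delta>(2)] by eventually_elim auto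
    ultimately show ?thesis
      by eventually_elim (use le in \<open>force simp: dist_norm\<close>)
  qed
  then show ?thesis by (simp add: tendsto_iff)
qed

lemma bounded_clinear_op_word:
  "(\<And>i. bounded_clinear (X i)) \<Longrightarrow> bounded_clinear (op_word X \<alpha>)"
proof (induction \<alpha>)
  case (Cons i \<alpha>)
  then show ?case
    using bounded_linear_compose[of "X i" "op_word X \<alpha>"]
    by (auto simp: bounded_clinear_def o_def)
qed (simp add: bounded_clinear_def id_def)

lemma bounded_linear_scaleC: "bounded_linear (\<lambda>x::'a::complex_inner. c *\<^sub>C x)"
  by (rule bounded_linear_intro[of _ "norm c"])
    (auto simp: scaleC_add_right scaleC_scaleC scaleR_eq_scaleC norm_scaleC mult.commute)

lemma bounded_linear_nc_homog:
  assumes "\<And>i. bounded_clinear (X i)"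
  shows "bounded_linear (nc_homog c k X)"
  unfolding nc_homog_def[abs_def]
  using bounded_clinear_op_word[of X, OF assms]
  by (intro bounded_linear_sum bounded_linear_compose[OF bounded_linear_scaleC])
    (auto simp: bounded_clinear_def)

lemma op_word_scaleR:
  assumes "\<And>i. bounded_clinear (X i)"
  shows "op_word (\<lambda>i x. r *\<^sub>R X i x) \<alpha> x = r ^ length \<alpha> *\<^sub>R op_word X \<alpha> x"
proof (induction \<alpha>)
  case (Cons i \<alpha>)
  have "linear (X i)" using assms by (simp add: bounded_clinear_def bounded_linear.linear)
  then show ?case by (simp add: Cons.IH linear_scale)
qed simp

lemma nc_homog_scaleR:
  assumes "\<And>i. bounded_clinear (X i)"
  shows "nc_homog c k (\<lambda>i x. r *\<^sub>R X i x) x = r ^ k *\<^sub>R nc_homog c k X x"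
  unfolding nc_homog_def scaleR_sum_right
  by (intro sum.cong)
    (auto simp: op_word_scaleR[OF assms] scaleR_eq_scaleC[of "_ ^ _"] scaleC_scaleC mult.commute)

lemma value_rad_pointwise:
  assumes X: "\<And>i. bounded_clinear (X i)" and "value_rad f X F"
  obtains \<delta> G where "0 < \<delta>" "\<delta> < 1"
    "\<And>r j x. \<delta> < r \<Longrightarrow> r < 1 \<Longrightarrow> (\<lambda>N. \<Sum>k<N. r ^ k *\<^sub>R nc_homog (f j) k X x) \<longlonglongrightarrow> G r j x"
    "\<And>j x. ((\<lambda>r. G r j x) \<longlongrightarrow> F j x) (at_left 1)"
proof -
  from assms(2) obtain \<delta> G where \<delta>: "0 < \<delta>" "\<delta> < 1"
    and N: "\<And>r j. \<delta> < r \<Longrightarrow> r < 1 \<Longrightarrow>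
          norm_sums (\<lambda>k. nc_homog (f j) k (\<lambda>i x. r *\<^sub>R X i x)) (G r j)"
    and L: "\<And>j. sot_lim (\<lambda>r. G r j) (F j) (at_left 1)"
    unfolding value_rad_def by blast
  have "(\<lambda>N. \<Sum>k<N. r ^ k *\<^sub>R nc_homog (f j) k X x) \<longlonglongrightarrow> G r j x" if "\<delta> < r" "r < 1" for r j x
  proof -
    let ?D = "\<lambda>N x. (\<Sum>k<N. nc_homog (f j) k (\<lambda>i x. r *\<^sub>R X i x) x) - G r j x"
    have n: "bounded_clinear (G r j)" "(\<lambda>N. onorm (?D N)) \<longlonglongrightarrow> 0"
      using N[OF that, of j] by (auto simp: norm_sums_def)
    have "bounded_linear (?D N)" for N
      unfolding nc_homog_scaleR[OF X] using n(1)
      by (intro bounded_linear_sub bounded_linear_sum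
          bounded_linear_compose[OF bounded_linear_scaleR_right] bounded_linear_nc_homog X)
        (simp add: bounded_clinear_def)
    then have le: "norm (?D N x) \<le> onorm (?D N) * norm x" for N by (rule onorm)
    have "(\<lambda>N. onorm (?D N) * norm x) \<longlonglongrightarrow> 0"
      using tendsto_mult_right[OF n(2), of "norm x"] by simp
    then have "(\<lambda>N. ?D N x) \<longlonglongrightarrow> 0"
      by (rule Lim_null_comparison[OF always_eventually, rotated]) (intro allI le)
    then show ?thesis
      unfolding nc_homog_scaleR[OF X] by (rule LIM_zero_cancel)
  qed
  moreover have "((\<lambda>r. G r j x) \<longlongrightarrow> F j x) (at_left 1)" for j x
    using L[of j] unfolding sot_lim_def by blast
  ultimately show thesis by (rule that[OF \<delta>])
qed

lemma value_unique:
  assumes X: "\<And>i. bounded_clinear (X i)"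
    and F: "value_SOT f X F \<or> value_rad f X F" and F': "value_SOT f X F' \<or> value_rad f X F'"
  shows "F = F'"
proof -
  have sot: "(\<lambda>N. \<Sum>k<N. nc_homog (f j) k X x) \<longlonglongrightarrow> F j x" if "value_SOT f X F" for F j x
    using that by (simp add: value_SOT_def sot_sums_def sot_lim_def)
  have mixed: "F j x = F' j x" if h: "value_SOT f X F" "value_rad f X F'" for F F' j x
  proof -
    obtain d G where 1: "0 < d" "d < 1"
      "\<And>r j x. d < r \<Longrightarrow> r < 1 \<Longrightarrow> (\<lambda>N. \<Sum>k<N. r ^ k *\<^sub>R nc_homog (f j) k X x) \<longlonglongrightarrow> G r j x"
      "\<And>j x. ((\<lambda>r. G r j x) \<longlongrightarrow> F' j x) (at_left 1)"
      by (rule value_rad_pointwise[OF X h(2)]) blast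
    have "((\<lambda>r. G r j x) \<longlongrightarrow> F j x) (at_left 1)"
      by (rule abel_limit[OF sot[OF h(1)] 1(1,2)]) (rule 1(3))
    then show ?thesis by (rule tendsto_unique[OF trivial_limit_at_left_real _ 1(4)])
  qed
  have "F j x = F' j x" if h: "value_rad f X F" "value_rad f X F'" for j x
  proof -
    obtain d G where 1: "0 < d" "d < 1"
      "\<And>r j x. d < r \<Longrightarrow> r < 1 \<Longrightarrow> (\<lambda>N. \<Sum>k<N. r ^ k *\<^sub>R nc_homog (f j) k X x) \<longlonglongrightarrow> G r j x"
      "\<And>j x. ((\<lambda>r. G r j x) \<longlongrightarrow> F j x) (at_left 1)"
      by (rule value_rad_pointwise[OF X h(1)]) blast
    obtain d' G' where 2: "0 < d'" "d' < 1"
      "\<And>r j x. d' < r \<Longrightarrow> r < 1 \<Longrightarrow> (\<lambda>N. \<Sum>k<N. r ^ k *\<^sub>R nc_homog (f j) k X x) \<longlonglongrightarrow> G' r j x"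
      "\<And>j x. ((\<lambda>r. G' r j x) \<longlongrightarrow> F' j x) (at_left 1)"
      by (rule value_rad_pointwise[OF X h(2)]) blast
    have "\<forall>\<^sub>F r in at_left 1. G r j x = G' r j x"
      using eventually_at_left_real[OF 1(2)] eventually_at_left_real[OF 2(2)]
      by eventually_elim (rule LIMSEQ_unique[OF 1(3) 2(3)]; simp)
    then have "((\<lambda>r. G r j x) \<longlongrightarrow> F' j x) (at_left 1)"
      using 2(4)[of j x] by (simp add: tendsto_cong)
    then show ?thesis by (rule tendsto_unique[OF trivial_limit_at_left_real 1(4)])
  qed
  moreover have "F j x = F' j x" if "value_SOT f X F" "value_SOT f X F'" for j x
    using sot[OF that(1)] sot[OF that(2)] LIMSEQ_unique by blast
  ultimately show ?thesis using F F' mixed[of F F'] mixed[of F' F] by (intro ext) metis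
qed

lemma nc_calc_eq:
  assumes "\<And>i. bounded_clinear (X i)" "value_SOT f X F \<or> value_rad f X F"
  shows "nc_calc f X = F"
  unfolding nc_calc_def
proof (rule the_equality)
  show "value_SOT f X F \<or> value_rad f X F" by (rule assms)
  show "F' = F" if "value_SOT f X F' \<or> value_rad f X F'" for F'
    by (rule value_unique[OF assms(1) that assms(2)])
qed


section \<open>The model property\<close>

text \<open>
  In all three cases the space \<open>H\<^sup>2(f)\<close> carries the inner product for which the \<open>f\<^sub>\<alpha>\<close> are
  orthonormal and consists of the (limits of) sums \<open>\<Sum>\<^sub>\<alpha> a\<^sub>\<alpha> f\<^sub>\<alpha>\<close> with square-summable
  coefficients. It is realized here on \<open>('n list, complex) l2\<close>: the family \<open>a\<close> stands for
  the element \<open>\<Sum>\<^sub>\<alpha> a\<^sub>\<alpha> f\<^sub>\<alpha>\<close>. Multiplication operators are defined through the elements represented, i.e.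
  through products of polynomials, of formal power series, or of operator-valued
  functions, respectively.

  The argument \<open>g\<close> is the tuple of coefficient families of the coordinates \<open>Z\<^sub>i = \<Sum>\<^sub>\<alpha> a\<^sup>i\<^sub>\<alpha> f\<^sub>\<alpha>\<close>, and \<open>MZ\<close> is
  the tuple of left multiplications by \<open>Z\<^sub>i\<close>; both are determined by \<open>f\<close>.
\<close>

text \<open>Case (A): the completion of the polynomials. The families of finite support represent the
  polynomials, and multiplication by \<open>Z\<^sub>i\<close> is extended continuously from these.\<close>

definition model_A ::
    "('n::finite \<Rightarrow> 'n series) \<Rightarrow> ('n \<Rightarrow> 'n series) \<Rightarrow>
     ('n \<Rightarrow> ('n list, complex) l2 \<Rightarrow> ('n list, complex) l2) \<Rightarrow> bool"
  where "model_A f g MZ \<longleftrightarrow>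
    (\<forall>i. nc_polynomial (f i)) \<and> (\<forall>i. nc_polynomial (g i)) \<and>
    (\<forall>i. nc_subst (f i) g = nc_var i) \<and> (\<forall>i. nc_subst (g i) f = nc_var i) \<and>
    (\<forall>i. bounded_clinear (MZ i) \<and>
      (\<forall>x. nc_polynomial (Rep_l2 x) \<longrightarrow> nc_polynomial (Rep_l2 (MZ i x)) \<and>
        nc_subst (Rep_l2 (MZ i x)) f = nc_mult (nc_var i) (nc_subst (Rep_l2 x) f)))"

text \<open>Case (S): formal power series. \<open>series_mult_op f p M\<close> says that left multiplication by the
  series \<open>p\<close> is a bounded operator on \<open>H\<^sup>2(f)\<close>, namely \<open>M\<close>.\<close>

definition series_mult_op ::
    "('n::finite \<Rightarrow> 'n series) \<Rightarrow> 'n series \<Rightarrow> (('n list, complex) l2 \<Rightarrow> ('n list, complex) l2) \<Rightarrow> bool"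
  where "series_mult_op f p M \<longleftrightarrow> bounded_clinear M \<and>
    (\<forall>x. nc_subst (Rep_l2 (M x)) f = nc_mult p (nc_subst (Rep_l2 x) f))"

definition model_S ::
    "('n::finite \<Rightarrow> 'n series) \<Rightarrow> ('n \<Rightarrow> 'n series) \<Rightarrow>
     ('n \<Rightarrow> ('n list, complex) l2 \<Rightarrow> ('n list, complex) l2) \<Rightarrow> bool"
  where "model_S f g MZ \<longleftrightarrow>
    (\<forall>i. f i [] = 0) \<and> (\<forall>i. nc_radius (f i) > 0) \<and> det (\<chi> i j. f i [j]) \<noteq> 0 \<and>
    (\<forall>i. square_summable (g i) \<and> nc_subst (g i) f = nc_var i) \<and>
    (\<forall>i. series_mult_op f (nc_var i) (MZ i)) \<and>
    MZ \<in> conv_SOT f \<union> conv_rad f \<and>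
    (\<forall>j. series_mult_op f (f j) (nc_calc f MZ j))"

text \<open>Case (F): free holomorphic functions on operator balls over a fixed separable
  infinite-dimensional Hilbert space.\<close>

type_synonym sep_hilbert = "(nat, complex) l2"

definition op_ball :: "real \<Rightarrow> ('n::finite \<Rightarrow> sep_hilbert \<Rightarrow> sep_hilbert) set"
  where "op_ball \<gamma> = {X. (\<forall>i. bounded_clinear (X i)) \<and> row_norm X < \<gamma>}"

definition hol_eval ::
    "'n::finite series \<Rightarrow> ('n \<Rightarrow> sep_hilbert \<Rightarrow> sep_hilbert) \<Rightarrow> sep_hilbert \<Rightarrow> sep_hilbert"
  where "hol_eval c X = (THE S. norm_sums (\<lambda>k. nc_homog c k X) S)"

definition hol_tuple ::
    "('n::finite \<Rightarrow> 'n series) \<Rightarrow> ('n \<Rightarrow> sep_hilbert \<Rightarrow> sep_hilbert) \<Rightarrow> 'n \<Rightarrow> sep_hilbert \<Rightarrow> sep_hilbert"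
  where "hol_tuple f X = (\<lambda>j. hol_eval (f j) X)"

definition fun_mult_op ::
    "real \<Rightarrow> ('n::finite \<Rightarrow> 'n series) \<Rightarrow>
     (('n \<Rightarrow> sep_hilbert \<Rightarrow> sep_hilbert) \<Rightarrow> sep_hilbert \<Rightarrow> sep_hilbert) \<Rightarrow>
     (('n list, complex) l2 \<Rightarrow> ('n list, complex) l2) \<Rightarrow> bool"
  where "fun_mult_op \<gamma> f \<phi> M \<longleftrightarrow> bounded_clinear M \<and>
    (\<forall>x. \<forall>X\<in>op_ball \<gamma>.
      hol_eval (Rep_l2 (M x)) (hol_tuple f X) = \<phi> X \<circ> hol_eval (Rep_l2 x) (hol_tuple f X))"

definition model_F ::
    "('n::finite \<Rightarrow> 'n series) \<Rightarrow> ('n \<Rightarrow> 'n series) \<Rightarrow>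
     ('n \<Rightarrow> ('n list, complex) l2 \<Rightarrow> ('n list, complex) l2) \<Rightarrow> bool"
  where "model_F f g MZ \<longleftrightarrow> (\<exists>\<gamma>>0.
    (\<forall>i. nc_radius (f i) \<ge> ereal \<gamma>) \<and>
    (\<forall>X\<in>op_ball \<gamma>. hol_tuple f X \<in> op_ball 1) \<and>
    (\<forall>G. nc_radius G \<ge> 1 \<and> G \<noteq> (\<lambda>_. 0) \<longrightarrow>
      (\<exists>X\<in>op_ball \<gamma>. hol_eval G (hol_tuple f X) \<noteq> (\<lambda>_. 0))) \<and>
    (\<forall>i. square_summable (g i) \<and> (\<forall>X\<in>op_ball \<gamma>. hol_eval (g i) (hol_tuple f X) = X i)) \<and>
    (\<forall>i. fun_mult_op \<gamma> f (\<lambda>X. X i) (MZ i)) \<and>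
    MZ \<in> conv_SOT f \<union> conv_rad f \<and>
    (\<forall>j. fun_mult_op \<gamma> f (hol_eval (f j)) (nc_calc f MZ j)))"

definition model_property ::
    "('n::finite \<Rightarrow> 'n series) \<Rightarrow> ('n \<Rightarrow> 'n series) \<Rightarrow>
     ('n \<Rightarrow> ('n list, complex) l2 \<Rightarrow> ('n list, complex) l2) \<Rightarrow> bool"
  where "model_property f g MZ \<longleftrightarrow> model_A f g MZ \<or> model_S f g MZ \<or> model_F f g MZ"


section \<open>The noncommutative domain and compressions of the universal model\<close>

definition inverse_at ::
    "('n::finite \<Rightarrow> 'n series) \<Rightarrow> ('n \<Rightarrow> 'n series) \<Rightarrow> ('n \<Rightarrow> 'h::complex_inner \<Rightarrow> 'h) \<Rightarrow> bool"
  where "inverse_at f g X \<longleftrightarrow> X \<in> conv_SOT f \<union> conv_rad f \<and>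
    (value_SOT g (nc_calc f X) X \<or> value_rad g (nc_calc f X) X)"

definition nc_domain ::
    "('n::finite \<Rightarrow> 'n series) \<Rightarrow> ('n \<Rightarrow> 'n series) \<Rightarrow> ('n \<Rightarrow> 'h::complex_inner \<Rightarrow> 'h) set"
  where "nc_domain f g = {X. (\<forall>i. bounded_clinear (X i)) \<and> inverse_at f g X \<and>
    row_norm (nc_calc f X) \<le> 1}"

definition pure_tuple ::
    "('n::finite \<Rightarrow> 'n series) \<Rightarrow> ('n \<Rightarrow> 'h::complex_inner \<Rightarrow> 'h) \<Rightarrow> bool"
  where "pure_tuple f T \<longleftrightarrow>
    sot_lim (\<lambda>k x. \<Sum>\<alpha> | length \<alpha> = k.
        op_word (nc_calc f T) \<alpha> (cadj (op_word (nc_calc f T) \<alpha>) x))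
      (\<lambda>_. 0) sequentially"

text \<open>\<open>T\<close> is unitarily equivalent to a compression of \<open>MZ \<otimes> I\<^sub>D\<close> to a co-invariant subspace.
  The Hilbert space \<open>D\<close> is given as a closed subspace of a Hilbert space type, since HOL cannot
  quantify existentially over types: a statement that such a \<open>D\<close> exists should name a type
  large enough to contain it, and a statement assuming one should leave the type arbitrary.\<close>

definition model_compression ::
    "('n::finite \<Rightarrow> ('n list, complex) l2 \<Rightarrow> ('n list, complex) l2) \<Rightarrow> 'd::complex_inner set \<Rightarrow>
     ('n \<Rightarrow> 'h::complex_inner \<Rightarrow> 'h) \<Rightarrow> bool"
  where "model_compression MZ D T \<longleftrightarrow>
    (\<exists>M. closed_csubspace M \<and> M \<subseteq> tensor_space D \<and> (\<forall>i. co_invariant M (tens_op (MZ i))) \<and>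
         unitarily_equivalent_on T M (\<lambda>i. orth_proj M \<circ> tens_op (MZ i)))"

end

theory Submission
  imports Defs
begin

text \<open>In all three cases of the model property, \<open>M\<^sub>Z\<close> and the creation operators \<open>S\<close> on words determine
  each other: \<open>f(M\<^sub>Z) = S\<close>, and \<open>M\<^bsub>Z\<^sub>i\<^esub>\<close> is left multiplication by \<open>g\<^sub>i\<close>, so \<open>g(S) = M\<^sub>Z\<close> in the radial sense.
  If \<open>T\<close> is pure in the domain, the Poisson kernel \<open>K\<close> of the pure row contraction \<open>F = f(T)\<close> is an
  isometry with \<open>F\<^sub>i K\<^sup>* = K\<^sup>* (S\<^sub>i \<otimes> I)\<close>. Applying \<open>g\<close> to this relation gives
  \<open>T\<^sub>i K\<^sup>* = K\<^sup>* (M\<^bsub>Z\<^sub>i\<^esub> \<otimes> I)\<close>, which says that \<open>T\<close> is the compression to the co-invariant range of \<open>K\<close>.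
  Conversely, for a compression one applies first \<open>f\<close> and then \<open>g\<close> to the intertwining relation, and
  row contractivity and purity of \<open>f(T)\<close> are inherited from \<open>S \<otimes> I\<close>.\<close>

section \<open>Operators and adjoints\<close>

text \<open>The delicate object is g(S). The coefficients of \<open>g i\<close> are only
  square-summable, so the series at S need not converge strongly, and the direct estimate at rS
  grows like 1/(1 - r). The radial limit exists because the norm of g_i(rS) never exceeds that of
  \<open>MZ i\<close>. This bound comes from dilating rS, itself a pure row contraction, to S
  \<otimes> I, so the Poisson kernel serves the model operators before it serves T. Square roots
  enter twice: in the defect operator of that kernel, and in showing that A \<otimes> I has norm at
  most that of A.

  What separates the three cases is only the reason why a coefficient family is determined by its
  composition with f: a polynomial inverse, an invertible Jacobian, or the nondegeneracy hypothesis
  on the range of f. Once this is used, no case distinction remains.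

  Strong and radial values are both preserved by amplification and by compressions W(.)V with W V =
  1, so it never matters in which of the two modes f or g converges.\<close>

instance chilbert_space \<subseteq> banach ..

section \<open>Algebra of complex scalars and of the sesquilinear form\<close>

lemma scaleC_one [simp]: "(1::complex) *\<^sub>C x = x" for x :: "'a::complex_inner"
  using scaleR_eq_scaleC[of 1 x] by simp

lemma scaleC_zero_left [simp]: "(0::complex) *\<^sub>C x = 0" for x :: "'a::complex_inner"
  using scaleR_eq_scaleC[of 0 x] by simp

lemma scaleC_zero_right [simp]: "c *\<^sub>C (0::'a::complex_inner) = 0"
  using norm_scaleC[of c "0::'a"] by simp

lemma scaleC_diff_right: "c *\<^sub>C (x - y) = c *\<^sub>C x - c *\<^sub>C y" for x :: "'a::complex_inner"
  using scaleC_add_right[of c "x - y" y] by simp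

lemma scaleC_diff_left: "(a - b) *\<^sub>C x = a *\<^sub>C x - b *\<^sub>C x" for x :: "'a::complex_inner"
  using scaleC_add_left[of "a - b" b x] by simp

lemma scaleC_sum_right: "c *\<^sub>C (\<Sum>i\<in>F. x i) = (\<Sum>i\<in>F. c *\<^sub>C x i)" for x :: "'i \<Rightarrow> 'a::complex_inner"
  by (induction F rule: infinite_finite_induct) (auto simp: scaleC_add_right)

lemma cinner_zero_left [simp]: "cinner 0 y = 0" for y :: "'a::complex_inner"
  using cinner_scaleC_left[of 0 0 y] by simp

lemma cinner_zero_right [simp]: "cinner y 0 = 0" for y :: "'a::complex_inner"
  using cinner_commute[of y 0] by simp

lemma cinner_diff_left: "cinner (x - y) z = cinner x z - cinner y z" for x :: "'a::complex_inner"
  using cinner_add_left[of "x - y" y z] by simp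

lemma cinner_diff_right: "cinner x (y - z) = cinner x y - cinner x z" for x :: "'a::complex_inner"
  using cinner_add_right[of x "y - z" z] by simp

lemma cinner_sum_left: "cinner (\<Sum>i\<in>F. x i) y = (\<Sum>i\<in>F. cinner (x i) y)" for y :: "'a::complex_inner"
  by (induction F rule: infinite_finite_induct) (auto simp: cinner_add_left)

lemma cinner_sum_right: "cinner y (\<Sum>i\<in>F. x i) = (\<Sum>i\<in>F. cinner y (x i))" for y :: "'a::complex_inner"
  by (induction F rule: infinite_finite_induct) (auto simp: cinner_add_right)

lemma cinner_self_eq_0: "cinner x x = 0 \<longleftrightarrow> x = 0" for x :: "'a::complex_inner"
  by (simp add: cinner_self)

lemma cinner_ext_left: "(\<And>z. cinner x z = cinner y z) \<Longrightarrow> x = y" for x :: "'a::complex_inner"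
  by (metis cinner_diff_left cinner_self_eq_0 eq_iff_diff_eq_0)

lemma cinner_ext_right: "(\<And>z. cinner z x = cinner z y) \<Longrightarrow> x = y" for x :: "'a::complex_inner"
  by (metis cinner_commute cinner_ext_left)

lemma norm_square_eq_Re_cinner: "(norm x)\<^sup>2 = Re (cinner x x)" for x :: "'a::complex_inner"
  by (simp add: cinner_self)

lemma bounded_bilinear_cinner: "bounded_bilinear (cinner :: 'a::complex_inner \<Rightarrow> 'a \<Rightarrow> complex)"
proof
  show "\<exists>K. \<forall>a b::'a. norm (cinner a b) \<le> norm a * norm b * K"
    by (rule exI[of _ 1]) (simp add: norm_cinner_le)
qed (simp_all add: cinner_add_left cinner_add_right scaleR_eq_scaleC[of _ "_::'a"]
      cinner_scaleC_left cinner_scaleC_right scaleR_conv_of_real)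

lemmas tendsto_cinner = bounded_bilinear.tendsto[OF bounded_bilinear_cinner]

section \<open>Bounded complex-linear maps\<close>

lemma bounded_clinearI:
  assumes "\<And>x y. A (x + y) = A x + A y" "\<And>c x. A (c *\<^sub>C x) = c *\<^sub>C A x" "\<And>x. norm (A x) \<le> C * norm x"
  shows "bounded_clinear A"
  unfolding bounded_clinear_def
  using assms by (auto intro!: bounded_linear_intro[of _ C] simp: scaleR_eq_scaleC mult.commute)

lemma
  assumes "bounded_clinear A"
  shows bounded_clinear_add: "A (x + y) = A x + A y"
    and bounded_clinear_diff: "A (x - y) = A x - A y"
    and bounded_clinear_zero: "A 0 = 0"
    and bounded_clinear_scaleC: "A (c *\<^sub>C x) = c *\<^sub>C A x"
    and bounded_clinear_scaleR: "A (r *\<^sub>R x) = r *\<^sub>R A x"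
    and bounded_clinear_sum: "A (\<Sum>i\<in>F. z i) = (\<Sum>i\<in>F. A (z i))"
    and bounded_clinear_tendsto: "(h \<longlongrightarrow> l) G \<Longrightarrow> ((\<lambda>i. A (h i)) \<longlongrightarrow> A l) G"
    and bounded_clinear_onorm: "norm (A x) \<le> onorm A * norm x"
proof -
  have b: "bounded_linear A" and c: "\<And>c x. A (c *\<^sub>C x) = c *\<^sub>C A x"
    using assms by (auto simp: bounded_clinear_def)
  interpret bounded_linear A by (rule b)
  show "A (x + y) = A x + A y" "A (x - y) = A x - A y" "A 0 = 0" "A (r *\<^sub>R x) = r *\<^sub>R A x"
    "A (\<Sum>i\<in>F. z i) = (\<Sum>i\<in>F. A (z i))"
    by (simp_all add: add diff scaleR sum)
  show "A (c *\<^sub>C x) = c *\<^sub>C A x" by (rule c)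
  show "(h \<longlongrightarrow> l) G \<Longrightarrow> ((\<lambda>i. A (h i)) \<longlongrightarrow> A l) G" by (rule tendsto)
  show "norm (A x) \<le> onorm A * norm x" by (rule onorm[OF b])
qed

lemma bounded_clinear_id: "bounded_clinear (\<lambda>x. x)"
  by (rule bounded_clinearI[of _ 1]) auto

lemma bounded_clinear_const_zero: "bounded_clinear (\<lambda>x. 0)"
  by (rule bounded_clinearI[of _ 0]) auto

lemma bounded_clinear_compose:
  assumes "bounded_clinear A" "bounded_clinear B"
  shows "bounded_clinear (\<lambda>x. A (B x))"
  using assms bounded_linear_compose[of A B] by (simp add: bounded_clinear_def)

lemma bounded_clinear_comp:
  "bounded_clinear A \<Longrightarrow> bounded_clinear B \<Longrightarrow> bounded_clinear (A \<circ> B)"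
  unfolding o_def by (rule bounded_clinear_compose)

lemma bounded_clinear_sub:
  assumes "bounded_clinear A" "bounded_clinear B"
  shows "bounded_clinear (\<lambda>x. A x - B x)"
  using assms bounded_linear_sub[of A B]
  by (auto simp: bounded_clinear_def scaleC_diff_right)

lemma bounded_clinear_plus:
  assumes "bounded_clinear A" "bounded_clinear B"
  shows "bounded_clinear (\<lambda>x. A x + B x)"
  using assms bounded_linear_add[of A B]
  by (auto simp: bounded_clinear_def scaleC_add_right)

lemma bounded_clinear_sum_op:
  assumes "\<And>i. i \<in> F \<Longrightarrow> bounded_clinear (A i)"
  shows "bounded_clinear (\<lambda>x. \<Sum>i\<in>F. A i x)"
  using assms bounded_linear_sum[of F A]
  by (auto simp: bounded_clinear_def scaleC_sum_right)

lemma bounded_clinear_scaleC_op: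
  assumes "bounded_clinear A"
  shows "bounded_clinear (\<lambda>x. c *\<^sub>C A x)"
  using assms bounded_linear_compose[OF bounded_linear_scaleC[of c], of A]
  by (simp add: bounded_clinear_def scaleC_scaleC mult.commute)

lemma bounded_clinear_scaleR_op:
  "bounded_clinear A \<Longrightarrow> bounded_clinear (\<lambda>x. r *\<^sub>R A x)"
  unfolding scaleR_eq_scaleC by (rule bounded_clinear_scaleC_op)

lemmas bounded_clinear_intros = bounded_clinear_id bounded_clinear_sub
  bounded_clinear_plus bounded_clinear_sum_op bounded_clinear_scaleC_op bounded_clinear_scaleR_op

lemma bounded_clinear_nc_homog:
  "(\<And>i. bounded_clinear (X i)) \<Longrightarrow> bounded_clinear (nc_homog c k X)"
  unfolding nc_homog_def[abs_def] by (intro bounded_clinear_intros bounded_clinear_op_word)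

text \<open>The minimizer of \<open>(norm x)\<^sup>2 / 2 - f x\<close> represents \<open>f\<close>.\<close>

lemma real_riesz_representation:
  fixes f :: "'a::{real_inner,complete_space} \<Rightarrow> real"
  assumes "bounded_linear f"
  obtains y where "\<And>x. f x = inner x y"
proof -
  interpret bounded_linear f by fact
  define \<phi> where "\<phi> x = (norm x)\<^sup>2 / 2 - f x" for x
  define m where "m = Inf (range \<phi>)"
  have lb: "- (onorm f)\<^sup>2 / 2 \<le> \<phi> x" for x
  proof -
    have "f x \<le> onorm f * norm x" using onorm[OF assms, of x] by simp
    moreover have "2 * (onorm f * norm x) \<le> (onorm f)\<^sup>2 + (norm x)\<^sup>2"
      using sum_squares_bound[of "onorm f" "norm x"] by simp
    ultimately show ?thesis unfolding \<phi>_def by simp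
  qed
  then have bdd: "bdd_below (range \<phi>)" by (intro bdd_belowI2)
  have ge: "m \<le> \<phi> x" for x unfolding m_def by (rule cInf_lower[OF _ bdd]) simp
  define u where "u n = inverse (real (Suc n))" for n
  have "\<exists>x. \<phi> x < m + u n" for n
  proof -
    have "Inf (range \<phi>) < m + u n" by (simp add: m_def u_def)
    then show ?thesis using cInf_lessD[of "range \<phi>"] by blast
  qed
  then obtain X where X: "\<And>n. \<phi> (X n) < m + u n" by metis
  \<comment> \<open>Parallelogram law: at the midpoint \<open>\<phi>\<close> equals the average of
    its two values minus one eighth of the squared distance. As it is still at least
    \<open>m\<close> there, near-minimizers lie close together.\<close>
  have par: "(norm (x - y))\<^sup>2 \<le> 4 * (\<phi> x + \<phi> y - 2 * m)" for x y
  proof -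
    have "\<phi> ((1/2) *\<^sub>R (x + y)) = (\<phi> x + \<phi> y) / 2 - (norm (x - y))\<^sup>2 / 8"
      unfolding \<phi>_def scaleR add power2_norm_eq_inner
      by (simp add: inner_simps inner_commute field_simps)
    with ge[of "(1/2) *\<^sub>R (x + y)"] show ?thesis by (simp add: field_simps)
  qed
  have "Cauchy X"
  proof (rule metric_CauchyI)
    fix e :: real assume "e > 0"
    then obtain M where M: "u M < e\<^sup>2 / 8"
      using reals_Archimedean[of "e\<^sup>2 / 8"] by (auto simp: u_def)
    have "dist (X p) (X q) < e" if "p \<ge> M" "q \<ge> M" for p q
    proof -
      have "u p \<le> u M" "u q \<le> u M"
        using that by (auto simp: u_def intro!: le_imp_inverse_le)
      then have "4 * (\<phi> (X p) + \<phi> (X q) - 2 * m) < 4 * (e\<^sup>2 / 4)"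
        using X[of p] X[of q] M by (intro mult_strict_left_mono) linarith+
      then have "(norm (X p - X q))\<^sup>2 < e\<^sup>2"
        using par[of "X p" "X q"] by simp
      then show ?thesis using \<open>e > 0\<close> by (simp add: dist_norm power2_less_imp_less)
    qed
    then show "\<exists>M. \<forall>p\<ge>M. \<forall>q\<ge>M. dist (X p) (X q) < e" by blast
  qed
  then obtain y where y: "X \<longlonglongrightarrow> y"
    by (auto simp: Cauchy_convergent_iff convergent_def)
  have "(\<lambda>n. \<phi> (X n)) \<longlonglongrightarrow> \<phi> y"
    unfolding \<phi>_def by (intro tendsto_intros y tendsto) simp
  moreover have "(\<lambda>n. m + u n) \<longlonglongrightarrow> m"
    using tendsto_add[OF tendsto_const LIMSEQ_inverse_real_of_nat, of m]
    by (simp add: u_def)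
  ultimately have ym: "\<phi> y \<le> m"
    by (rule LIMSEQ_le) (use X less_imp_le in blast)
  have "f x = inner x y" for x
  proof (rule ccontr)
    define d where "d = inner x y - f x"
    assume "f x \<noteq> inner x y"
    then have d: "d \<noteq> 0" "x \<noteq> 0" by (auto simp: d_def zero)
    \<comment> \<open>The vertex of the parabola t d + t^2 |x|^2 / 2, which describes the change of
      \<open>\<phi>\<close> along the line through \<open>y\<close> in direction
      \<open>x\<close>.\<close>
    define t where "t = - d / (norm x)\<^sup>2"
    have "\<phi> (y + t *\<^sub>R x) = \<phi> y + t * d + t\<^sup>2 * (norm x)\<^sup>2 / 2"
      unfolding \<phi>_def add scaleR d_def power2_norm_eq_inner
      by (simp add: inner_simps inner_commute power2_eq_square algebra_simps)
    also have "\<dots> = \<phi> y - d\<^sup>2 / (2 * (norm x)\<^sup>2)"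
      using d by (simp add: t_def power2_eq_square field_simps)
    also have "\<dots> < \<phi> y" using d by simp
    finally show False using ge[of "y + t *\<^sub>R x"] ym by simp
  qed
  then show thesis by (rule that)
qed

text \<open>The imaginary part of f(x) is the real part of f(-ix). A vector that represents the real
  part for the real inner product therefore represents the whole functional.\<close>

lemma riesz_representation:
  fixes f :: "'a::chilbert_space \<Rightarrow> complex"
  assumes "bounded_linear f" "\<And>c x. f (c *\<^sub>C x) = c * f x"
  obtains y where "\<And>x. f x = cinner x y"
proof -
  have "bounded_linear (\<lambda>x. Re (f x))"
    by (rule bounded_linear_compose[OF bounded_linear_Re assms(1)])
  then obtain y where y: "\<And>x. Re (f x) = inner x y"
    using real_riesz_representation by blast
  have "f x = cinner x y" for x
  proof (rule complex_eqI)
    show "Re (f x) = Re (cinner x y)" by (simp add: y inner_eq_Re_cinner)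
    show "Im (f x) = Im (cinner x y)"
      using y[of "- \<i> *\<^sub>C x"] by (simp add: inner_eq_Re_cinner assms(2) cinner_scaleC_left)
  qed
  then show thesis by (rule that)
qed

section \<open>Adjoints and rows of operators\<close>

lemma cadj_eqI:
  assumes "\<And>x y. cinner (B y) x = cinner y (A x)"
  shows "cadj A = B"
  unfolding cadj_def
proof (rule the_equality)
  fix B' assume "\<forall>x y. cinner (B' y) x = cinner y (A x)"
  then show "B' = B" using assms by (metis cinner_ext_left ext)
qed (use assms in blast)

text \<open>For fixed \<open>y\<close>, pairing \<open>A x\<close> with \<open>y\<close> is a
  bounded functional on a complete space, so Riesz representation supplies the operator that the
  definite description \<open>cadj\<close> refers to.\<close>

lemma cinner_cadj_left:
  fixes A :: "'a::chilbert_space \<Rightarrow> 'b::complex_inner"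
  assumes A: "bounded_clinear A"
  shows "cinner (cadj A y) x = cinner y (A x)"
proof -
  have "\<exists>z. \<forall>x. cinner (A x) y = cinner x z" for y
  proof -
    have "bounded_linear (\<lambda>x. cinner (A x) y)"
    proof (rule bounded_linear_intro[of _ "onorm A * norm y"])
      show "norm (cinner (A x) y) \<le> norm x * (onorm A * norm y)" for x
        using norm_cinner_le[of "A x" y]
          mult_right_mono[OF bounded_clinear_onorm[OF A, of x], of "norm y"] by (simp add: mult_ac)
    qed (simp_all add: bounded_clinear_add[OF A] bounded_clinear_scaleR[OF A] cinner_add_left
          scaleR_eq_scaleC[of _ "A _"] cinner_scaleC_left scaleR_conv_of_real)
    then show ?thesis
      by (rule riesz_representation) (auto simp: bounded_clinear_scaleC[OF A] cinner_scaleC_left)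
  qed
  then obtain B where B: "\<And>x y. cinner (A x) y = cinner x (B y)" by metis
  have B': "cinner (B y) x = cinner y (A x)" for x y using B[of x y] by (metis cinner_commute)
  then have "cadj A = B" by (rule cadj_eqI)
  then show ?thesis by (simp add: B')
qed

lemma cinner_cadj_right:
  fixes A :: "'a::chilbert_space \<Rightarrow> 'b::complex_inner"
  assumes "bounded_clinear A"
  shows "cinner x (cadj A y) = cinner (A x) y"
  using cinner_cadj_left[OF assms, of y x] by (metis cinner_commute)

lemma norm_le_if_cinner_le:
  fixes x :: "'a::complex_inner"
  assumes "\<And>z. norm (cinner x z) \<le> C * norm z" "0 \<le> C"
  shows "norm x \<le> C"
proof (cases "x = 0")
  case False
  have "norm x * norm x \<le> C * norm x"
    using assms(1)[of x] by (simp add: cinner_self power2_eq_square norm_mult)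
  then show ?thesis using False by simp
qed (simp add: assms)

lemma norm_cadj_le:
  fixes A :: "'a::chilbert_space \<Rightarrow> 'b::complex_inner"
  assumes A: "bounded_clinear A" and C: "\<And>x. norm (A x) \<le> C * norm x" "0 \<le> C"
  shows "norm (cadj A y) \<le> C * norm y"
proof (rule norm_le_if_cinner_le)
  fix z
  have "norm (cinner (cadj A y) z) \<le> norm y * norm (A z)"
    unfolding cinner_cadj_left[OF A] by (rule norm_cinner_le)
  also have "\<dots> \<le> norm y * (C * norm z)" by (intro mult_left_mono C) auto
  finally show "norm (cinner (cadj A y) z) \<le> C * norm y * norm z" by (simp add: mult_ac)
qed (simp add: C)

lemma bounded_clinear_cadj:
  fixes A :: "'a::chilbert_space \<Rightarrow> 'b::complex_inner"
  assumes A: "bounded_clinear A"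
  shows "bounded_clinear (cadj A)"
proof (rule bounded_clinearI[of _ "onorm A"])
  show "norm (cadj A y) \<le> onorm A * norm y" for y
    by (rule norm_cadj_le[OF A bounded_clinear_onorm[OF A]])
      (use A in \<open>simp add: bounded_clinear_def onorm_pos_le\<close>)
qed (rule cinner_ext_left, simp add: cinner_cadj_left[OF A] cinner_add_left cinner_scaleC_left)+

lemma cadj_compose:
  fixes A :: "'b::chilbert_space \<Rightarrow> 'c::complex_inner" and B :: "'a::chilbert_space \<Rightarrow> 'b"
  assumes "bounded_clinear A" "bounded_clinear B"
  shows "cadj (A \<circ> B) = cadj B \<circ> cadj A"
  by (rule cadj_eqI) (simp add: cinner_cadj_left assms)

lemma sqsum_cinner_le:
  fixes x :: "'i \<Rightarrow> 'a::complex_inner"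
  shows "norm (\<Sum>i\<in>F. cinner (x i) (y i)) \<le> sqrt (\<Sum>i\<in>F. (norm (x i))\<^sup>2) * sqrt (\<Sum>i\<in>F. (norm (y i))\<^sup>2)"
proof -
  have "norm (\<Sum>i\<in>F. cinner (x i) (y i)) \<le> (\<Sum>i\<in>F. norm (x i) * norm (y i))"
    by (rule order_trans[OF norm_sum]) (intro sum_mono norm_cinner_le)
  also have "\<dots> \<le> L2_set (\<lambda>i. norm (x i)) F * L2_set (\<lambda>i. norm (y i)) F"
    using L2_set_mult_ineq[of "\<lambda>i. norm (x i)" "\<lambda>i. norm (y i)" F] by simp
  finally show ?thesis by (simp add: L2_set_def)
qed

text \<open>The adjoint of the column \<open>z \<mapsto> (A\<^sub>i\<^sup>* z)\<^sub>i\<close> has the same norm.\<close>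

lemma norm_row_le:
  fixes A :: "'i \<Rightarrow> 'a::chilbert_space \<Rightarrow> 'b::complex_inner"
  assumes A: "\<And>i. i \<in> F \<Longrightarrow> bounded_clinear (A i)"
    and C: "\<And>z. (\<Sum>i\<in>F. (norm (cadj (A i) z))\<^sup>2) \<le> C\<^sup>2 * (norm z)\<^sup>2" "0 \<le> C"
  shows "norm (\<Sum>i\<in>F. A i (y i)) \<le> C * sqrt (\<Sum>i\<in>F. (norm (y i))\<^sup>2)"
proof (rule norm_le_if_cinner_le)
  fix z
  have "cinner (\<Sum>i\<in>F. A i (y i)) z = (\<Sum>i\<in>F. cinner (y i) (cadj (A i) z))"
    unfolding cinner_sum_left by (intro sum.cong) (auto simp: cinner_cadj_right A)
  also have "norm \<dots> \<le> sqrt (\<Sum>i\<in>F. (norm (y i))\<^sup>2) * sqrt (\<Sum>i\<in>F. (norm (cadj (A i) z))\<^sup>2)"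
    by (rule sqsum_cinner_le)
  also have "\<dots> \<le> sqrt (\<Sum>i\<in>F. (norm (y i))\<^sup>2) * sqrt (C\<^sup>2 * (norm z)\<^sup>2)"
    by (intro mult_left_mono real_sqrt_le_mono C) (simp add: sum_nonneg)
  finally show "norm (cinner (\<Sum>i\<in>F. A i (y i)) z) \<le> C * sqrt (\<Sum>i\<in>F. (norm (y i))\<^sup>2) * norm z"
    using C by (simp add: real_sqrt_mult mult_ac)
qed (use C in \<open>simp add: sum_nonneg\<close>)

text \<open>Baire category: the closed sets where all \<open>A n\<close> are bounded by
  \<open>m\<close> cover the space, so one of them contains a ball. Differences of points of this
  ball show that the operators are bounded by 2m on vectors of norm e/2, which gives the constant
  4m/e.\<close>

lemma banach_steinhaus:
  fixes A :: "nat \<Rightarrow> 'a::banach \<Rightarrow> 'b::real_normed_vector"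
  assumes A: "\<And>n. bounded_linear (A n)" and bdd: "\<And>x. Bseq (\<lambda>n. A n x)"
  obtains C where "0 \<le> C" "\<And>n x. norm (A n x) \<le> C * norm x"
proof -
  define E where "E m = {x. \<forall>n. norm (A n x) \<le> real m}" for m
  have cl: "closed (E m)" for m
    unfolding E_def
    by (intro closed_Collect_all closed_Collect_le continuous_intros bounded_linear.continuous_on[OF A])
  have "x \<in> \<Union> (range E)" for x
  proof -
    obtain K where "\<And>n. norm (A n x) \<le> K" using bdd[of x] unfolding Bseq_def by blast
    moreover obtain m where "K \<le> real m" using real_arch_simple by blast
    ultimately show ?thesis unfolding E_def by (auto intro: order_trans)
  qed
  then have U: "\<Union> (range E) = UNIV" by blast
  have "\<exists>m. interior (E m) \<noteq> {}"
  proof (rule ccontr)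
    assume *: "\<not> ?thesis"
    have "Met_TC.mtopology interior_of \<Union> (range E) = ({}::'a set)"
    proof (rule Met_TC.metric_Baire_category_alt)
      show "Met_TC.mcomplete TYPE('a)" by (simp add: complete_UNIV)
    qed (use * cl in auto)
    then show False unfolding U by simp
  qed
  then obtain m c where "c \<in> interior (E m)" by blast
  then obtain e where e: "e > 0" "ball c e \<subseteq> E m"
    using mem_interior by blast
  have "norm (A n x) \<le> (4 * real m / e) * norm x" for n x
  proof (cases "x = 0")
    case True
    then show ?thesis using A[of n] by (simp add: bounded_linear.linear linear_0)
  next
    case False
    define u where "u = (e / (2 * norm x)) *\<^sub>R x"
    interpret bounded_linear "A n" by (rule A)
    have "norm u = e / 2" using False e by (simp add: u_def)
    then have "c + u \<in> E m" "c \<in> E m" using e by (auto simp: subset_eq dist_norm)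
    then have "norm (A n (c + u)) \<le> real m" "norm (A n c) \<le> real m" unfolding E_def by auto
    then have "norm (A n u) \<le> 2 * real m"
      using norm_triangle_ineq4[of "A n (c + u)" "A n c"] by (simp add: add)
    then have "e / (2 * norm x) * norm (A n x) \<le> 2 * real m"
      using e by (simp add: u_def scaleR)
    then show ?thesis using False e by (simp add: field_simps)
  qed
  moreover have "0 \<le> 4 * real m / e" using e by simp
  ultimately show thesis using that by blast
qed

text \<open>The vectors at which convergence holds form a subspace containing \<open>S\<close>. A
  common bound for the operators then carries convergence to the closure by a three-term
  estimate.\<close>

lemma tendsto_everywhere_if_total:
  fixes A :: "'i \<Rightarrow> 'a::complex_inner \<Rightarrow> 'b::complex_inner"
  assumes A: "\<forall>\<^sub>F i in G. bounded_clinear (A i) \<and> (\<forall>x. norm (A i x) \<le> C * norm x)"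
    and B: "bounded_clinear B" and S: "closure (cspan S) = UNIV"
    and conv: "\<And>x. x \<in> S \<Longrightarrow> ((\<lambda>i. A i x) \<longlongrightarrow> B x) G"
  shows "((\<lambda>i. A i x) \<longlongrightarrow> B x) G"
proof -
  have lin: "\<forall>\<^sub>F i in G. bounded_clinear (A i)" using A by (rule eventually_mono) simp
  let ?V = "{x. ((\<lambda>i. A i x) \<longlongrightarrow> B x) G}"
  have "((\<lambda>i. A i 0) \<longlongrightarrow> B 0) G"
    using lin bounded_clinear_zero[OF B]
    by (intro tendsto_eventually) (auto elim!: eventually_mono simp: bounded_clinear_zero)
  moreover have "((\<lambda>i. A i (x + y)) \<longlongrightarrow> B (x + y)) G" if "x \<in> ?V" "y \<in> ?V" for x y
  proof (rule Lim_transform_eventually)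
    show "((\<lambda>i. A i x + A i y) \<longlongrightarrow> B (x + y)) G"
      unfolding bounded_clinear_add[OF B] using that by (intro tendsto_add) auto
    show "\<forall>\<^sub>F i in G. A i x + A i y = A i (x + y)"
      using lin by eventually_elim (simp add: bounded_clinear_add)
  qed
  moreover have "((\<lambda>i. A i (c *\<^sub>C x)) \<longlongrightarrow> B (c *\<^sub>C x)) G" if "x \<in> ?V" for c x
  proof (rule Lim_transform_eventually)
    show "((\<lambda>i. c *\<^sub>C A i x) \<longlongrightarrow> B (c *\<^sub>C x)) G"
      unfolding bounded_clinear_scaleC[OF B]
      using that by (auto intro: bounded_linear.tendsto[OF bounded_linear_scaleC])
    show "\<forall>\<^sub>F i in G. c *\<^sub>C A i x = A i (c *\<^sub>C x)"
      using lin by eventually_elim (simp add: bounded_clinear_scaleC)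
  qed
  ultimately have "csubspace ?V" unfolding csubspace_def by auto
  then have V: "cspan S \<subseteq> ?V" unfolding cspan_def using conv by auto
  show ?thesis
  proof (rule tendstoI)
    fix e :: real assume "e > 0"
    \<comment> \<open>The absolute value covers a negative \<open>C\<close>, and the summand 1 keeps
      the divisor in \<open>e / (2 * K)\<close> away from 0.\<close>
    define K where "K = \<bar>C\<bar> + onorm B + 1"
    have K: "K \<ge> 1" using B by (simp add: K_def bounded_clinear_def onorm_pos_le)
    then have "e / (2 * K) > 0" using \<open>e > 0\<close> by simp
    moreover have "x \<in> closure (cspan S)" using S by simp
    ultimately obtain y where y: "y \<in> cspan S" "dist y x < e / (2 * K)"
      unfolding closure_approachable by blast
    then have nK: "K * norm (x - y) < e / 2"
      using K by (simp add: dist_norm norm_minus_commute field_simps)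
    have "\<forall>\<^sub>F i in G. dist (A i y) (B y) < e / 2"
      using V y(1) \<open>e > 0\<close> by (intro tendstoD) auto
    with A show "\<forall>\<^sub>F i in G. dist (A i x) (B x) < e"
    proof eventually_elim
      case (elim i)
      have "A i x - B x = A i (x - y) + (A i y - B y) - B (x - y)"
        using elim by (simp add: bounded_clinear_diff B)
      then have "norm (A i x - B x) \<le> norm (A i (x - y)) + norm (A i y - B y) + norm (B (x - y))"
        by (smt (verit) norm_triangle_ineq norm_triangle_ineq4)
      also have "\<dots> \<le> C * norm (x - y) + norm (A i y - B y) + onorm B * norm (x - y)"
        using elim bounded_clinear_onorm[OF B] by (intro add_mono) auto
      also have "C * norm (x - y) + norm (A i y - B y) + onorm B * norm (x - y)
          \<le> K * norm (x - y) + norm (A i y - B y)"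
      proof -
        have "C * norm (x - y) \<le> \<bar>C\<bar> * norm (x - y)" by (rule mult_right_mono) auto
        then show ?thesis by (simp add: K_def distrib_right add_increasing2)
      qed
      also have "\<dots> < e" using nK elim by (simp add: dist_norm)
      finally show ?case by (simp add: dist_norm)
    qed
  qed
qed

text \<open>The density argument, applied to the constant sequence \<open>A\<close>: converging to
  \<open>B\<close> on a total set, it converges to \<open>B\<close> everywhere.\<close>

lemma bounded_clinear_eq_if_total:
  fixes A B :: "'a::complex_inner \<Rightarrow> 'b::complex_inner"
  assumes "bounded_clinear A" "bounded_clinear B" "closure (cspan S) = UNIV"
    and "\<And>x. x \<in> S \<Longrightarrow> A x = B x"
  shows "A = B"
proof
  fix x
  have "((\<lambda>_::nat. A x) \<longlongrightarrow> B x) sequentially"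
    by (rule tendsto_everywhere_if_total[where C="onorm A" and S=S])
      (auto simp: assms intro!: always_eventually bounded_clinear_onorm)
  then show "A x = B x" by (simp add: LIMSEQ_const_iff)
qed

section \<open>Square roots\<close>

text \<open>Iterating \<open>Y \<mapsto> (A + Y\<^sup>2) / 2\<close> from 0 gives polynomials in \<open>A\<close> with nonnegative coefficients, so the
  increments are dominated in norm by those of the scalar iteration for \<open>A = 1\<close>, which converges. The
  limit satisfies \<open>(1 - Y)\<^sup>2 = 1 - A\<close>.\<close>

primrec sqrt_iter :: "('a \<Rightarrow> 'a) \<Rightarrow> nat \<Rightarrow> 'a::complex_inner \<Rightarrow> 'a"
  where "sqrt_iter A 0 = (\<lambda>x. 0)"
  | "sqrt_iter A (Suc n) = (\<lambda>x. (1/2) *\<^sub>R (A x + sqrt_iter A n (sqrt_iter A n x)))"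

primrec sqrt_iter_bound :: "nat \<Rightarrow> real"
  where "sqrt_iter_bound 0 = 0"
  | "sqrt_iter_bound (Suc n) = (1 + (sqrt_iter_bound n)\<^sup>2) / 2"

lemma sqrt_iter_bound_range: "0 \<le> sqrt_iter_bound n \<and> sqrt_iter_bound n \<le> 1"
proof (induction n)
  case (Suc n)
  then have "(sqrt_iter_bound n)\<^sup>2 \<le> 1" by (simp add: power_le_one)
  then show ?case by simp
qed simp

lemma sqrt_iter_bound_incr: "sqrt_iter_bound n \<le> sqrt_iter_bound (Suc n)"
proof -
  have "sqrt_iter_bound (Suc n) - sqrt_iter_bound n = (1 - sqrt_iter_bound n)\<^sup>2 / 2"
    by (simp add: power2_eq_square field_simps)
  then show ?thesis by (metis diff_ge_0_iff_ge half_gt_zero_iff zero_le_divide_iff zero_le_numeral zero_le_power2)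
qed

lemma sqrt_one_minus:
  fixes A :: "'a::chilbert_space \<Rightarrow> 'a"
  assumes A: "bounded_clinear A" and selfadj: "\<And>x y. cinner (A x) y = cinner x (A y)"
    and contr: "\<And>x. norm (A x) \<le> norm x"
  obtains D where "bounded_clinear D" "\<And>x y. cinner (D x) y = cinner x (D y)"
    "\<And>x. D (D x) = x - A x"
proof -
  define Y where "Y = sqrt_iter A"
  define y where "y = sqrt_iter_bound"
  have Y_Suc: "Y (Suc n) x = (1/2) *\<^sub>R (A x + Y n (Y n x))" for n x by (simp add: Y_def)
  have y_Suc: "y (Suc n) = (1 + (y n)\<^sup>2) / 2" for n by (simp add: y_def)
  have y0: "0 \<le> y n" "y n \<le> 1" and y_mono: "y n \<le> y (Suc n)" for n
    using sqrt_iter_bound_range sqrt_iter_bound_incr by (auto simp: y_def)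
  have bcl: "bounded_clinear (Y n)" for n
  proof (induction n)
    case 0 show ?case by (simp add: Y_def bounded_clinear_const_zero)
  next
    case (Suc n)
    then show ?case
      unfolding Y_Suc[abs_def]
      by (intro bounded_clinear_scaleR_op bounded_clinear_plus A bounded_clinear_compose[of "Y n" "Y n"])
  qed
  have sa: "cinner (Y n x) z = cinner x (Y n z)" for n x z
  proof (induction n arbitrary: x z)
    case (Suc n)
    show ?case
      unfolding Y_Suc scaleR_eq_scaleC cinner_scaleC_left cinner_scaleC_right
      by (simp add: cinner_add_left cinner_add_right selfadj Suc.IH)
  qed (simp add: Y_def)
  \<comment> \<open>Commuting with \<open>A\<close> passes to every iterate. Taking \<open>B\<close>
    to be \<open>A\<close> and then an iterate shows that all iterates commute with each
    other.\<close>
  have comm: "B (Y n x) = Y n (B x)"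
    if "bounded_clinear B" "\<And>x. B (A x) = A (B x)" for B n x
  proof (induction n arbitrary: x)
    case 0 show ?case using that(1) by (simp add: Y_def bounded_clinear_zero)
  next
    case (Suc n)
    then show ?case
      by (simp add: Y_Suc bounded_clinear_scaleR[OF that(1)] bounded_clinear_add[OF that(1)] that(2))
  qed
  have "A (Y n x) = Y n (A x)" for n x by (rule comm[OF A]) simp
  then have comm2: "Y m (Y n x) = Y n (Y m x)" for m n x
    by (intro comm[OF bcl]) simp
  have bd: "norm (Y n x) \<le> y n * norm x" for n x
  proof (induction n arbitrary: x)
    case (Suc n)
    have "norm (Y n (Y n x)) \<le> y n * (y n * norm x)"
      using Suc.IH[of "Y n x"] Suc.IH[of x] y0(1)[of n] by (meson mult_left_mono order_trans)
    then have "norm (A x + Y n (Y n x)) \<le> norm x + y n * (y n * norm x)"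
      using contr by (intro norm_triangle_mono)
    then show ?case by (simp add: Y_Suc y_Suc power2_eq_square distrib_right mult.assoc)
  qed (simp add: Y_def y_def)
  \<comment> \<open>The difference of consecutive squares is the sum times the difference because
    the iterates commute. The scalar sequence factors in the same way, so its exact increments close
    the induction.\<close>
  have incr: "norm (Y (Suc n) x - Y n x) \<le> (y (Suc n) - y n) * norm x" for n x
  proof (induction n arbitrary: x)
    case 0 show ?case using contr[of x] by (simp add: Y_def y_def)
  next
    case (Suc n)
    define u where "u = Y (Suc n) x - Y n x"
    have "(1/2) *\<^sub>R (A x + Y (Suc n) (Y (Suc n) x)) - (1/2) *\<^sub>R (A x + Y n (Y n x))
        = (1/2) *\<^sub>R (Y (Suc n) u + Y n u)"
      unfolding u_def bounded_clinear_diff[OF bcl] comm2[of n "Suc n"]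
      by (simp add: scaleR_add_right scaleR_diff_right)
    then have "Y (Suc (Suc n)) x - Y (Suc n) x = (1/2) *\<^sub>R (Y (Suc n) u + Y n u)"
      by (metis Y_Suc)
    moreover have "norm (Y (Suc n) u + Y n u) \<le> y (Suc n) * norm u + y n * norm u"
      by (intro norm_triangle_mono bd)
    ultimately have "norm (Y (Suc (Suc n)) x - Y (Suc n) x) \<le> (y (Suc n) + y n) / 2 * norm u"
      by (simp add: distrib_right)
    also have "\<dots> \<le> (y (Suc n) + y n) / 2 * ((y (Suc n) - y n) * norm x)"
      unfolding u_def using y0(1)[of n] y0(1)[of "Suc n"] by (intro mult_left_mono Suc.IH) auto
    also have "\<dots> = (y (Suc (Suc n)) - y (Suc n)) * norm x"
      unfolding y_Suc[of "Suc n"] by (simp add: y_Suc[of n] power2_eq_square field_simps)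
    finally show ?case .
  qed
  have dist_le: "norm (Y m x - Y n x) \<le> (y m - y n) * norm x" if "n \<le> m" for m n x
    using that
  proof (induction m rule: dec_induct)
    case (step m)
    have "norm (Y (Suc m) x - Y n x) \<le> norm (Y (Suc m) x - Y m x) + norm (Y m x - Y n x)"
      using norm_triangle_ineq[of "Y (Suc m) x - Y m x" "Y m x - Y n x"] by simp
    then show ?case using incr[of m x] step.IH by (simp add: algebra_simps)
  qed simp
  have "incseq y" using y_mono by (rule incseq_SucI)
  then obtain l where "y \<longlonglongrightarrow> l"
    using incseq_convergent[of y 1] y0(2) by blast
  then have "Cauchy y" by (rule LIMSEQ_imp_Cauchy)
  have "Cauchy (\<lambda>n. Y n x)" for x
  proof (rule metric_CauchyI)
    fix e :: real assume "e > 0"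
    then have "e / (norm x + 1) > 0" by (simp add: add_nonneg_pos)
    then obtain M where M: "\<And>m n. m \<ge> M \<Longrightarrow> n \<ge> M \<Longrightarrow> dist (y m) (y n) < e / (norm x + 1)"
      using \<open>Cauchy y\<close> unfolding Cauchy_def by meson
    have *: "dist (Y m x) (Y n x) < e" if "n \<le> m" "M \<le> n" for m n
    proof -
      have "norm (Y m x - Y n x) \<le> (y m - y n) * norm x" by (rule dist_le[OF that(1)])
      also have "\<dots> \<le> dist (y m) (y n) * (norm x + 1)"
        unfolding dist_real_def by (intro mult_mono) auto
      also have "\<dots> < e" using M[of m n] that by (simp add: pos_less_divide_eq add_nonneg_pos)
      finally show ?thesis by (simp add: dist_norm)
    qed
    then have "dist (Y m x) (Y n x) < e" if "M \<le> m" "M \<le> n" for m n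
      using that by (metis * dist_commute linear)
    then show "\<exists>M. \<forall>m\<ge>M. \<forall>n\<ge>M. dist (Y m x) (Y n x) < e" by blast
  qed
  then obtain L where L: "\<And>x. (\<lambda>n. Y n x) \<longlonglongrightarrow> L x"
    unfolding Cauchy_convergent_iff convergent_def by metis
  have Lb: "bounded_clinear L"
  proof (rule bounded_clinearI)
    show "L (x + z) = L x + L z" for x z
      using tendsto_add[OF L[of x] L[of z]] L[of "x + z"]
      by (intro LIMSEQ_unique) (simp_all add: bounded_clinear_add[OF bcl])
    show "L (c *\<^sub>C x) = c *\<^sub>C L x" for c x
      using bounded_linear.tendsto[OF bounded_linear_scaleC L[of x], of c] L[of "c *\<^sub>C x"]
      by (intro LIMSEQ_unique) (simp_all add: bounded_clinear_scaleC[OF bcl])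
    have "norm (Y n x) \<le> norm x" for n x
      using bd[of n x] y0[of n] mult_right_mono[of "y n" 1 "norm x"] by simp
    then show "norm (L x) \<le> 1 * norm x" for x
      by (intro tendsto_upperbound[OF tendsto_norm[OF L]]) auto
  qed
  have Lsa: "cinner (L x) z = cinner x (L z)" for x z
    using tendsto_cinner[OF L[of x] tendsto_const[of z]] tendsto_cinner[OF tendsto_const[of x] L[of z]]
    unfolding sa by (rule LIMSEQ_unique)
  \<comment> \<open>Products of strong limits converge here because the iterates are contractions:
    \<open>Y n (Y n x)\<close> is split into \<open>Y n (Y n x - L x)\<close> and
    \<open>Y n (L x)\<close>.\<close>
  have "(\<lambda>n. Y n (Y n x)) \<longlonglongrightarrow> L (L x)" for x
  proof -
    have "(\<lambda>n. Y n (Y n x - L x)) \<longlonglongrightarrow> 0"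
    proof (rule Lim_null_comparison)
      show "\<forall>\<^sub>F n in sequentially. norm (Y n (Y n x - L x)) \<le> norm (Y n x - L x)"
        using bd y0(2) by (intro always_eventually allI)
          (metis mult_1 mult_right_mono norm_ge_zero order_trans)
      show "(\<lambda>n. norm (Y n x - L x)) \<longlonglongrightarrow> 0"
        by (intro tendsto_norm_zero LIM_zero L)
    qed
    from tendsto_add[OF this L[of "L x"]] show ?thesis
      by (simp add: bounded_clinear_diff[OF bcl])
  qed
  then have "(\<lambda>n. Y (Suc n) x) \<longlonglongrightarrow> (1/2) *\<^sub>R (A x + L (L x))" for x
    unfolding Y_Suc by (intro tendsto_intros)
  then have "L x = (1/2) *\<^sub>R (A x + L (L x))" for x
    using LIMSEQ_Suc[OF L[of x]] LIMSEQ_unique by blast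
  then have LL: "L (L x) = L x + L x - A x" for x
    by (metis add_diff_cancel_left' scaleR_half_double scaleR_add_right)
  show thesis
  proof (rule that[of "\<lambda>x. x - L x"])
    show "bounded_clinear (\<lambda>x. x - L x)" by (intro bounded_clinear_sub bounded_clinear_id Lb)
    show "cinner (x - L x) z = cinner x (z - L z)" for x z
      by (simp add: cinner_diff_left cinner_diff_right Lsa)
    show "(x - L x) - L (x - L x) = x - A x" for x
      by (simp add: bounded_clinear_diff[OF Lb] LL)
  qed
qed

section \<open>Sequence spaces over words\<close>

text \<open>In the coordinates of the model space, \<open>ket \<alpha>\<close> stands for the basis
  element f_\<alpha>.\<close>

definition ket :: "'i \<Rightarrow> ('i, complex) l2"
  where "ket i = Abs_l2 (\<lambda>j. if j = i then 1 else 0)"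

lemma Rep_Abs_l2: "(\<lambda>i. (norm (x i))\<^sup>2) summable_on UNIV \<Longrightarrow> Rep_l2 (Abs_l2 x) = x"
  by (simp add: Abs_l2_inverse)

lemma Rep_ket: "Rep_l2 (ket i) = (\<lambda>j. if j = i then 1 else 0)"
  unfolding ket_def
  by (rule Rep_Abs_l2, rule finite_nonzero_values_imp_summable_on, rule finite_subset[of _ "{i}"]) auto

lemma l2_eqI: "(\<And>i. Rep_l2 x i = Rep_l2 y i) \<Longrightarrow> x = y"
  by (simp add: Rep_l2_inject[symmetric] fun_eq_iff)

lemma finite_words_eq: "finite {w::'n::finite list. length w = k}"
  using finite_lists_length_eq[of "UNIV::'n set" k] by simp

lemma finite_words_less: "finite {w::'n::finite list. length w < N}"
  by (rule finite_subset[OF _ finite_lists_length_le[of "UNIV::'n set" N]]) auto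

text \<open>An unconditional sum may be taken along an exhausting sequence of finite sets. The words
  of length below \<open>N\<close> are chosen because they match partial sums by degree.\<close>

lemma has_sum_imp_tendsto_words:
  fixes h :: "'n::finite list \<Rightarrow> 'b::{comm_monoid_add,topological_space}"
  assumes "(h has_sum s) UNIV"
  shows "(\<lambda>N. \<Sum>w | length w < N. h w) \<longlonglongrightarrow> s"
proof -
  have "filterlim (\<lambda>N. {w::'n list. length w < N}) (finite_subsets_at_top UNIV) sequentially"
    unfolding filterlim_finite_subsets_at_top
  proof (intro allI impI)
    fix X :: "'n list set" assume "finite X \<and> X \<subseteq> UNIV"
    then have "X \<subseteq> {w. length w < N}" if "N > Max (insert 0 (length ` X))" for N
      using that by auto
    then show "\<forall>\<^sub>F N in sequentially. finite {w::'n list. length w < N} \<and> X \<subseteq> {w. length w < N} \<and> {w::'n list. length w < N} \<subseteq> UNIV"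
      by (auto simp: finite_words_less intro!: eventually_mono[OF eventually_gt_at_top])
  qed
  then show ?thesis using assms unfolding has_sum_def by (rule filterlim_compose[rotated])
qed

lemma norm_l2_eq_limit:
  fixes x :: "('n::finite list, 'd::complex_inner) l2"
  shows "(\<lambda>N. \<Sum>w | length w < N. (norm (Rep_l2 x w))\<^sup>2) \<longlonglongrightarrow> (norm x)\<^sup>2"
  unfolding norm_l2_power2 by (intro has_sum_imp_tendsto_words has_sum_infsum l2_summable)

lemma norm_diff_truncation:
  fixes x z :: "('n::finite list, 'd::complex_inner) l2"
  assumes z: "\<And>w. Rep_l2 z w = (if length w < N then Rep_l2 x w else 0)"
  shows "(norm (x - z))\<^sup>2 = (norm x)\<^sup>2 - (\<Sum>w | length w < N. (norm (Rep_l2 x w))\<^sup>2)"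
proof -
  let ?F = "{w::'n list. length w < N}"
  have "(norm x)\<^sup>2 = infsum (\<lambda>w. (norm (Rep_l2 x w))\<^sup>2) (?F \<union> - ?F)"
    unfolding norm_l2_power2 by simp
  also have "\<dots> = infsum (\<lambda>w. (norm (Rep_l2 x w))\<^sup>2) ?F + infsum (\<lambda>w. (norm (Rep_l2 x w))\<^sup>2) (- ?F)"
    by (rule infsum_Un_disjoint)
      (auto intro: finite_words_less summable_on_subset_banach[OF l2_summable])
  also have "infsum (\<lambda>w. (norm (Rep_l2 x w))\<^sup>2) (- ?F) = (norm (x - z))\<^sup>2"
    unfolding norm_l2_power2 Rep_minus_l2 z by (rule infsum_cong_neutral) auto
  finally show ?thesis by (simp add: infsum_finite[OF finite_words_less])
qed

text \<open>The offset \<open>m\<close> accommodates partial sums applied to a basis vector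
  \<open>ket \<beta>\<close>: with terms of degree below N they fill the words shorter than N +
  |\<beta>|.\<close>

lemma truncation_tendsto:
  fixes x :: "('n::finite list, 'd::complex_inner) l2"
  assumes z: "\<And>N w. Rep_l2 (z N) w = (if length w < N + m then Rep_l2 x w else 0)"
  shows "z \<longlonglongrightarrow> x"
proof -
  have "(\<lambda>N. (norm x)\<^sup>2 - (\<Sum>w | length w < N + m. (norm (Rep_l2 x w))\<^sup>2)) \<longlonglongrightarrow> (norm x)\<^sup>2 - (norm x)\<^sup>2"
    by (intro tendsto_diff tendsto_const LIMSEQ_ignore_initial_segment[OF norm_l2_eq_limit])
  then have "(\<lambda>N. (norm (x - z N))\<^sup>2) \<longlonglongrightarrow> 0"
    by (simp add: norm_diff_truncation[OF z])
  then have "(\<lambda>N. sqrt ((norm (x - z N))\<^sup>2)) \<longlonglongrightarrow> sqrt 0" by (rule tendsto_real_sqrt)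
  then have "(\<lambda>N. norm (z N - x)) \<longlonglongrightarrow> 0" by (simp add: norm_minus_commute)
  then have "(\<lambda>N. z N - x) \<longlonglongrightarrow> 0" by (rule tendsto_norm_zero_cancel)
  then show ?thesis by (rule LIM_zero_cancel)
qed

lemma bounded_clinear_Rep_l2: "bounded_clinear (\<lambda>x. Rep_l2 x i)"
  by (rule bounded_clinearI[of _ 1]) (auto simp: Rep_l2_simps norm_Rep_l2_le)

section \<open>Tensoring operators with the identity\<close>

lemma bounded_clinear_tens_left: "bounded_clinear (\<lambda>a. tens a d)"
proof (rule bounded_clinearI)
  show "norm (tens a d) \<le> norm d * norm a" for a
  proof -
    have "complex_of_real ((norm (tens a d))\<^sup>2) = of_real ((norm a * norm d)\<^sup>2)"
      unfolding cinner_self[symmetric] cinner_tens by (simp add: cinner_self power_mult_distrib)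
    then have "(norm (tens a d))\<^sup>2 = (norm a * norm d)\<^sup>2" using of_real_eq_iff by blast
    then show ?thesis by (simp add: power2_eq_iff_nonneg mult.commute)
  qed
qed (auto intro!: l2_eqI simp: Rep_tens Rep_l2_simps scaleC_add_left scaleC_scaleC scaleC_complex_def)

lemma tens_scaleC_right: "tens a (c *\<^sub>C d) = tens (c *\<^sub>C a) d"
  by (auto intro!: l2_eqI simp: Rep_tens Rep_l2_simps scaleC_scaleC scaleC_complex_def mult.commute)

lemma tens_add_right: "tens a (d + e) = tens a d + tens a e"
  by (auto intro!: l2_eqI simp: Rep_tens Rep_l2_simps scaleC_add_right)

lemma tens_complex_right: "tens a (c::complex) = c *\<^sub>C a"
  by (auto intro!: l2_eqI simp: Rep_tens Rep_l2_simps scaleC_complex_def mult.commute)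

lemma cinner_sum_tens:
  "cinner (\<Sum>j\<in>F. tens (a j) (d j)) (\<Sum>j\<in>F. tens (b j) (d j))
    = (\<Sum>j\<in>F. \<Sum>k\<in>F. cinner (a j) (b k) * cinner (d j) (d k))"
  unfolding cinner_sum_right unfolding cinner_sum_left cinner_tens by (rule sum.swap)

text \<open>With \<open>D\<^sup>*D = 1 - A\<^sup>*A / C\<^sup>2\<close>, the difference of the squares of the two sides is
  the square of the norm of \<open>C (\<Sum>\<^sub>j D a\<^sub>j \<otimes> d\<^sub>j)\<close>.\<close>

lemma norm_sum_tens_le:
  fixes A :: "('i, complex) l2 \<Rightarrow> ('i, complex) l2"
  assumes A: "bounded_clinear A" and C: "\<And>x. norm (A x) \<le> C * norm x" "0 \<le> C"
  shows "norm (\<Sum>j\<in>F. tens (A (a j)) (d j)) \<le> C * norm (\<Sum>j\<in>F. tens (a j) (d j))"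
proof (cases "C = 0")
  case True
  then have "A x = 0" for x using C(1)[of x] by simp
  then show ?thesis
    using True by (simp add: bounded_clinear_zero[OF bounded_clinear_tens_left])
next
  case False
  then have "C > 0" using C by simp
  define P where "P x = (1 / C\<^sup>2) *\<^sub>R cadj A (A x)" for x
  have "bounded_clinear P"
    unfolding P_def by (intro bounded_clinear_scaleR_op bounded_clinear_compose[OF bounded_clinear_cadj] A)
  moreover have "cinner (P x) y = cinner x (P y)" for x y
    unfolding P_def scaleR_eq_scaleC cinner_scaleC_left cinner_scaleC_right
    by (simp add: cinner_cadj_left A cinner_cadj_right)
  moreover have "norm (P x) \<le> norm x" for x
  proof -
    have "norm (cadj A (A x)) \<le> C * norm (A x)" by (rule norm_cadj_le[OF A C])
    also have "\<dots> \<le> C * (C * norm x)" by (intro mult_left_mono C)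
    finally show ?thesis using \<open>C > 0\<close> by (simp add: P_def power2_eq_square field_simps)
  qed
  ultimately obtain D where D: "bounded_clinear D" "\<And>x y. cinner (D x) y = cinner x (D y)"
    "\<And>x. D (D x) = x - P x"
    using sqrt_one_minus by blast
  have gram: "of_real (C\<^sup>2) * cinner x y = cinner (A x) (A y) + of_real (C\<^sup>2) * cinner (D x) (D y)" for x y
  proof -
    have "cinner (D x) (D y) = cinner x y - cinner x (P y)"
      by (simp add: D cinner_diff_right)
    also have "cinner x (P y) = cinner (A x) (A y) / of_real (C\<^sup>2)"
      unfolding P_def scaleR_eq_scaleC cinner_scaleC_right by (simp add: cinner_cadj_right A)
    finally show ?thesis using False by (simp add: right_diff_distrib)
  qed
  have gram': "of_real (C\<^sup>2) * (cinner x y * e)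
      = cinner (A x) (A y) * e + of_real (C\<^sup>2) * (cinner (D x) (D y) * e)" for x y e
    using gram[of x y] by (metis distrib_right mult.assoc)
  define t where "t B = (\<Sum>j\<in>F. tens (B (a j)) (d j))" for B :: "('i, complex) l2 \<Rightarrow> ('i, complex) l2"
  have "of_real (C\<^sup>2) * cinner (t (\<lambda>x. x)) (t (\<lambda>x. x))
      = cinner (t A) (t A) + of_real (C\<^sup>2) * cinner (t D) (t D)"
    unfolding t_def cinner_sum_tens sum_distrib_left sum.distrib[symmetric]
    by (intro sum.cong refl gram')
  then have "C\<^sup>2 * (norm (t (\<lambda>x. x)))\<^sup>2 = (norm (t A))\<^sup>2 + C\<^sup>2 * (norm (t D))\<^sup>2"
    unfolding cinner_self of_real_mult[symmetric] of_real_add[symmetric] of_real_eq_iff .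
  moreover have "0 \<le> C\<^sup>2 * (norm (t D))\<^sup>2" by simp
  ultimately have "(norm (t A))\<^sup>2 \<le> (C * norm (t (\<lambda>x. x)))\<^sup>2"
    unfolding power_mult_distrib by (simp only: le_add_same_cancel1)
  then show ?thesis
    unfolding t_def by (rule power2_le_imp_le) (intro mult_nonneg_nonneg C(2) norm_ge_zero)
qed

lemma total_tens: "closure (cspan {tens a d |a d. True}) = (UNIV :: ('i, 'd::complex_inner) l2 set)"
  using tensor_space_UNIV unfolding tensor_space_def by simp

lemma Rep_sum_tens_ket:
  "finite F \<Longrightarrow> Rep_l2 (\<Sum>v\<in>F. tens (ket v) (h v)) w = (if w \<in> F then h w else 0)"
proof -
  assume "finite F"
  have "Rep_l2 (\<Sum>v\<in>F. tens (ket v) (h v)) w = (\<Sum>v\<in>F. if w = v then h v else 0)"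
    unfolding Rep_l2_sum Rep_tens Rep_ket by (intro sum.cong) auto
  then show ?thesis using \<open>finite F\<close> by simp
qed

lemma sum_tens_ket_tendsto:
  fixes x :: "('n::finite list, 'd::complex_inner) l2"
  shows "(\<lambda>N. \<Sum>w | length w < N. tens (ket w) (Rep_l2 x w)) \<longlonglongrightarrow> x"
  by (rule truncation_tendsto[where m=0]) (simp add: Rep_sum_tens_ket finite_words_less)

lemma sum_ket_tendsto:
  fixes a :: "('n::finite list, complex) l2"
  shows "(\<lambda>N. \<Sum>w | length w < N. Rep_l2 a w *\<^sub>C ket w) \<longlonglongrightarrow> a"
  using sum_tens_ket_tendsto[of a] by (simp add: tens_complex_right)

text \<open>Each \<open>x\<close> has unique coefficients along the \<open>ket w\<close>, so
  applying \<open>A\<close> to the \<open>ket w\<close> in the finite truncations of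
  \<open>x\<close> raises no question of well-definedness. The estimate for finite sums of
  elementary tensors makes these images Cauchy and keeps the bound \<open>C\<close>.\<close>

lemma tens_op_exists:
  fixes A :: "('n::finite list, complex) l2 \<Rightarrow> ('n list, complex) l2"
  assumes A: "bounded_clinear A" and C: "\<And>x. norm (A x) \<le> C * norm x" "0 \<le> C"
  obtains B :: "('n list, 'd::chilbert_space) l2 \<Rightarrow> ('n list, 'd) l2"
  where "bounded_clinear B" "\<And>a d. B (tens a d) = tens (A a) d" "\<And>x. norm (B x) \<le> C * norm x"
proof -
  define t :: "nat \<Rightarrow> ('n list, 'd) l2 \<Rightarrow> ('n list, 'd) l2"
    where "t N x = (\<Sum>w | length w < N. tens (ket w) (Rep_l2 x w))" for N x
  define B' :: "nat \<Rightarrow> ('n list, 'd) l2 \<Rightarrow> ('n list, 'd) l2"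
    where "B' N x = (\<Sum>w | length w < N. tens (A (ket w)) (Rep_l2 x w))" for N x
  have t: "(\<lambda>N. t N x) \<longlonglongrightarrow> x" for x
    unfolding t_def by (rule sum_tens_ket_tendsto)
  have diff: "norm (B' M x - B' N x) \<le> C * norm (t M x - t N x)" if "N \<le> M" for M N x
  proof -
    have "h M - h N = (\<Sum>w\<in>{w. length w < M} - {w. length w < N}. g w)"
      if "\<And>N. h N = (\<Sum>w | length w < N. g w)" for h and g :: "'n list \<Rightarrow> ('n list, 'd) l2"
      unfolding that using \<open>N \<le> M\<close> by (intro sum_diff[symmetric]) (auto simp: finite_words_less)
    then show ?thesis
      using norm_sum_tens_le[OF A C] by (simp add: B'_def t_def)
  qed
  have "Cauchy (\<lambda>N. B' N x)" for x
  proof (rule metric_CauchyI)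
    fix e :: real assume "e > 0"
    have "Cauchy (\<lambda>N. t N x)" by (rule LIMSEQ_imp_Cauchy[OF t])
    \<comment> \<open>\<open>C\<close> may be 0, hence the divisor C + 1.\<close>
    moreover have "e / (C + 1) > 0" using \<open>e > 0\<close> C by simp
    ultimately obtain K where K: "\<And>M N. M \<ge> K \<Longrightarrow> N \<ge> K \<Longrightarrow> dist (t M x) (t N x) < e / (C + 1)"
      unfolding Cauchy_def by meson
    have *: "dist (B' M x) (B' N x) < e" if "N \<le> M" "K \<le> N" for M N
    proof -
      have "norm (B' M x - B' N x) \<le> (C + 1) * norm (t M x - t N x)"
        using diff[OF that(1), of x] by (simp add: distrib_right add_increasing2)
      also have "\<dots> < e" using K[of M N] that C by (simp add: dist_norm field_simps)
      finally show ?thesis by (simp add: dist_norm)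
    qed
    then have "dist (B' M x) (B' N x) < e" if "K \<le> M" "K \<le> N" for M N
      using that by (metis * dist_commute linear)
    then show "\<exists>K. \<forall>M\<ge>K. \<forall>N\<ge>K. dist (B' M x) (B' N x) < e" by blast
  qed
  then obtain B where B: "\<And>x. (\<lambda>N. B' N x) \<longlonglongrightarrow> B x"
    unfolding Cauchy_convergent_iff convergent_def by metis
  have nB: "norm (B x) \<le> C * norm x" for x
  proof (rule LIMSEQ_le)
    show "(\<lambda>N. norm (B' N x)) \<longlonglongrightarrow> norm (B x)" by (intro tendsto_norm B)
    show "(\<lambda>N. C * norm (t N x)) \<longlonglongrightarrow> C * norm x" by (intro tendsto_intros t)
    show "\<exists>N0. \<forall>N\<ge>N0. norm (B' N x) \<le> C * norm (t N x)"
      using norm_sum_tens_le[OF A C] by (auto simp: B'_def t_def)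
  qed
  have "bounded_clinear B"
  proof (rule bounded_clinearI[OF _ _ nB])
    have "B' N (x + y) = B' N x + B' N y" for N x y
      by (simp add: B'_def Rep_l2_simps tens_add_right sum.distrib)
    then show "B (x + y) = B x + B y" for x y
      using tendsto_add[OF B[of x] B[of y]] B[of "x + y"] LIMSEQ_unique by simp blast
    have "B' N (c *\<^sub>C x) = c *\<^sub>C B' N x" for N c x
      by (simp add: B'_def Rep_l2_simps tens_scaleC_right scaleC_sum_right
          bounded_clinear_scaleC[OF bounded_clinear_tens_left])
    then show "B (c *\<^sub>C x) = c *\<^sub>C B x" for c x
      using bounded_linear.tendsto[OF bounded_linear_scaleC B[of x], of c] B[of "c *\<^sub>C x"] LIMSEQ_unique
      by simp blast
  qed
  moreover have "B (tens a d) = tens (A a) d" for a d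
  proof (rule LIMSEQ_unique[OF B])
    have "B' N (tens a d) = tens (A (\<Sum>w | length w < N. Rep_l2 a w *\<^sub>C ket w)) d" for N
      by (simp add: B'_def Rep_tens tens_scaleC_right bounded_clinear_sum[OF A]
          bounded_clinear_scaleC[OF A] bounded_clinear_sum[OF bounded_clinear_tens_left])
    then show "(\<lambda>N. B' N (tens a d)) \<longlonglongrightarrow> tens (A a) d"
      by (simp only:) (intro bounded_clinear_tendsto[OF bounded_clinear_tens_left]
          bounded_clinear_tendsto[OF A] sum_ket_tendsto)
  qed
  ultimately show thesis using nB that by blast
qed

text \<open>Elementary tensors are total, so they determine the operator. The algebraic rules for
  amplifications thereby reduce to identities in the first tensor factor.\<close>

lemma tens_op_eqI:
  fixes B :: "('i, 'd::complex_inner) l2 \<Rightarrow> ('i, 'd) l2"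
  assumes B: "bounded_clinear B" "\<And>a d. B (tens a d) = tens (A a) d"
  shows "tens_op A = B"
  unfolding tens_op_def
proof (rule the_equality)
  fix B' :: "('i, 'd) l2 \<Rightarrow> ('i, 'd) l2"
  assume B': "bounded_clinear B' \<and> (\<forall>a d. B' (tens a d) = tens (A a) d)"
  show "B' = B"
    by (rule bounded_clinear_eq_if_total[OF _ B(1) total_tens]) (use B' B(2) in auto)
qed (use B in blast)

context
  fixes A :: "('n::finite list, complex) l2 \<Rightarrow> ('n list, complex) l2"
  assumes A: "bounded_clinear A"
begin

lemma norm_tens_op_le:
  fixes x :: "('n list, 'd::chilbert_space) l2"
  assumes C: "\<And>x. norm (A x) \<le> C * norm x" "0 \<le> C"
  shows "norm (tens_op A x) \<le> C * norm x"
proof -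
  obtain B :: "('n list, 'd) l2 \<Rightarrow> ('n list, 'd) l2"
    where B: "bounded_clinear B" "\<And>a d. B (tens a d) = tens (A a) d" "\<And>x. norm (B x) \<le> C * norm x"
    using tens_op_exists[OF A C] by metis
  show ?thesis using B(3) by (simp add: tens_op_eqI[OF B(1,2)])
qed

lemma
  shows bounded_clinear_tens_op: "bounded_clinear (tens_op A :: ('n list, 'd::chilbert_space) l2 \<Rightarrow> _)"
    and tens_op_tens: "tens_op A (tens a (d::'d)) = tens (A a) d"
proof -
  have "0 \<le> onorm A" using A by (simp add: bounded_clinear_def onorm_pos_le)
  with A bounded_clinear_onorm[OF A] obtain B :: "('n list, 'd) l2 \<Rightarrow> ('n list, 'd) l2"
    where B: "bounded_clinear B" "\<And>a d. B (tens a d) = tens (A a) d"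
    using tens_op_exists by metis
  have "tens_op A = B" by (rule tens_op_eqI[OF B])
  then show "bounded_clinear (tens_op A :: ('n list, 'd) l2 \<Rightarrow> _)" "tens_op A (tens a d) = tens (A a) d"
    using B by auto
qed

end

lemma null_sequence_le:
  fixes a b :: "nat \<Rightarrow> real"
  assumes "\<And>n. a n \<le> b n" "\<And>n. 0 \<le> a n" "b \<longlonglongrightarrow> 0"
  shows "a \<longlonglongrightarrow> 0"
  by (rule tendsto_sandwich[OF _ _ tendsto_const assms(3)]) (use assms(1,2) in auto)

lemma tens_op_id: "tens_op id = (id :: ('i, 'd::complex_inner) l2 \<Rightarrow> _)"
  by (rule tens_op_eqI) (use bounded_clinear_id in \<open>simp_all add: id_def\<close>)

lemma tens_op_comp:
  fixes A B :: "('n::finite list, complex) l2 \<Rightarrow> ('n list, complex) l2"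
  assumes "bounded_clinear A" "bounded_clinear B"
  shows "tens_op (A \<circ> B) = (tens_op A \<circ> tens_op B :: ('n list, 'd::chilbert_space) l2 \<Rightarrow> _)"
  by (rule tens_op_eqI) (simp_all add: assms bounded_clinear_comp bounded_clinear_tens_op tens_op_tens)

lemma tens_op_diff:
  fixes A B :: "('n::finite list, complex) l2 \<Rightarrow> ('n list, complex) l2"
  assumes "bounded_clinear A" "bounded_clinear B"
  shows "tens_op (\<lambda>x. A x - B x) = (\<lambda>x :: ('n list, 'd::chilbert_space) l2. tens_op A x - tens_op B x)"
  by (rule tens_op_eqI)
    (simp_all add: assms bounded_clinear_sub bounded_clinear_tens_op tens_op_tens
      bounded_clinear_diff[OF bounded_clinear_tens_left])

lemma tens_op_sum:
  fixes A :: "'j \<Rightarrow> ('n::finite list, complex) l2 \<Rightarrow> ('n list, complex) l2"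
  assumes "\<And>j. bounded_clinear (A j)"
  shows "tens_op (\<lambda>x. \<Sum>j\<in>F. A j x) = (\<lambda>x :: ('n list, 'd::chilbert_space) l2. \<Sum>j\<in>F. tens_op (A j) x)"
  by (rule tens_op_eqI)
    (simp_all add: assms bounded_clinear_sum_op bounded_clinear_tens_op tens_op_tens
      bounded_clinear_sum[OF bounded_clinear_tens_left])

lemma tens_op_scaleC:
  fixes A :: "('n::finite list, complex) l2 \<Rightarrow> ('n list, complex) l2"
  assumes "bounded_clinear A"
  shows "tens_op (\<lambda>x. c *\<^sub>C A x) = (\<lambda>x :: ('n list, 'd::chilbert_space) l2. c *\<^sub>C tens_op A x)"
  by (rule tens_op_eqI)
    (simp_all add: assms bounded_clinear_scaleC_op bounded_clinear_tens_op tens_op_tens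
      bounded_clinear_scaleC[OF bounded_clinear_tens_left])

section \<open>Words and series evaluated at amplified tuples\<close>

context
  fixes X :: "'n::finite \<Rightarrow> ('n list, complex) l2 \<Rightarrow> ('n list, complex) l2"
  assumes X: "\<And>i. bounded_clinear (X i)"
begin

lemma op_word_tens_op:
  "op_word (\<lambda>i. tens_op (X i)) \<alpha> = (tens_op (op_word X \<alpha>) :: ('n list, 'd::chilbert_space) l2 \<Rightarrow> _)"
  by (induction \<alpha>)
    (simp_all only: op_word.simps tens_op_id tens_op_comp[OF X bounded_clinear_op_word[OF X]])

lemma nc_homog_tens_op:
  "nc_homog c k (\<lambda>i. tens_op (X i)) = (tens_op (nc_homog c k X) :: ('n list, 'd::chilbert_space) l2 \<Rightarrow> _)"
  unfolding nc_homog_def[abs_def] op_word_tens_op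
  by (simp add: tens_op_sum tens_op_scaleC X bounded_clinear_op_word bounded_clinear_scaleC_op)

lemma sum_nc_homog_tens_op:
  "(\<lambda>x. \<Sum>k<N. nc_homog c k (\<lambda>i. tens_op (X i)) x)
    = (tens_op (\<lambda>x. \<Sum>k<N. nc_homog c k X x) :: ('n list, 'd::chilbert_space) l2 \<Rightarrow> _)"
  unfolding nc_homog_tens_op by (simp add: tens_op_sum X bounded_clinear_nc_homog)

end

text \<open>On elementary tensors the convergence is clear; elsewhere a uniform bound is required.
  Uniform boundedness supplies one for the \<open>A k\<close>, and amplification preserves
  it.\<close>

lemma sot_lim_tens_op:
  fixes A :: "nat \<Rightarrow> ('n::finite list, complex) l2 \<Rightarrow> ('n list, complex) l2"
  assumes A: "\<And>k. bounded_clinear (A k)" and lim: "sot_lim A S sequentially"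
  shows "sot_lim (\<lambda>k. tens_op (A k) :: ('n list, 'd::chilbert_space) l2 \<Rightarrow> _) (tens_op S) sequentially"
proof -
  have S: "bounded_clinear S" and conv: "\<And>x. (\<lambda>k. A k x) \<longlonglongrightarrow> S x"
    using lim by (auto simp: sot_lim_def)
  have "Bseq (\<lambda>k. A k x)" for x
    using conv convergent_def convergent_imp_Bseq by blast
  moreover have "bounded_linear (A k)" for k using A by (simp add: bounded_clinear_def)
  ultimately obtain C where C: "0 \<le> C" "\<And>k x. norm (A k x) \<le> C * norm x"
    using banach_steinhaus by metis
  show ?thesis
    unfolding sot_lim_def
  proof (intro conjI allI bounded_clinear_tens_op S)
    show "(\<lambda>k. tens_op (A k) x) \<longlonglongrightarrow> tens_op S x" for x :: "('n list, 'd) l2"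
    proof (rule tendsto_everywhere_if_total[where C=C, OF _ bounded_clinear_tens_op[OF S] total_tens])
      show "\<forall>\<^sub>F k in sequentially. bounded_clinear (tens_op (A k) :: ('n list, 'd) l2 \<Rightarrow> _) \<and>
          (\<forall>x::('n list, 'd) l2. norm (tens_op (A k) x) \<le> C * norm x)"
        by (intro always_eventually allI conjI bounded_clinear_tens_op A norm_tens_op_le[OF A C(2,1)])
      show "(\<lambda>k. tens_op (A k) y) \<longlonglongrightarrow> tens_op S y" if y: "y \<in> {tens a d |a d. True}" for y :: "('n list, 'd) l2"
      proof -
        obtain a d where "y = tens a d" using y by blast
        have "(\<lambda>k. tens_op (A k) (tens a d)) \<longlonglongrightarrow> tens_op S (tens a d)"
          unfolding tens_op_tens[OF A] tens_op_tens[OF S]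
          by (rule bounded_clinear_tendsto[OF bounded_clinear_tens_left conv])
        then show ?thesis by (simp add: \<open>y = _\<close>)
      qed
    qed
  qed
qed

text \<open>Partial sums commute with amplification, and amplification does not increase the norm of
  the error operators.\<close>

lemma norm_sums_tens_op:
  fixes X :: "'n::finite \<Rightarrow> ('n list, complex) l2 \<Rightarrow> ('n list, complex) l2"
  assumes X: "\<And>i. bounded_clinear (X i)" and lim: "norm_sums (\<lambda>k. nc_homog c k X) S"
  shows "norm_sums (\<lambda>k. nc_homog c k (\<lambda>i. tens_op (X i)) :: ('n list, 'd::chilbert_space) l2 \<Rightarrow> _) (tens_op S)"
proof -
  have S: "bounded_clinear S" and conv: "(\<lambda>N. onorm (\<lambda>x. (\<Sum>k<N. nc_homog c k X x) - S x)) \<longlonglongrightarrow> 0"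
    using lim by (auto simp: norm_sums_def)
  let ?D = "\<lambda>N x. (\<Sum>k<N. nc_homog c k X x) - S x"
  have sum: "bounded_clinear (\<lambda>x. \<Sum>k<N. nc_homog c k X x)" for N
    by (intro bounded_clinear_sum_op bounded_clinear_nc_homog X)
  then have D: "bounded_clinear (?D N)" for N by (intro bounded_clinear_sub S)
  have pos: "0 \<le> onorm (?D N)" for N using D by (simp add: bounded_clinear_def onorm_pos_le)
  have eq: "(\<lambda>x :: ('n list, 'd) l2. (\<Sum>k<N. nc_homog c k (\<lambda>i. tens_op (X i)) x) - tens_op S x) = tens_op (?D N)" for N
    by (rule ext)
      (simp add: tens_op_diff[OF sum S] fun_cong[OF sum_nc_homog_tens_op[where X=X and c=c and N=N, OF X]])
  have "onorm (tens_op (?D N) :: ('n list, 'd) l2 \<Rightarrow> _) \<le> onorm (?D N)" for N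
    by (intro onorm_bound pos norm_tens_op_le[OF D] bounded_clinear_onorm[OF D])
  moreover have "0 \<le> onorm (tens_op (?D N) :: ('n list, 'd) l2 \<Rightarrow> _)" for N
    using bounded_clinear_tens_op[OF D, where 'd='d] by (simp add: bounded_clinear_def onorm_pos_le)
  ultimately have "(\<lambda>N. onorm (tens_op (?D N) :: ('n list, 'd) l2 \<Rightarrow> _)) \<longlonglongrightarrow> 0"
    using conv by (rule null_sequence_le)
  then show ?thesis
    unfolding norm_sums_def eq using bounded_clinear_tens_op[OF S] by blast
qed

lemma value_tens_op:
  fixes X :: "'n::finite \<Rightarrow> ('n list, complex) l2 \<Rightarrow> ('n list, complex) l2"
  assumes X: "\<And>i. bounded_clinear (X i)" and F: "value_SOT f X F \<or> value_rad f X F"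
  shows "value_SOT f (\<lambda>i. tens_op (X i)) (\<lambda>j. tens_op (F j) :: ('n list, 'd::chilbert_space) l2 \<Rightarrow> _) \<or>
    value_rad f (\<lambda>i. tens_op (X i)) (\<lambda>j. tens_op (F j) :: ('n list, 'd) l2 \<Rightarrow> _)"
  using F
proof
  assume "value_SOT f X F"
  then have lim: "sot_lim (\<lambda>N x. \<Sum>k<N. nc_homog (f j) k X x) (F j) sequentially" for j
    by (simp add: value_SOT_def sot_sums_def)
  have bcl: "bounded_clinear (\<lambda>x. \<Sum>k<N. nc_homog (f j) k X x)" for j N
    by (intro bounded_clinear_sum_op bounded_clinear_nc_homog X)
  show ?thesis
    unfolding value_SOT_def sot_sums_def sum_nc_homog_tens_op[where X=X, OF X]
    by (intro disjI1 allI sot_lim_tens_op[OF bcl lim])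
next
  assume "value_rad f X F"
  then obtain \<delta> G where \<delta>: "0 < \<delta>" "\<delta> < 1"
    and N: "\<And>r j. \<delta> < r \<Longrightarrow> r < 1 \<Longrightarrow> norm_sums (\<lambda>k. nc_homog (f j) k (\<lambda>i x. r *\<^sub>R X i x)) (G r j)"
    and L: "\<And>j. sot_lim (\<lambda>r. G r j) (F j) (at_left 1)"
    unfolding value_rad_def by blast
  have rX: "bounded_clinear (\<lambda>x. r *\<^sub>R X i x)" for r i by (intro bounded_clinear_scaleR_op X)
  have scale: "(\<lambda>i x. r *\<^sub>R tens_op (X i) x) = (\<lambda>i. tens_op (\<lambda>x. r *\<^sub>R X i x) :: ('n list, 'd) l2 \<Rightarrow> _)" for r
    by (simp add: scaleR_eq_scaleC tens_op_scaleC X)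
  have F: "bounded_clinear (F j)" for j using L by (simp add: sot_lim_def)
  have G: "bounded_clinear (G r j)" if "\<delta> < r" "r < 1" for r j using N[OF that] by (simp add: norm_sums_def)
  have "norm_sums (\<lambda>k. nc_homog (f j) k (\<lambda>i (x :: ('n list, 'd) l2). r *\<^sub>R tens_op (X i) x)) (tens_op (G r j))"
    if "\<delta> < r" "r < 1" for r j
    unfolding scale by (rule norm_sums_tens_op[where X="\<lambda>i x. r *\<^sub>R X i x", OF rX N[OF that]])
  moreover have "sot_lim (\<lambda>r. tens_op (G r j) :: ('n list, 'd) l2 \<Rightarrow> _) (tens_op (F j)) (at_left 1)" for j
    unfolding sot_lim_def
  \<comment> \<open>Uniform boundedness is an argument about sequences, so the limit at 1 is tested
    along sequences in (\<delta>, 1).\<close>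
  proof (intro conjI allI bounded_clinear_tens_op F tendsto_at_left_sequentially[OF \<delta>(2)])
    fix x :: "('n list, 'd) l2" and s :: "nat \<Rightarrow> real"
    assume s: "\<And>n. s n < 1" "\<And>n. \<delta> < s n" "s \<longlonglongrightarrow> 1"
    have "filterlim s (at_left 1) sequentially"
      unfolding filterlim_at using s by (auto simp: less_imp_neq)
    then have "sot_lim (\<lambda>n. G (s n) j) (F j) sequentially"
      using L[of j] unfolding sot_lim_def by (auto intro: filterlim_compose)
    from sot_lim_tens_op[OF G[OF s(2,1)] this, where 'd='d]
    show "(\<lambda>n. tens_op (G (s n) j) x) \<longlonglongrightarrow> tens_op (F j) x"
      by (simp add: sot_lim_def)
  qed
  ultimately show ?thesis
    unfolding value_rad_def using \<delta> by (intro disjI2 exI[of _ \<delta>] exI[of _ "\<lambda>r j. tens_op (G r j)"]) blast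
qed

section \<open>Intertwining\<close>

lemma sum_nc_homog_tendsto:
  assumes "\<And>i. bounded_clinear (X i)" "norm_sums (\<lambda>k. nc_homog c k X) S"
  shows "(\<lambda>N. \<Sum>k<N. nc_homog c k X x) \<longlonglongrightarrow> S x"
proof -
  let ?D = "\<lambda>N x. (\<Sum>k<N. nc_homog c k X x) - S x"
  have S: "bounded_clinear S" "(\<lambda>N. onorm (?D N)) \<longlonglongrightarrow> 0" using assms by (auto simp: norm_sums_def)
  have D: "bounded_clinear (?D N)" for N
    by (intro bounded_clinear_sub S bounded_clinear_sum_op bounded_clinear_nc_homog assms)
  have "(\<lambda>N. onorm (?D N) * norm x) \<longlonglongrightarrow> 0"
    using tendsto_mult_right[OF S(2), of "norm x"] by simp
  then have "(\<lambda>N. ?D N x) \<longlonglongrightarrow> 0"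
    by (rule Lim_null_comparison[OF always_eventually, rotated]) (intro allI bounded_clinear_onorm[OF D])
  then show ?thesis by (rule LIM_zero_cancel)
qed

context
  fixes W :: "'k::complex_inner \<Rightarrow> 'h::complex_inner" and V :: "'h \<Rightarrow> 'k"
    and X :: "'n::finite \<Rightarrow> 'k \<Rightarrow> 'k" and T :: "'n \<Rightarrow> 'h \<Rightarrow> 'h"
  assumes W: "bounded_clinear W" and V: "bounded_clinear V" and WV: "\<And>x. W (V x) = x"
    and X: "\<And>i. bounded_clinear (X i)" and T: "\<And>i. bounded_clinear (T i)"
    and TW: "\<And>i x. T i (W x) = W (X i x)"
begin

lemma op_word_intertwine: "op_word T \<alpha> (W x) = W (op_word X \<alpha> x)"
  by (induction \<alpha>) (simp_all add: TW)

lemma nc_homog_intertwine: "nc_homog c k T (W x) = W (nc_homog c k X x)"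
  by (simp add: nc_homog_def op_word_intertwine bounded_clinear_sum[OF W] bounded_clinear_scaleC[OF W])

lemma sum_nc_homog_intertwine: "(\<Sum>k\<in>K. nc_homog c k T x) = W (\<Sum>k\<in>K. nc_homog c k X (V x))"
  using nc_homog_intertwine[of c _ "V x"] by (simp add: WV bounded_clinear_sum[OF W])

lemma norm_sums_compress:
  assumes "norm_sums (\<lambda>k. nc_homog c k X) S"
  shows "norm_sums (\<lambda>k. nc_homog c k T) (\<lambda>x. W (S (V x)))"
proof -
  let ?D = "\<lambda>N x. (\<Sum>k<N. nc_homog c k X x) - S x"
  have S: "bounded_clinear S" "(\<lambda>N. onorm (?D N)) \<longlonglongrightarrow> 0" using assms by (auto simp: norm_sums_def)
  have D: "bounded_clinear (?D N)" for N
    by (intro bounded_clinear_sub S bounded_clinear_sum_op bounded_clinear_nc_homog X)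
  have WS: "bounded_clinear (\<lambda>x. W (S (V x)))"
    by (intro bounded_clinear_compose[OF W] bounded_clinear_compose[OF S(1)] V)
  have eq: "(\<lambda>x. (\<Sum>k<N. nc_homog c k T x) - W (S (V x))) = (\<lambda>x. W (?D N (V x)))" for N
    by (simp add: sum_nc_homog_intertwine bounded_clinear_diff[OF W])
  have bl: "bounded_linear W" "bounded_linear V" using W V by (auto simp: bounded_clinear_def)
  have "norm (W (?D N (V x))) \<le> (onorm W * onorm (?D N) * onorm V) * norm x" for N x
  proof -
    have "norm (W (?D N (V x))) \<le> onorm W * norm (?D N (V x))" by (rule bounded_clinear_onorm[OF W])
    also have "\<dots> \<le> onorm W * (onorm (?D N) * norm (V x))"
      by (intro mult_left_mono bounded_clinear_onorm[OF D] onorm_pos_le bl)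
    also have "\<dots> \<le> onorm W * (onorm (?D N) * (onorm V * norm x))"
      using D[of N] by (intro mult_left_mono bounded_clinear_onorm[OF V] onorm_pos_le bl)
        (simp add: bounded_clinear_def)
    finally show ?thesis by (simp add: mult_ac)
  qed
  then have "onorm (\<lambda>x. W (?D N (V x))) \<le> onorm W * onorm (?D N) * onorm V" for N
    using D[of N] by (intro onorm_bound) (auto intro!: mult_nonneg_nonneg onorm_pos_le bl simp: bounded_clinear_def)
  moreover have "0 \<le> onorm (\<lambda>x. W (?D N (V x)))" for N
    using bounded_clinear_compose[OF W bounded_clinear_compose[OF D[of N] V]]
    by (intro onorm_pos_le) (simp add: bounded_clinear_def)
  moreover have "(\<lambda>N. onorm W * onorm (?D N) * onorm V) \<longlonglongrightarrow> 0"
    using tendsto_mult_right[OF tendsto_mult_left[OF S(2), of "onorm W"], of "onorm V"] by simp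
  ultimately have "(\<lambda>N. onorm (\<lambda>x. W (?D N (V x)))) \<longlonglongrightarrow> 0"
    by (rule null_sequence_le)
  then show ?thesis unfolding norm_sums_def eq using WS by blast
qed

end

text \<open>The relation T W = W X passes to words and hence to partial sums, and \<open>V\<close>
  supplies for each vector a preimage under \<open>W\<close>. The second conclusion says that the
  values again satisfy F' W = W F with F' = W F V; it makes a further application possible, with the
  values in place of the tuples.\<close>

lemma value_compress:
  fixes W :: "'k::complex_inner \<Rightarrow> 'h::complex_inner" and V :: "'h \<Rightarrow> 'k"
    and X :: "'n::finite \<Rightarrow> 'k \<Rightarrow> 'k" and T :: "'n \<Rightarrow> 'h \<Rightarrow> 'h"
  assumes W: "bounded_clinear W" and V: "bounded_clinear V" and WV: "\<And>x. W (V x) = x"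
    and X: "\<And>i. bounded_clinear (X i)" and T: "\<And>i. bounded_clinear (T i)"
    and TW: "\<And>i x. T i (W x) = W (X i x)"
    and F: "value_SOT f X F \<or> value_rad f X F"
  shows "value_SOT f T (\<lambda>j x. W (F j (V x))) \<or> value_rad f T (\<lambda>j x. W (F j (V x)))" (is ?value)
    and "W (F j (V (W x))) = W (F j x)"
proof -
  note ctx = W V WV X T TW
  have TrW: "r *\<^sub>R T i (W x) = W (r *\<^sub>R X i x)" for r i x
    by (simp add: TW bounded_clinear_scaleR[OF W])
  note ctxr = W V WV bounded_clinear_scaleR_op[OF X] bounded_clinear_scaleR_op[OF T] TrW
  have "?value \<and> W (F j (V (W x))) = W (F j x)"
    using F
  proof
    assume *: "value_SOT f X F"
    have c: "bounded_clinear (F j)" "(\<lambda>N. \<Sum>k<N. nc_homog (f j) k X x) \<longlonglongrightarrow> F j x" for j x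
      using * by (auto simp: value_SOT_def sot_sums_def sot_lim_def)
    have "value_SOT f T (\<lambda>j x. W (F j (V x)))"
      unfolding value_SOT_def sot_sums_def sot_lim_def sum_nc_homog_intertwine[where W=W and V=V and X=X and T=T, OF ctx]
      by (intro allI conjI bounded_clinear_tendsto[OF W] c bounded_clinear_compose[OF W]
          bounded_clinear_compose[OF c(1)] V)
    then have "(\<lambda>N. \<Sum>k<N. nc_homog (f j) k T (W x)) \<longlonglongrightarrow> W (F j (V (W x)))"
      by (simp add: value_SOT_def sot_sums_def sot_lim_def)
    moreover have "(\<lambda>N. \<Sum>k<N. nc_homog (f j) k T (W x)) \<longlonglongrightarrow> W (F j x)"
      unfolding nc_homog_intertwine[where W=W and V=V and X=X and T=T, OF ctx] bounded_clinear_sum[OF W, symmetric]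
      by (intro bounded_clinear_tendsto[OF W] c)
    ultimately show ?thesis using \<open>value_SOT f T _\<close> LIMSEQ_unique by blast
  next
    assume "value_rad f X F"
    then obtain \<delta> G where \<delta>: "0 < \<delta>" "\<delta> < 1"
      and N: "\<And>r j. \<delta> < r \<Longrightarrow> r < 1 \<Longrightarrow> norm_sums (\<lambda>k. nc_homog (f j) k (\<lambda>i x. r *\<^sub>R X i x)) (G r j)"
      and L: "\<And>j. sot_lim (\<lambda>r. G r j) (F j) (at_left 1)"
      unfolding value_rad_def by blast
    have L': "bounded_clinear (F j)" "((\<lambda>r. G r j x) \<longlongrightarrow> F j x) (at_left 1)" for j x
      using L by (auto simp: sot_lim_def)
    have N': "norm_sums (\<lambda>k. nc_homog (f j) k (\<lambda>i x. r *\<^sub>R T i x)) (\<lambda>x. W (G r j (V x)))"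
      if "\<delta> < r" "r < 1" for r j
      by (rule norm_sums_compress[where W=W and V=V and X="\<lambda>i x. r *\<^sub>R X i x" and T="\<lambda>i x. r *\<^sub>R T i x", OF ctxr N[OF that]])
    have "value_rad f T (\<lambda>j x. W (F j (V x)))"
      unfolding value_rad_def sot_lim_def
      using \<delta> N' by (intro exI[of _ \<delta>] exI[of _ "\<lambda>r j x. W (G r j (V x))"] allI conjI
          bounded_clinear_tendsto[OF W] L' bounded_clinear_compose[OF W] bounded_clinear_compose[OF L'(1)] V) auto
    moreover have "W (F j (V (W x))) = W (F j x)"
    proof (rule tendsto_unique[OF trivial_limit_at_left_real])
      show "((\<lambda>r. W (G r j x)) \<longlongrightarrow> W (F j x)) (at_left 1)"
        by (intro bounded_clinear_tendsto[OF W] L')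
      \<comment> \<open>For fixed r both vectors are limits of the same partial sums, those at the
        scaled \<open>T\<close> applied to \<open>W x\<close>.\<close>
      have eq: "W (G r j (V (W x))) = W (G r j x)" if "\<delta> < r" "r < 1" for r
      proof (rule LIMSEQ_unique)
        show "(\<lambda>K. \<Sum>k<K. nc_homog (f j) k (\<lambda>i x. r *\<^sub>R T i x) (W x)) \<longlonglongrightarrow> W (G r j (V (W x)))"
          by (rule sum_nc_homog_tendsto[where X="\<lambda>i x. r *\<^sub>R T i x", OF bounded_clinear_scaleR_op[OF T] N'[OF that]])
        show "(\<lambda>K. \<Sum>k<K. nc_homog (f j) k (\<lambda>i x. r *\<^sub>R T i x) (W x)) \<longlonglongrightarrow> W (G r j x)"
          unfolding nc_homog_intertwine[where W=W and V=V and X="\<lambda>i x. r *\<^sub>R X i x" and T="\<lambda>i x. r *\<^sub>R T i x", OF ctxr] bounded_clinear_sum[OF W, symmetric]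
          by (intro bounded_clinear_tendsto[OF W]
              sum_nc_homog_tendsto[where X="\<lambda>i x. r *\<^sub>R X i x", OF bounded_clinear_scaleR_op[OF X] N[OF that]])
      qed
      show "((\<lambda>r. W (G r j x)) \<longlongrightarrow> W (F j (V (W x)))) (at_left 1)"
      proof (rule Lim_transform_eventually)
        show "((\<lambda>r. W (G r j (V (W x)))) \<longlongrightarrow> W (F j (V (W x)))) (at_left 1)"
          by (intro bounded_clinear_tendsto[OF W] L')
        show "\<forall>\<^sub>F r in at_left 1. W (G r j (V (W x))) = W (G r j x)"
          using eventually_at_left_real[OF \<delta>(2)] by eventually_elim (simp add: eq)
      qed
    qed
    ultimately show ?thesis by blast
  qed
  then show ?value "W (F j (V (W x))) = W (F j x)" by auto
qed

section \<open>Row contractions\<close>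

lemma op_word_append: "op_word X (\<alpha> @ \<beta>) x = op_word X \<alpha> (op_word X \<beta> x)"
  by (induction \<alpha>) simp_all

section \<open>Sums over words and energies along words\<close>

lemma sum_words_Suc_Cons:
  "(\<Sum>\<alpha>::'n::finite list | length \<alpha> = Suc k. h \<alpha>) = (\<Sum>i\<in>UNIV. \<Sum>\<alpha> | length \<alpha> = k. h (i # \<alpha>))"
proof -
  have "{\<alpha>::'n list. length \<alpha> = Suc k} = (\<lambda>p. fst p # snd p) ` (UNIV \<times> {\<alpha>. length \<alpha> = k})"
    by (auto simp: length_Suc_conv image_iff)
  moreover have "inj_on (\<lambda>p. fst p # snd p) (UNIV \<times> {\<alpha>::'n list. length \<alpha> = k})"
    by (auto simp: inj_on_def prod_eq_iff)
  ultimately show ?thesis by (simp add: sum.reindex sum.cartesian_product split_def)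
qed

text \<open>Splitting off the last letter suits adjoints: in the adjoint of X_\<alpha> X_i the
  adjoint of the new factor X_i acts last, so an inequality for the row applies directly to
  it.\<close>

lemma sum_words_Suc_snoc:
  "(\<Sum>\<alpha>::'n::finite list | length \<alpha> = Suc k. h \<alpha>) = (\<Sum>\<alpha> | length \<alpha> = k. \<Sum>i\<in>UNIV. h (\<alpha> @ [i]))"
proof -
  have "{\<alpha>::'n list. length \<alpha> = Suc k} = (\<lambda>p. fst p @ [snd p]) ` ({\<alpha>. length \<alpha> = k} \<times> UNIV)"
    by (auto simp: length_Suc_conv_rev image_iff)
  moreover have "inj_on (\<lambda>p. fst p @ [snd p]) ({\<alpha>::'n list. length \<alpha> = k} \<times> UNIV)"
    by (auto simp: inj_on_def prod_eq_iff)
  ultimately show ?thesis by (simp add: sum.reindex sum.cartesian_product split_def)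
qed

lemma sum_words_less_Suc:
  "(\<Sum>w::'n::finite list | length w < Suc N. h w) = (\<Sum>w | length w < N. h w) + (\<Sum>w | length w = N. h w)"
proof -
  have "{w::'n list. length w < Suc N} = {w. length w < N} \<union> {w. length w = N}" by auto
  then show ?thesis
    by (simp add: sum.union_disjoint finite_words_less finite_words_eq disjoint_iff)
qed

text \<open>The quadratic form at \<open>x\<close> of the sum of X_\<alpha> X_\<alpha>* over words
  of length k. It measures purity, and its consecutive differences are the blocks of the Poisson
  kernel.\<close>

definition word_energy :: "('n::finite \<Rightarrow> 'h::complex_inner \<Rightarrow> 'h) \<Rightarrow> nat \<Rightarrow> 'h \<Rightarrow> real"
  where "word_energy X k x = (\<Sum>\<alpha> | length \<alpha> = k. (norm (cadj (op_word X \<alpha>) x))\<^sup>2)"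

text \<open>The operator inequality \<Sum> X_i X_i* \<le> r^2 read as quadratic forms, which
  iterates along words without passing through an operator norm.\<close>

definition row_bound :: "('n::finite \<Rightarrow> 'h::complex_inner \<Rightarrow> 'h) \<Rightarrow> real \<Rightarrow> bool"
  where "row_bound X r \<longleftrightarrow> (\<forall>x. (\<Sum>i\<in>UNIV. (norm (cadj (X i) x))\<^sup>2) \<le> r\<^sup>2 * (norm x)\<^sup>2)"

lemma word_energy_nonneg: "0 \<le> word_energy X k x"
  unfolding word_energy_def by (intro sum_nonneg) simp

context
  fixes X :: "'n::finite \<Rightarrow> 'h::chilbert_space \<Rightarrow> 'h"
  assumes X: "\<And>i. bounded_clinear (X i)"
begin

lemma cadj_op_word_append:
  "cadj (op_word X (\<alpha> @ \<beta>)) x = cadj (op_word X \<beta>) (cadj (op_word X \<alpha>) x)"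
proof -
  have "op_word X (\<alpha> @ \<beta>) = op_word X \<alpha> \<circ> op_word X \<beta>" by (simp add: fun_eq_iff op_word_append)
  then show ?thesis by (simp only: cadj_compose bounded_clinear_op_word X o_apply)
qed

lemma cadj_op_word_single: "cadj (op_word X [i]) = cadj (X i)"
  by (simp add: id_def[symmetric] o_def)

lemma cadj_op_word_Nil: "cadj (op_word X []) x = x"
  by (subst cadj_eqI[where B="\<lambda>x. x"]) auto

lemma word_energy_0: "word_energy X 0 x = (norm x)\<^sup>2"
  by (simp add: word_energy_def cadj_op_word_Nil del: op_word.simps)

lemma word_energy_Suc:
  "word_energy X (Suc k) x = (\<Sum>\<alpha> | length \<alpha> = k. \<Sum>i\<in>UNIV. (norm (cadj (X i) (cadj (op_word X \<alpha>) x)))\<^sup>2)"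
  unfolding word_energy_def sum_words_Suc_snoc cadj_op_word_append cadj_op_word_single ..

lemma word_energy_le:
  assumes "row_bound X r"
  shows "word_energy X k x \<le> (r ^ k)\<^sup>2 * (norm x)\<^sup>2"
proof (induction k)
  case (Suc k)
  have "word_energy X (Suc k) x \<le> (\<Sum>\<alpha> | length \<alpha> = k. r\<^sup>2 * (norm (cadj (op_word X \<alpha>) x))\<^sup>2)"
    unfolding word_energy_Suc using assms by (intro sum_mono) (simp add: row_bound_def)
  also have "\<dots> = r\<^sup>2 * word_energy X k x" by (simp add: word_energy_def sum_distrib_left)
  also have "\<dots> \<le> r\<^sup>2 * ((r ^ k)\<^sup>2 * (norm x)\<^sup>2)" by (intro mult_left_mono Suc) simp
  finally show ?case by (simp add: power_mult_distrib mult.assoc)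
qed (simp add: word_energy_0)

lemma norm_word_row_le:
  assumes "row_bound X r" "0 \<le> r"
  shows "norm (\<Sum>\<alpha> | length \<alpha> = k. op_word X \<alpha> (y \<alpha>)) \<le> r ^ k * sqrt (\<Sum>\<alpha> | length \<alpha> = k. (norm (y \<alpha>))\<^sup>2)"
proof (rule norm_row_le)
  show "(\<Sum>\<alpha> | length \<alpha> = k. (norm (cadj (op_word X \<alpha>) z))\<^sup>2) \<le> (r ^ k)\<^sup>2 * (norm z)\<^sup>2" for z
    using word_energy_le[OF assms(1), of k z] by (simp add: word_energy_def)
qed (use assms X in \<open>auto intro: bounded_clinear_op_word\<close>)

text \<open>The row of all X_\<alpha> with |\<alpha>| = k has norm at most r^k and acts on the
  column of the vectors c_\<alpha> x. The number of words of length k therefore does not enter, only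
  the l2 norm of the coefficients.\<close>

lemma norm_nc_homog_le:
  assumes "row_bound X r" "0 \<le> r"
  shows "norm (nc_homog c k X x) \<le> r ^ k * (sqrt (\<Sum>\<alpha> | length \<alpha> = k. (norm (c \<alpha>))\<^sup>2) * norm x)"
proof -
  have "nc_homog c k X x = (\<Sum>\<alpha> | length \<alpha> = k. op_word X \<alpha> (c \<alpha> *\<^sub>C x))"
    unfolding nc_homog_def
    by (intro sum.cong refl) (simp add: bounded_clinear_scaleC[OF bounded_clinear_op_word[of X, OF X]])
  also have "norm \<dots> \<le> r ^ k * sqrt (\<Sum>\<alpha> | length \<alpha> = k. (norm (c \<alpha> *\<^sub>C x))\<^sup>2)"
    by (rule norm_word_row_le[OF assms])
  also have "(\<Sum>\<alpha> | length \<alpha> = k. (norm (c \<alpha> *\<^sub>C x))\<^sup>2) = (\<Sum>\<alpha> | length \<alpha> = k. (norm (c \<alpha>))\<^sup>2) * (norm x)\<^sup>2"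
    by (simp add: norm_scaleC power_mult_distrib sum_distrib_right)
  finally show ?thesis by (simp add: real_sqrt_mult)
qed

text \<open>The coefficients of each degree have l2 norm at most \<open>B\<close>, so degree k
  contributes at most r^k B and the tails are geometric.\<close>

lemma norm_sums_exists:
  assumes row: "row_bound X r" "0 \<le> r" "r < 1" and c: "square_summable c"
  shows "\<exists>S. norm_sums (\<lambda>k. nc_homog c k X) S"
proof -
  define B where "B = sqrt (infsum (\<lambda>\<alpha>. (norm (c \<alpha>))\<^sup>2) UNIV)"
  have B: "0 \<le> B" unfolding B_def by (simp add: infsum_nonneg)
  have le: "norm (nc_homog c k X x) \<le> r ^ k * (B * norm x)" for k x
  proof -
    have "(\<Sum>\<alpha> | length \<alpha> = k. (norm (c \<alpha>))\<^sup>2) \<le> infsum (\<lambda>\<alpha>. (norm (c \<alpha>))\<^sup>2) UNIV"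
      using c by (intro finite_sum_le_infsum finite_words_eq) (auto simp: square_summable_def)
    then have "sqrt (\<Sum>\<alpha> | length \<alpha> = k. (norm (c \<alpha>))\<^sup>2) \<le> B"
      unfolding B_def by (rule real_sqrt_le_mono)
    then show ?thesis
      by (intro order_trans[OF norm_nc_homog_le[OF row(1,2)]] mult_left_mono mult_right_mono) (use row in auto)
  qed
  have geo: "summable (\<lambda>k. r ^ k * (B * norm x))" for x
    using row by (intro summable_mult2 summable_geometric) simp
  have sm: "summable (\<lambda>k. nc_homog c k X x)" for x
    by (rule summable_comparison_test'[OF geo le])
  define S where "S x = (\<Sum>k. nc_homog c k X x)" for x
  have lim: "(\<lambda>N. \<Sum>k<N. nc_homog c k X x) \<longlonglongrightarrow> S x" for x
    unfolding S_def by (rule summable_LIMSEQ[OF sm])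
  have tail: "norm (S x - (\<Sum>k<N. nc_homog c k X x)) \<le> r ^ N * (B / (1 - r)) * norm x" for x N
  proof -
    have "S x - (\<Sum>k<N. nc_homog c k X x) = (\<Sum>k. nc_homog c (k + N) X x)"
      unfolding S_def by (rule suminf_minus_initial_segment[OF sm, symmetric])
    also have "norm \<dots> \<le> (\<Sum>k. r ^ (k + N) * (B * norm x))"
      by (intro norm_suminf_le le summable_ignore_initial_segment[OF geo])
    also have "\<dots> = (\<Sum>k. r ^ k) * (r ^ N * (B * norm x))"
      using row by (subst suminf_mult2) (simp_all add: power_add mult_ac)
    finally show ?thesis using row by (simp add: suminf_geometric)
  qed
  have "bounded_clinear S"
  proof (rule bounded_clinearI)
    have bcl: "bounded_clinear (\<lambda>x. \<Sum>k<N. nc_homog c k X x)" for N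
      by (intro bounded_clinear_sum_op bounded_clinear_nc_homog X)
    show "S (x + y) = S x + S y" for x y
      using tendsto_add[OF lim[of x] lim[of y]] lim[of "x + y"]
      by (intro LIMSEQ_unique) (simp_all add: bounded_clinear_add[OF bcl])
    show "S (a *\<^sub>C x) = a *\<^sub>C S x" for a x
      using bounded_linear.tendsto[OF bounded_linear_scaleC lim[of x], of a] lim[of "a *\<^sub>C x"]
      by (intro LIMSEQ_unique) (simp_all add: bounded_clinear_scaleC[OF bcl])
    show "norm (S x) \<le> (B / (1 - r)) * norm x" for x using tail[of x 0] by simp
  qed
  moreover have "(\<lambda>N. onorm (\<lambda>x. (\<Sum>k<N. nc_homog c k X x) - S x)) \<longlonglongrightarrow> 0"
  proof (rule null_sequence_le)
    show "onorm (\<lambda>x. (\<Sum>k<N. nc_homog c k X x) - S x) \<le> r ^ N * (B / (1 - r))" for N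
      by (rule onorm_bound) (use tail B row in \<open>auto simp: norm_minus_commute[of _ "S _"]\<close>)
    have "bounded_clinear (\<lambda>x. (\<Sum>k<N. nc_homog c k X x) - S x)" for N
      by (intro bounded_clinear_sub \<open>bounded_clinear S\<close> bounded_clinear_sum_op bounded_clinear_nc_homog X)
    then show "0 \<le> onorm (\<lambda>x. (\<Sum>k<N. nc_homog c k X x) - S x)" for N
      by (intro onorm_pos_le) (simp add: bounded_clinear_def)
    show "(\<lambda>N. r ^ N * (B / (1 - r))) \<longlonglongrightarrow> 0"
      using tendsto_mult_right[OF LIMSEQ_power_zero[of r], of "B / (1 - r)"] row by simp
  qed
  ultimately show ?thesis unfolding norm_sums_def by blast
qed

lemma row_bound_if_row_norm_le:
  assumes "row_norm X \<le> r"
  shows "row_bound X r"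
  unfolding row_bound_def
proof
  fix x
  define A where "A x = (\<Sum>i\<in>UNIV. X i (cadj (X i) x))" for x
  have A: "bounded_clinear A"
    unfolding A_def by (intro bounded_clinear_sum_op bounded_clinear_compose[OF X] bounded_clinear_cadj X)
  then have "0 \<le> onorm A" by (simp add: bounded_clinear_def onorm_pos_le)
  moreover have "sqrt (onorm A) \<le> r" using assms by (simp add: row_norm_def A_def[abs_def])
  ultimately have r: "onorm A \<le> r\<^sup>2" by (simp add: sqrt_le_D)
  have "complex_of_real (\<Sum>i\<in>UNIV. (norm (cadj (X i) x))\<^sup>2) = cinner (A x) x"
    unfolding A_def cinner_sum_left by (simp add: cinner_cadj_right[OF X, symmetric] cinner_self)
  then have "(\<Sum>i\<in>UNIV. (norm (cadj (X i) x))\<^sup>2) = Re (cinner (A x) x)"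
    by (metis Re_complex_of_real)
  also have "\<dots> \<le> norm (A x) * norm x"
    using complex_Re_le_cmod norm_cinner_le order_trans by blast
  also have "\<dots> \<le> (onorm A * norm x) * norm x"
    by (intro mult_right_mono bounded_clinear_onorm A) simp
  also have "\<dots> \<le> r\<^sup>2 * (norm x)\<^sup>2"
    using mult_right_mono[OF r, of "norm x * norm x"] by (simp add: power2_eq_square mult.assoc)
  finally show "(\<Sum>i\<in>UNIV. (norm (cadj (X i) x))\<^sup>2) \<le> r\<^sup>2 * (norm x)\<^sup>2" .
qed

lemma norm_row_self_le:
  assumes "row_bound X 1"
  shows "norm (\<Sum>i\<in>UNIV. X i (cadj (X i) x)) \<le> norm x"
proof -
  have b: "(\<Sum>i\<in>UNIV. (norm (cadj (X i) z))\<^sup>2) \<le> 1\<^sup>2 * (norm z)\<^sup>2" for z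
    using assms by (simp add: row_bound_def)
  have "norm (\<Sum>i\<in>UNIV. X i (cadj (X i) x)) \<le> 1 * sqrt (\<Sum>i\<in>UNIV. (norm (cadj (X i) x))\<^sup>2)"
    by (rule norm_row_le[OF X b]) simp_all
  also have "\<dots> \<le> sqrt ((norm x)\<^sup>2)"
    using b[of x] by (simp only: mult_1 power_one) (rule real_sqrt_le_mono)
  finally show ?thesis by simp
qed

lemma row_norm_le_one:
  assumes "row_bound X 1"
  shows "row_norm X \<le> 1"
proof -
  have "onorm (\<lambda>x. \<Sum>i\<in>UNIV. X i (cadj (X i) x)) \<le> 1"
    using norm_row_self_le[OF assms] by (intro onorm_bound) auto
  then show ?thesis by (simp add: row_norm_def)
qed

text \<open>One direction pairs the sum with \<open>x\<close>. For the other, the row of all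
  X_\<alpha> of length k is a contraction, so the norm of the sum at \<open>x\<close> is at most the
  square root of the energy.\<close>

lemma sot_lim_zero_iff_word_energy:
  assumes row: "row_bound X 1"
  shows "sot_lim (\<lambda>k x. \<Sum>\<alpha> | length \<alpha> = k. op_word X \<alpha> (cadj (op_word X \<alpha>) x)) (\<lambda>_. 0) sequentially
    \<longleftrightarrow> (\<forall>x. (\<lambda>k. word_energy X k x) \<longlonglongrightarrow> 0)" (is "?L \<longleftrightarrow> ?R")
proof
  let ?Q = "\<lambda>k x. \<Sum>\<alpha> | length \<alpha> = k. op_word X \<alpha> (cadj (op_word X \<alpha>) x)"
  assume ?L
  then have "(\<lambda>k. ?Q k x) \<longlonglongrightarrow> 0" for x by (simp add: sot_lim_def)
  from tendsto_Re[OF tendsto_cinner[OF this tendsto_const]]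
  have lim: "(\<lambda>k. Re (cinner (?Q k x) x)) \<longlonglongrightarrow> 0" for x by simp
  have "complex_of_real (word_energy X k x) = cinner (?Q k x) x" for k x
    unfolding word_energy_def cinner_sum_left
    by (simp add: cinner_cadj_right[OF bounded_clinear_op_word[of X, OF X], symmetric] cinner_self)
  then have "word_energy X k x = Re (cinner (?Q k x) x)" for k x
    by (metis Re_complex_of_real)
  then show ?R using lim by simp
next
  let ?Q = "\<lambda>k x. \<Sum>\<alpha> | length \<alpha> = k. op_word X \<alpha> (cadj (op_word X \<alpha>) x)"
  assume R: ?R
  have "(\<lambda>k. ?Q k x) \<longlonglongrightarrow> 0" for x
  proof (rule Lim_null_comparison)
    show "\<forall>\<^sub>F k in sequentially. norm (?Q k x) \<le> sqrt (word_energy X k x)"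
      using norm_word_row_le[OF row, where y="\<lambda>\<alpha>. cadj (op_word X \<alpha>) x"]
      by (intro always_eventually allI) (simp add: word_energy_def)
    show "(\<lambda>k. sqrt (word_energy X k x)) \<longlonglongrightarrow> 0"
      using tendsto_real_sqrt[OF R[rule_format, of x]] by simp
  qed
  then show ?L by (simp add: sot_lim_def bounded_clinear_const_zero)
qed

end

text \<open>Polarization recovers the real inner product from norms; replacing x by -ix recovers the
  imaginary part.\<close>

lemma isometry_cinner:
  fixes K :: "'a::complex_inner \<Rightarrow> 'b::complex_inner"
  assumes K: "bounded_clinear K" and iso: "\<And>x. norm (K x) = norm x"
  shows "cinner (K x) (K y) = cinner x y"
proof -
  have re: "inner (K x) (K y) = inner x y" for x y
  proof -
    have "(norm (K x + K y))\<^sup>2 = (norm (x + y))\<^sup>2"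
      using iso[of "x + y"] by (simp add: bounded_clinear_add[OF K])
    then show ?thesis
      using iso[of x] iso[of y] by (simp add: dot_norm)
  qed
  show ?thesis
  proof (rule complex_eqI)
    show "Re (cinner (K x) (K y)) = Re (cinner x y)" using re by (simp add: inner_eq_Re_cinner)
    show "Im (cinner (K x) (K y)) = Im (cinner x y)"
      using re[of "- \<i> *\<^sub>C x" y]
      by (simp add: inner_eq_Re_cinner bounded_clinear_scaleC[OF K] cinner_scaleC_left)
  qed
qed

section \<open>Creation operators\<close>

text \<open>The coefficient space is left general: over the complex numbers this is S_j, over any
  other space it is S_j \<otimes> I, as \<open>tens_op_creation\<close> confirms. In the model space
  it represents left multiplication by f_j.\<close>

definition creation :: "'n \<Rightarrow> ('n list, 'd::complex_inner) l2 \<Rightarrow> ('n list, 'd) l2"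
  where "creation j x = Abs_l2 (\<lambda>w. case w of [] \<Rightarrow> 0 | i # v \<Rightarrow> if i = j then Rep_l2 x v else 0)"

definition backshift :: "'n \<Rightarrow> ('n list, 'd::complex_inner) l2 \<Rightarrow> ('n list, 'd) l2"
  where "backshift j x = Abs_l2 (\<lambda>w. Rep_l2 x (j # w))"

lemma inj_Cons: "inj ((#) j)" by simp

lemma Rep_creation:
  "Rep_l2 (creation j x) w = (case w of [] \<Rightarrow> 0 | i # v \<Rightarrow> if i = j then Rep_l2 x v else 0)"
proof -
  let ?c = "\<lambda>w. case w of [] \<Rightarrow> 0 | i # v \<Rightarrow> if i = j then Rep_l2 x v else 0"
  have "(\<lambda>w. (norm (?c w))\<^sup>2) summable_on range ((#) j)"
    using l2_summable[of x] by (subst summable_on_reindex) (simp_all add: o_def)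
  then have "(\<lambda>w. (norm (?c w))\<^sup>2) summable_on UNIV"
    by (rule summable_on_cong_neutral[THEN iffD1, rotated -1]) (auto split: list.split)
  then show ?thesis by (simp add: creation_def Rep_Abs_l2)
qed

lemma Rep_backshift: "Rep_l2 (backshift j x) w = Rep_l2 x (j # w)"
proof -
  have "(\<lambda>w. (norm (Rep_l2 x w))\<^sup>2) summable_on range ((#) j)"
    by (rule summable_on_subset_banach[OF l2_summable]) simp
  then have "(\<lambda>w. (norm (Rep_l2 x (j # w)))\<^sup>2) summable_on UNIV"
    by (subst (asm) summable_on_reindex) (simp_all add: o_def)
  then show ?thesis by (simp add: backshift_def Rep_Abs_l2)
qed

lemma cinner_backshift: "cinner (backshift j y) x = cinner y (creation j x)"
proof -
  have "cinner y (creation j x) = infsum (\<lambda>w. cinner (Rep_l2 y w) (Rep_l2 (creation j x) w)) (range ((#) j))"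
    unfolding cinner_l2_def
    by (rule infsum_cong_neutral) (auto simp: Rep_creation split: list.split)
  also have "\<dots> = cinner (backshift j y) x"
    unfolding cinner_l2_def infsum_reindex[OF inj_Cons] by (simp add: o_def Rep_creation Rep_backshift)
  finally show ?thesis ..
qed

lemma cadj_creation: "cadj (creation j) = backshift j"
  by (rule cadj_eqI) (rule cinner_backshift)

lemma backshift_creation: "backshift j (creation j x) = x"
  by (rule l2_eqI) (simp add: Rep_backshift Rep_creation)

lemma norm_creation: "norm (creation j x) = norm x"
proof -
  have "cinner (creation j x) (creation j x) = cinner x x"
    using cinner_backshift[of j "creation j x" x] by (simp add: backshift_creation)
  then have "(norm (creation j x))\<^sup>2 = (norm x)\<^sup>2" by (simp add: norm_square_eq_Re_cinner)
  then show ?thesis by simp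
qed

lemma bounded_clinear_creation: "bounded_clinear (creation j)"
  by (rule bounded_clinearI[of _ 1])
    (auto intro!: l2_eqI simp: Rep_creation Rep_l2_simps norm_creation split: list.split)

lemma creation_tens: "creation j (tens a d) = tens (creation j a) d"
  by (rule l2_eqI) (simp add: Rep_creation Rep_tens split: list.split)

lemma tens_op_creation: "tens_op (creation j) = creation j"
  by (rule tens_op_eqI) (auto simp: bounded_clinear_creation creation_tens)

text \<open>Every nonempty word has a unique first letter, so the backward shifts together see every
  coordinate except the one at the empty word.\<close>

lemma sum_norm_backshift:
  fixes x :: "('n::finite list, 'd::complex_inner) l2"
  shows "(\<Sum>i\<in>UNIV. (norm (backshift i x))\<^sup>2) = (norm x)\<^sup>2 - (norm (Rep_l2 x []))\<^sup>2"
proof -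
  have "(\<Sum>w | length w < Suc N. h w) = h [] + (\<Sum>i\<in>UNIV. \<Sum>w | length w < N. h (i # w))"
    for N and h :: "'n list \<Rightarrow> real"
    by (induction N) (simp_all add: sum_words_less_Suc sum_words_Suc_Cons sum.distrib add.assoc)
  then have "(\<lambda>N. (norm (Rep_l2 x []))\<^sup>2 + (\<Sum>i\<in>UNIV. \<Sum>w | length w < N. (norm (Rep_l2 (backshift i x) w))\<^sup>2))
      \<longlonglongrightarrow> (norm x)\<^sup>2"
    using LIMSEQ_Suc[OF norm_l2_eq_limit[of x]] by (simp add: Rep_backshift)
  moreover have "(\<lambda>N. (norm (Rep_l2 x []))\<^sup>2 + (\<Sum>i\<in>UNIV. \<Sum>w | length w < N. (norm (Rep_l2 (backshift i x) w))\<^sup>2))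
      \<longlonglongrightarrow> (norm (Rep_l2 x []))\<^sup>2 + (\<Sum>i\<in>UNIV. (norm (backshift i x))\<^sup>2)"
    by (intro tendsto_intros norm_l2_eq_limit)
  ultimately show ?thesis using LIMSEQ_unique by fastforce
qed

lemma Rep_cadj_op_word_creation:
  "Rep_l2 (cadj (op_word creation \<alpha>) x) w = Rep_l2 (x :: ('n::finite list, 'd::chilbert_space) l2) (\<alpha> @ w)"
proof (induction \<alpha> arbitrary: x)
  case Nil show ?case by (simp add: cadj_op_word_Nil[of creation, OF bounded_clinear_creation] del: op_word.simps)
next
  case (Cons i \<alpha>)
  have "cadj (op_word creation ([i] @ \<alpha>)) x = cadj (op_word creation \<alpha>) (backshift i x)"
    by (simp only: cadj_op_word_append[of creation, OF bounded_clinear_creation]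
        cadj_op_word_single[of creation, OF bounded_clinear_creation] cadj_creation)
  then show ?case using Cons.IH by (simp only: append_Cons append_Nil Rep_backshift)
qed

text \<open>The k-th energy is the squared norm of the part of \<open>x\<close> on words of length
  at least k, hence a tail of a convergent sum.\<close>

lemma word_energy_creation_tendsto:
  fixes x :: "('n::finite list, 'd::chilbert_space) l2"
  shows "(\<lambda>k. word_energy creation k x) \<longlonglongrightarrow> 0"
proof -
  have "word_energy creation k x = (norm x)\<^sup>2 - (\<Sum>w | length w < k. (norm (Rep_l2 x w))\<^sup>2)" for k
  proof (induction k)
    case 0 show ?case by (simp add: word_energy_0[of creation, OF bounded_clinear_creation])
  next
    case (Suc k)
    have "word_energy creation (Suc k) x
        = (\<Sum>\<alpha> | length \<alpha> = k. (norm (cadj (op_word creation \<alpha>) x))\<^sup>2 - (norm (Rep_l2 x \<alpha>))\<^sup>2)"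
      by (simp add: word_energy_Suc[of creation, OF bounded_clinear_creation] cadj_creation
          sum_norm_backshift Rep_cadj_op_word_creation)
    also have "\<dots> = word_energy creation k x - (\<Sum>\<alpha> | length \<alpha> = k. (norm (Rep_l2 x \<alpha>))\<^sup>2)"
      by (simp add: word_energy_def sum_subtractf)
    finally show ?case by (simp add: Suc sum_words_less_Suc)
  qed
  then show ?thesis
    using tendsto_diff[OF tendsto_const[of "(norm x)\<^sup>2"] norm_l2_eq_limit[of x]] by simp
qed

section \<open>The Poisson kernel of a pure row contraction\<close>

text \<open>The coordinate of K x at w is D F_w* x, where D^2 = 1 - \<Sum> F_i F_i*. By the choice
  of D, the squared norms over words of length N sum to a difference of consecutive energies; they
  telescope, and purity removes the remainder, which makes K isometric. The shift relation is the
  rule that the adjoint of F_i F_w is F_w* F_i*.\<close>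

lemma poisson_kernel_exists:
  fixes F :: "'n::finite \<Rightarrow> 'h::chilbert_space \<Rightarrow> 'h"
  assumes F: "\<And>i. bounded_clinear (F i)" and row: "row_bound F 1"
    and pure: "\<And>x. (\<lambda>k. word_energy F k x) \<longlonglongrightarrow> 0"
  obtains K :: "'h \<Rightarrow> ('n list, 'h) l2"
  where "bounded_clinear K" "\<And>x y. cinner (K x) (K y) = cinner x y"
    "\<And>i x. K (cadj (F i) x) = backshift i (K x)"
proof -
  define A where "A x = (\<Sum>i\<in>UNIV. F i (cadj (F i) x))" for x
  have A: "bounded_clinear A"
    unfolding A_def by (intro bounded_clinear_sum_op bounded_clinear_compose[OF F] bounded_clinear_cadj F)
  have "cinner (A x) y = cinner x (A y)" for x y
    unfolding A_def cinner_sum_left cinner_sum_right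
    by (simp add: cinner_cadj_left[OF F, symmetric] cinner_cadj_right[OF F, symmetric])
  moreover have "norm (A x) \<le> norm x" for x
    unfolding A_def by (rule norm_row_self_le[OF F row])
  ultimately obtain D where D: "bounded_clinear D" "\<And>x y. cinner (D x) y = cinner x (D y)"
    "\<And>x. D (D x) = x - A x"
    using sqrt_one_minus[OF A] by metis
  have normD: "(norm (D x))\<^sup>2 = (norm x)\<^sup>2 - (\<Sum>i\<in>UNIV. (norm (cadj (F i) x))\<^sup>2)" for x
  proof -
    have "complex_of_real ((norm (D x))\<^sup>2) = cinner x x - (\<Sum>i\<in>UNIV. cinner (cadj (F i) x) (cadj (F i) x))"
      unfolding cinner_self[symmetric] D(2,3) cinner_diff_right A_def cinner_sum_right
      by (simp add: cinner_cadj_left[OF F])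
    also have "\<dots> = of_real ((norm x)\<^sup>2 - (\<Sum>i\<in>UNIV. (norm (cadj (F i) x))\<^sup>2))"
      by (simp add: cinner_self)
    finally show ?thesis using of_real_eq_iff by blast
  qed
  define k where "k x w = D (cadj (op_word F w) x)" for x w
  have part: "(\<Sum>w | length w < N. (norm (k x w))\<^sup>2) = (norm x)\<^sup>2 - word_energy F N x" for N x
  proof (induction N)
    case 0 show ?case by (simp add: word_energy_0[OF F])
  next
    case (Suc N)
    have "(\<Sum>w | length w = N. (norm (k x w))\<^sup>2) = word_energy F N x - word_energy F (Suc N) x"
      unfolding word_energy_Suc[OF F] by (simp add: k_def normD sum_subtractf word_energy_def)
    then show ?case by (simp add: sum_words_less_Suc Suc)
  qed
  have "(\<lambda>w. (norm (k x w))\<^sup>2) summable_on UNIV" for x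
  proof (rule nonneg_bdd_above_summable_on)
    have "(\<Sum>w\<in>E. (norm (k x w))\<^sup>2) \<le> (norm x)\<^sup>2" if "finite E" for E
    proof -
      have "length w < Suc (Max (insert 0 (length ` E)))" if "w \<in> E" for w
        using that \<open>finite E\<close> by (simp add: less_Suc_eq_le)
      then have "(\<Sum>w\<in>E. (norm (k x w))\<^sup>2) \<le> (\<Sum>w | length w < Suc (Max (insert 0 (length ` E))). (norm (k x w))\<^sup>2)"
        by (intro sum_mono2 finite_words_less) auto
      also have "\<dots> \<le> (norm x)\<^sup>2" unfolding part using word_energy_nonneg by simp
      finally show ?thesis .
    qed
    then show "bdd_above (sum (\<lambda>w. (norm (k x w))\<^sup>2) ` {E. E \<subseteq> UNIV \<and> finite E})"
      by (auto intro!: bdd_aboveI2)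
  qed simp
  then have Rep_K: "Rep_l2 (Abs_l2 (k x)) = k x" for x by (rule Rep_Abs_l2)
  define K where "K x = Abs_l2 (k x)" for x
  have Rep_K: "Rep_l2 (K x) w = D (cadj (op_word F w) x)" for x w
    unfolding K_def Rep_K k_def ..
  have "(\<lambda>N. (norm x)\<^sup>2 - word_energy F N x) \<longlonglongrightarrow> (norm (K x))\<^sup>2" for x
    using norm_l2_eq_limit[of "K x"] part[of x] by (simp add: Rep_K k_def)
  moreover have "(\<lambda>N. (norm x)\<^sup>2 - word_energy F N x) \<longlonglongrightarrow> (norm x)\<^sup>2" for x
    using tendsto_diff[OF tendsto_const[of "(norm x)\<^sup>2"] pure[of x]] by simp
  ultimately have "(norm (K x))\<^sup>2 = (norm x)\<^sup>2" for x using LIMSEQ_unique by blast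
  then have iso: "norm (K x) = norm x" for x by simp
  have bw: "bounded_clinear (cadj (op_word F w))" for w
    by (intro bounded_clinear_cadj bounded_clinear_op_word F)
  have K: "bounded_clinear K"
    by (rule bounded_clinearI[of _ 1])
      (auto intro!: l2_eqI simp: Rep_K Rep_l2_simps iso bounded_clinear_add[OF bw]
        bounded_clinear_add[OF D(1)] bounded_clinear_scaleC[OF bw] bounded_clinear_scaleC[OF D(1)])
  have "K (cadj (F i) x) = backshift i (K x)" for i x
    using cadj_op_word_append[of F "[i]", OF F] cadj_op_word_single[of F i, OF F]
    by (intro l2_eqI) (simp add: Rep_K Rep_backshift del: op_word.simps)
  with K isometry_cinner[OF K iso] show thesis by (rule that)
qed

lemma
  fixes F :: "'n::finite \<Rightarrow> 'h::chilbert_space \<Rightarrow> 'h" and K :: "'h \<Rightarrow> ('n list, 'h) l2"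
  assumes F: "\<And>i. bounded_clinear (F i)" and K: "bounded_clinear K"
    and iso: "\<And>x y. cinner (K x) (K y) = cinner x y"
    and shift: "\<And>i x. K (cadj (F i) x) = backshift i (K x)"
  shows poisson_left_inverse: "cadj K (K x) = x"
    and poisson_intertwine: "F i (cadj K y) = cadj K (creation i y)"
proof -
  show "cadj K (K x) = x" by (rule cinner_ext_left) (simp add: cinner_cadj_left[OF K] iso)
  show "F i (cadj K y) = cadj K (creation i y)"
  proof (rule cinner_ext_right)
    fix z
    have "cinner z (F i (cadj K y)) = cinner (K (cadj (F i) z)) y"
      by (simp add: cinner_cadj_left[OF F, symmetric] cinner_cadj_right[OF K])
    also have "\<dots> = cinner z (cadj K (creation i y))"
      by (simp add: shift cinner_backshift cinner_cadj_right[OF K])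
    finally show "cinner z (F i (cadj K y)) = cinner z (cadj K (creation i y))" .
  qed
qed

section \<open>Left multiplication operators\<close>

text \<open>Multiplication in terms of coefficient families, without reference to f: the form in
  which the three cases of the model property become comparable. Each coordinate of
  \<open>nc_mult\<close> is a finite sum, so \<open>p\<close> may be an arbitrary series.\<close>

definition left_mult_op :: "'n series \<Rightarrow> (('n list, complex) l2 \<Rightarrow> ('n list, complex) l2) \<Rightarrow> bool"
  where "left_mult_op p M \<longleftrightarrow> bounded_clinear M \<and> (\<forall>x. Rep_l2 (M x) = nc_mult p (Rep_l2 x))"

lemma total_tens_ket:
  "closure (cspan {tens (ket w) d |w d. True}) = (UNIV :: ('n::finite list, 'd::complex_inner) l2 set)"
proof -
  have "x \<in> closure (cspan {tens (ket w) d |w d. True})" for x :: "('n list, 'd) l2"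
    unfolding closure_sequential
  proof (intro exI conjI allI)
    show "(\<lambda>N. \<Sum>w | length w < N. tens (ket w) (Rep_l2 x w)) \<longlonglongrightarrow> x"
      by (rule sum_tens_ket_tendsto)
    show "(\<Sum>w | length w < N. tens (ket w) (Rep_l2 x w)) \<in> cspan {tens (ket w) d |w d. True}" for N
      unfolding cspan_def by (auto intro!: csubspace_sum)
  qed
  then show ?thesis by blast
qed

lemma total_ket: "closure (cspan (range ket)) = (UNIV :: ('n::finite list, complex) l2 set)"
proof -
  have "x \<in> closure (cspan (range ket))" for x :: "('n list, complex) l2"
    unfolding closure_sequential
  proof (intro exI conjI allI)
    show "(\<lambda>N. \<Sum>w | length w < N. Rep_l2 x w *\<^sub>C ket w) \<longlonglongrightarrow> x"
      by (rule sum_ket_tendsto)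
    show "(\<Sum>w | length w < N. Rep_l2 x w *\<^sub>C ket w) \<in> cspan (range ket)" for N
      unfolding cspan_def
      by (intro InterI csubspace_sum) (auto simp: csubspace_def image_subset_iff)
  qed
  then show ?thesis by blast
qed

lemma nc_mult_ket:
  "nc_mult p (Rep_l2 (ket \<beta>)) w = (\<Sum>k\<le>length w. if drop k w = \<beta> then p (take k w) else 0)"
  unfolding nc_mult_def Rep_ket by (intro sum.cong) auto

text \<open>Both sides are, at each word, finite combinations of coordinates of \<open>x\<close>, hence continuous in \<open>x\<close>.\<close>

lemma left_mult_opI:
  fixes M :: "('n::finite list, complex) l2 \<Rightarrow> ('n list, complex) l2"
  assumes M: "bounded_clinear M" and ket: "\<And>\<beta>. Rep_l2 (M (ket \<beta>)) = nc_mult p (Rep_l2 (ket \<beta>))"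
  shows "left_mult_op p M"
  unfolding left_mult_op_def
proof (intro conjI allI M ext)
  fix x w
  have "(\<lambda>x. Rep_l2 (M x) w) = (\<lambda>x. \<Sum>k\<le>length w. p (take k w) *\<^sub>C Rep_l2 x (drop k w))"
  proof (rule bounded_clinear_eq_if_total[OF _ _ total_ket])
    show "bounded_clinear (\<lambda>x. Rep_l2 (M x) w)"
      by (intro bounded_clinear_compose[OF bounded_clinear_Rep_l2 M])
    show "bounded_clinear (\<lambda>x. \<Sum>k\<le>length w. p (take k w) *\<^sub>C Rep_l2 x (drop k w))"
      by (intro bounded_clinear_sum_op bounded_clinear_scaleC_op bounded_clinear_Rep_l2)
    show "Rep_l2 (M y) w = (\<Sum>k\<le>length w. p (take k w) *\<^sub>C Rep_l2 y (drop k w))"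
      if "y \<in> range ket" for y
      using that ket by (auto simp: nc_mult_def scaleC_complex_def)
  qed
  from fun_cong[OF this, of x] show "Rep_l2 (M x) w = nc_mult p (Rep_l2 x) w"
    by (simp add: nc_mult_def scaleC_complex_def)
qed

lemma left_mult_op_unique: "left_mult_op p M \<Longrightarrow> left_mult_op p M' \<Longrightarrow> M = M'"
  by (auto simp: left_mult_op_def fun_eq_iff Rep_l2_inject[symmetric])

lemma Rep_op_word_creation:
  "Rep_l2 (op_word creation \<alpha> x) w = (if take (length \<alpha>) w = \<alpha> then Rep_l2 x (drop (length \<alpha>) w) else 0)"
proof (induction \<alpha> arbitrary: w)
  case (Cons i \<alpha>)
  then show ?case by (cases w) (auto simp: Rep_creation)
qed simp

lemma Rep_nc_homog_creation:
  fixes x :: "('n::finite list, 'd::complex_inner) l2"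
  shows "Rep_l2 (nc_homog c k creation x) w
    = (if k \<le> length w then c (take k w) *\<^sub>C Rep_l2 x (drop k w) else 0)"
proof -
  have "Rep_l2 (nc_homog c k creation x) w
      = (\<Sum>\<alpha> | length \<alpha> = k. if \<alpha> = take k w then c (take k w) *\<^sub>C Rep_l2 x (drop k w) else 0)"
    unfolding nc_homog_def Rep_l2_sum Rep_scaleC_l2 Rep_op_word_creation
    by (intro sum.cong refl) (simp add: eq_commute[of _ "take k w"])
  then show ?thesis by (simp add: sum.delta[OF finite_words_eq] min_def)
qed

lemma left_mult_op_creation: "left_mult_op (nc_var j) (creation (j :: 'n::finite))"
proof (rule left_mult_opI[OF bounded_clinear_creation], rule ext)
  fix \<beta> w
  have "nc_mult (nc_var j) (Rep_l2 (ket \<beta>)) w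
      = (\<Sum>k\<le>length w. if k = 1 \<and> w = j # \<beta> then 1 else 0)"
    unfolding nc_mult_ket
  proof (intro sum.cong refl)
    fix k assume "k \<in> {..length w}"
    then show "(if drop k w = \<beta> then nc_var j (take k w) else 0) = (if k = 1 \<and> w = j # \<beta> then 1 else 0)"
      by (cases w; cases k) (auto simp: nc_var_def)
  qed
  also have "\<dots> = (if w = j # \<beta> then 1 else 0)"
    by (cases "w = j # \<beta>") (simp_all del: sum.atMost_Suc)
  also have "\<dots> = Rep_l2 (creation j (ket \<beta>)) w"
    by (auto simp: Rep_creation Rep_ket split: list.split)
  finally show "Rep_l2 (creation j (ket \<beta>)) w = nc_mult (nc_var j) (Rep_l2 (ket \<beta>)) w" ..
qed

text \<open>On a basis vector the partial sums are truncations of the image. On general vectors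
  strong convergence may fail, which is why only the radial value is established later.\<close>

lemma sum_nc_homog_creation_ket_tendsto:
  fixes M :: "('n::finite list, complex) l2 \<Rightarrow> ('n list, complex) l2"
  assumes "left_mult_op p M"
  shows "(\<lambda>N. \<Sum>k<N. nc_homog p k creation (ket \<beta>)) \<longlonglongrightarrow> M (ket \<beta>)"
proof (rule truncation_tendsto[where m="length \<beta>"])
  fix N w
  let ?h = "\<lambda>k. if drop k w = \<beta> then p (take k w) else 0"
  have "Rep_l2 (\<Sum>k<N. nc_homog p k creation (ket \<beta>)) w = (\<Sum>k<N. if k \<le> length w then ?h k else 0)"
    unfolding Rep_l2_sum Rep_nc_homog_creation Rep_ket
    by (intro sum.cong) (auto simp: scaleC_complex_def)
  \<comment> \<open>A suffix equal to \<beta> occurs only at k = |w| - |\<beta>|, so the cutoff k <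
    N is the cutoff |w| < N + |\<beta>|.\<close>
  also have "\<dots> = (if length w < N + length \<beta> then \<Sum>k\<le>length w. ?h k else 0)"
  proof (cases "length w < N + length \<beta>")
    case True
    then show ?thesis
      by (simp, intro sum.mono_neutral_cong) auto
  next
    case False
    then have "(\<Sum>k<N. if k \<le> length w then ?h k else 0) = 0"
      by (intro sum.neutral) auto
    then show ?thesis using False by simp
  qed
  also have "\<dots> = (if length w < N + length \<beta> then Rep_l2 (M (ket \<beta>)) w else 0)"
    using assms by (simp add: left_mult_op_def nc_mult_ket)
  finally show "Rep_l2 (\<Sum>k<N. nc_homog p k creation (ket \<beta>)) w
      = (if length w < N + length \<beta> then Rep_l2 (M (ket \<beta>)) w else 0)" .
qed

lemma cadj_scaleR:
  fixes A :: "'a::chilbert_space \<Rightarrow> 'b::complex_inner"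
  assumes "bounded_clinear A"
  shows "cadj (\<lambda>x. r *\<^sub>R A x) = (\<lambda>y. r *\<^sub>R cadj A y)"
  by (rule cadj_eqI)
    (simp add: scaleR_eq_scaleC cinner_scaleC_left cinner_scaleC_right cinner_cadj_left assms)

lemma row_bound_scaled_creation:
  "row_bound (\<lambda>i (x :: ('n::finite list, 'd::chilbert_space) l2). r *\<^sub>R creation i x) r"
proof -
  have "(\<Sum>i\<in>UNIV. (norm (r *\<^sub>R backshift i x))\<^sup>2) = r\<^sup>2 * (\<Sum>i\<in>UNIV. (norm (backshift i x))\<^sup>2)"
    for x :: "('n list, 'd) l2"
    by (simp add: power_mult_distrib sum_distrib_left)
  then show ?thesis
    by (simp add: row_bound_def cadj_scaleR bounded_clinear_creation cadj_creation sum_norm_backshift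
        mult_left_mono)
qed

lemma square_summable_Rep_l2: "square_summable (Rep_l2 x)"
  by (simp add: square_summable_def l2_summable)

text \<open>\<open>ket []\<close> represents the series 1, and multiplying it returns the symbol.
  Symbols of bounded left multiplications are thus square-summable.\<close>

lemma left_mult_op_symbol:
  assumes "left_mult_op p M"
  shows "p = Rep_l2 (M (ket []))"
proof
  fix w
  have "Rep_l2 (M (ket [])) w = (\<Sum>k\<le>length w. if k = length w then p w else 0)"
    using assms unfolding left_mult_op_def
    by (simp add: nc_mult_ket)
  then show "p w = Rep_l2 (M (ket [])) w" by simp
qed

text \<open>Through the Poisson kernel of the strict row contraction \<open>r S\<close>, the value of the symbol at \<open>r S\<close> is
  a compression of \<open>M \<otimes> I\<close>.\<close>

lemma norm_dilated_symbol_le: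
  fixes M :: "('n::finite list, complex) l2 \<Rightarrow> ('n list, complex) l2"
  assumes M: "left_mult_op p M" and r: "0 < r" "r < 1"
    and G: "norm_sums (\<lambda>k. nc_homog p k (\<lambda>i (x :: ('n list, complex) l2). r *\<^sub>R creation i x)) G"
  shows "norm (G x) \<le> onorm M * norm x"
proof -
  define F where "F i x = r *\<^sub>R creation i x" for i and x :: "('n list, complex) l2"
  have Mb: "bounded_clinear M" using M by (simp add: left_mult_op_def)
  have F: "bounded_clinear (F i)" for i
    unfolding F_def by (intro bounded_clinear_scaleR_op bounded_clinear_creation)
  have row: "row_bound F r" unfolding F_def[abs_def] by (rule row_bound_scaled_creation)
  then have "row_bound F 1"
    unfolding row_bound_def using r
    by (meson mult_right_mono order_trans power_mono less_imp_le zero_le_power2)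
  moreover have "(\<lambda>k. word_energy F k x) \<longlonglongrightarrow> 0" for x
  proof (rule null_sequence_le[OF word_energy_le[OF F row] word_energy_nonneg])
    have "(\<lambda>k. (r ^ k)\<^sup>2) \<longlonglongrightarrow> 0\<^sup>2" using r by (intro tendsto_power LIMSEQ_power_zero) simp
    then show "(\<lambda>k. (r ^ k)\<^sup>2 * (norm x)\<^sup>2) \<longlonglongrightarrow> 0"
      using tendsto_mult_right[of "\<lambda>k. (r ^ k)\<^sup>2" 0 sequentially "(norm x)\<^sup>2"] by simp
  qed
  ultimately obtain K :: "('n list, complex) l2 \<Rightarrow> ('n list, ('n list, complex) l2) l2"
    where K: "bounded_clinear K" "\<And>x y. cinner (K x) (K y) = cinner x y"
      "\<And>i x. K (cadj (F i) x) = backshift i (K x)"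
    using poisson_kernel_exists[of F, OF F] by blast
  define W where "W = cadj K"
  have W: "bounded_clinear W" unfolding W_def by (rule bounded_clinear_cadj[OF K(1)])
  have WK: "W (K x) = x" for x unfolding W_def by (rule poisson_left_inverse[OF F K])
  have FW: "F i (W y) = W (creation i y)" for i y
    unfolding W_def by (rule poisson_intertwine[OF F K])
  have G': "norm_sums (\<lambda>k. nc_homog p k F) G" using G by (simp add: F_def[abs_def])
  then have Gb: "bounded_clinear G" by (simp add: norm_sums_def)
  \<comment> \<open>\<open>M\<close> need not be the strong sum of its series at the creation
    operators, so the relation is checked on tensors of basis vectors, where the partial sums do
    converge.\<close>
  have "(\<lambda>y. G (W y)) = (\<lambda>y. W (tens_op M y))"
  proof (rule bounded_clinear_eq_if_total[OF _ _ total_tens_ket])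
    show "bounded_clinear (\<lambda>y. G (W y))" by (rule bounded_clinear_compose[OF Gb W])
    show "bounded_clinear (\<lambda>y. W (tens_op M y))"
      by (rule bounded_clinear_compose[OF W bounded_clinear_tens_op[OF Mb]])
    fix y :: "('n list, ('n list, complex) l2) l2" assume "y \<in> {tens (ket w) d |w d. True}"
    then obtain \<beta> d where y: "y = tens (ket \<beta>) d" by blast
    have c: "(\<Sum>k<N. nc_homog p k creation y) = tens (\<Sum>k<N. nc_homog p k creation (ket \<beta>)) d" for N
    proof -
      let ?S = "\<lambda>x :: ('n list, complex) l2. \<Sum>k<N. nc_homog p k creation x"
      have "tens_op ?S y = (\<Sum>k<N. nc_homog p k creation y)"
        using fun_cong[OF sum_nc_homog_tens_op[where X=creation and c=p and N=N and 'd="('n list, complex) l2",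
            OF bounded_clinear_creation], of y]
        by (simp add: tens_op_creation)
      moreover have "bounded_clinear ?S"
        by (intro bounded_clinear_sum_op bounded_clinear_nc_homog bounded_clinear_creation)
      ultimately show ?thesis by (simp add: y tens_op_tens)
    qed
    show "G (W y) = W (tens_op M y)"
    proof (rule LIMSEQ_unique)
      show "(\<lambda>N. \<Sum>k<N. nc_homog p k F (W y)) \<longlonglongrightarrow> G (W y)"
        by (rule sum_nc_homog_tendsto[where X=F, OF F G'])
      have "(\<Sum>k<N. nc_homog p k F (W y)) = W (tens (\<Sum>k<N. nc_homog p k creation (ket \<beta>)) d)" for N
        unfolding c[symmetric] bounded_clinear_sum[OF W]
        by (intro sum.cong refl nc_homog_intertwine[where W=W and V=K and X=creation and T=F,
              OF W K(1) WK bounded_clinear_creation F FW])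
      moreover have "(\<lambda>N. W (tens (\<Sum>k<N. nc_homog p k creation (ket \<beta>)) d)) \<longlonglongrightarrow> W (tens (M (ket \<beta>)) d)"
        by (intro bounded_clinear_tendsto[OF W] bounded_clinear_tendsto[OF bounded_clinear_tens_left]
            sum_nc_homog_creation_ket_tendsto[OF M])
      ultimately show "(\<lambda>N. \<Sum>k<N. nc_homog p k F (W y)) \<longlonglongrightarrow> W (tens_op M y)"
        by (simp add: y tens_op_tens[OF Mb])
    qed
  qed
  from fun_cong[OF this, of "K x"] have Gx: "G x = W (tens_op M (K x))" by (simp add: WK)
  have isoK: "norm (K x) \<le> 1 * norm x" for x
  proof -
    have "(norm (K x))\<^sup>2 = (norm x)\<^sup>2" using K(2)[of x x] by (simp add: norm_square_eq_Re_cinner)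
    then show ?thesis by simp
  qed
  have "norm (G x) \<le> 1 * norm (tens_op M (K x))"
    unfolding Gx W_def by (rule norm_cadj_le[OF K(1) isoK]) simp
  also have "\<dots> \<le> onorm M * norm (K x)"
    using norm_tens_op_le[OF Mb bounded_clinear_onorm[OF Mb]] Mb
    by (simp add: bounded_clinear_def onorm_pos_le)
  also have "\<dots> \<le> onorm M * norm x"
    using isoK[of x] Mb by (intro mult_left_mono) (simp_all add: bounded_clinear_def onorm_pos_le)
  finally show ?thesis .
qed

text \<open>Square-summability of the symbol gives norm convergence at rS for every r < 1. The bound
  by the norm of \<open>M i\<close>, uniform in r, then reduces the limit r \<rightarrow> 1 to basis
  vectors.\<close>

lemma value_rad_creation:
  fixes p :: "'n::finite \<Rightarrow> 'n series"
  assumes M: "\<And>i. left_mult_op (p i) (M i)"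
  shows "value_rad p creation M"
proof -
  have Mb: "bounded_clinear (M i)" for i using M by (simp add: left_mult_op_def)
  have C: "bounded_clinear (creation i :: ('n list, complex) l2 \<Rightarrow> _)" for i :: 'n
    by (rule bounded_clinear_creation)
  have rC: "bounded_clinear (\<lambda>x :: ('n list, complex) l2. r *\<^sub>R creation i x)" for r and i :: 'n
    by (intro bounded_clinear_scaleR_op C)
  have "\<exists>G. norm_sums (\<lambda>k. nc_homog (p j) k (\<lambda>i (x :: ('n list, complex) l2). r *\<^sub>R creation i x)) G"
    if "0 < r" "r < 1" for r j
    using that left_mult_op_symbol[OF M[of j]] square_summable_Rep_l2[of "M j (ket [])"]
    by (intro norm_sums_exists[where X="\<lambda>i x. r *\<^sub>R creation i x", OF rC row_bound_scaled_creation]) auto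
  then obtain G where G: "\<And>r j. 0 < r \<Longrightarrow> r < 1 \<Longrightarrow>
      norm_sums (\<lambda>k. nc_homog (p j) k (\<lambda>i (x :: ('n list, complex) l2). r *\<^sub>R creation i x)) (G r j)"
    by metis
  have "sot_lim (\<lambda>r. G r j) (M j) (at_left 1)" for j
    unfolding sot_lim_def
  proof (intro conjI allI Mb)
    fix x
    show "((\<lambda>r. G r j x) \<longlongrightarrow> M j x) (at_left 1)"
    proof (rule tendsto_everywhere_if_total[OF _ Mb total_ket, where C="onorm (M j)"])
      show "\<forall>\<^sub>F r in at_left 1. bounded_clinear (G r j) \<and> (\<forall>x. norm (G r j x) \<le> onorm (M j) * norm x)"
        using eventually_at_left_real[of 0 1]
        by (auto elim!: eventually_mono simp: norm_dilated_symbol_le[OF M _ _ G] G[unfolded norm_sums_def])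
      fix y :: "('n list, complex) l2" assume "y \<in> range ket"
      then obtain \<beta> where y: "y = ket \<beta>" by blast
      show "((\<lambda>r. G r j y) \<longlongrightarrow> M j y) (at_left 1)"
        unfolding y
      \<comment> \<open>Without scaling the sums already converge at a basis vector, so Abel's
        theorem identifies the radial limit. The lower end 1/2 is an arbitrary choice.\<close>
      proof (rule abel_limit[of _ _ "1/2"])
        show "(\<lambda>N. \<Sum>k<N. nc_homog (p j) k creation (ket \<beta>)) \<longlonglongrightarrow> M j (ket \<beta>)"
          by (rule sum_nc_homog_creation_ket_tendsto[OF M])
        show "(\<lambda>N. \<Sum>k<N. r ^ k *\<^sub>R nc_homog (p j) k creation (ket \<beta>)) \<longlonglongrightarrow> G r j (ket \<beta>)"
          if "1/2 < r" "r < 1" for r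
          using sum_nc_homog_tendsto[where X="\<lambda>i x. r *\<^sub>R creation i x", OF rC G[of r j]] that
          by (simp add: nc_homog_scaleR[of creation, OF C])
      qed simp_all
    qed
  qed
  then show ?thesis
    unfolding value_rad_def using G by (intro exI[of _ "1/2"] exI[of _ G]) auto
qed

section \<open>Products and substitution of formal power series\<close>

definition nc_monom :: "'n list \<Rightarrow> 'n series"
  where "nc_monom \<beta> w = (if w = \<beta> then 1 else 0)"

lemma Rep_ket_monom: "Rep_l2 (ket \<beta>) = nc_monom \<beta>"
  by (simp add: Rep_ket nc_monom_def fun_eq_iff)

lemma nc_one_eq_monom: "nc_one = nc_monom []"
  by (simp add: nc_one_def nc_monom_def fun_eq_iff)

lemma nc_var_eq_monom: "nc_var j = nc_monom [j]"
  by (simp add: nc_var_def nc_monom_def fun_eq_iff)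

lemma nc_mult_Cons: "nc_mult p q (i # w) = p [] * q (i # w) + nc_mult (\<lambda>v. p (i # v)) q w"
  unfolding nc_mult_def by (simp add: sum.atMost_Suc_shift del: sum.atMost_Suc)

lemma nc_mult_Nil: "nc_mult p q [] = p [] * q []"
  by (simp add: nc_mult_def)

lemma nc_mult_lincomb_left:
  "nc_mult (\<lambda>v. \<Sum>b\<in>B. c b * P b v) q w = (\<Sum>b\<in>B. c b * nc_mult (P b) q w)"
  unfolding nc_mult_def sum_distrib_left sum_distrib_right
  by (subst sum.swap) (simp add: mult.assoc)

lemma nc_mult_lincomb_right:
  "nc_mult p (\<lambda>v. \<Sum>b\<in>B. c b * Q b v) w = (\<Sum>b\<in>B. c b * nc_mult p (Q b) w)"
  unfolding nc_mult_def sum_distrib_left by (subst sum.swap) (simp add: mult_ac)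

lemma nc_mult_add_left: "nc_mult (\<lambda>v. p v + p' v) q w = nc_mult p q w + nc_mult p' q w"
  by (simp add: nc_mult_def distrib_right sum.distrib)

lemma nc_mult_scale_left: "nc_mult (\<lambda>v. c * p v) q w = c * nc_mult p q w"
  by (simp add: nc_mult_def sum_distrib_left mult.assoc)

text \<open>Induction on the word with \<open>p\<close> arbitrary: after removing the first letter,
  the left factor becomes a shifted product plus a scalar multiple of a shifted \<open>q\<close>,
  and bilinearity does the rest.\<close>

lemma nc_mult_assoc: "nc_mult (nc_mult p q) r = nc_mult p (nc_mult q r)"
proof
  fix w
  show "nc_mult (nc_mult p q) r w = nc_mult p (nc_mult q r) w"
  proof (induction w arbitrary: p)
    case (Cons i w)
    show ?case
      unfolding nc_mult_Cons[of "nc_mult p q"] nc_mult_Cons[of p "nc_mult q r"] nc_mult_Cons[of p q]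
        nc_mult_Cons[of q r] nc_mult_add_left nc_mult_scale_left Cons.IH nc_mult_Nil
      by (simp add: algebra_simps)
  qed (simp add: nc_mult_Nil)
qed

lemma nc_mult_one_left: "nc_mult nc_one q = q"
proof
  fix w
  have "nc_mult (\<lambda>v. nc_one (i # v)) q v = 0" for i v
    by (simp add: nc_mult_def nc_one_def)
  then show "nc_mult nc_one q w = q w"
    by (cases w) (simp_all add: nc_mult_Cons nc_mult_Nil nc_one_def)
qed

lemma nc_word_append: "nc_word f (\<alpha> @ \<beta>) = nc_mult (nc_word f \<alpha>) (nc_word f \<beta>)"
  by (induction \<alpha>) (simp_all add: nc_mult_one_left nc_mult_assoc)

lemma nc_mult_monom_append: "nc_mult p (nc_monom \<beta>) (\<alpha> @ \<beta>) = p \<alpha>"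
proof -
  have "nc_mult p (nc_monom \<beta>) (\<alpha> @ \<beta>) = (\<Sum>k\<le>length \<alpha> + length \<beta>. if k = length \<alpha> then p \<alpha> else 0)"
    unfolding nc_mult_def length_append
  proof (intro sum.cong refl)
    fix k assume "k \<in> {..length \<alpha> + length \<beta>}"
    show "p (take k (\<alpha> @ \<beta>)) * nc_monom \<beta> (drop k (\<alpha> @ \<beta>)) = (if k = length \<alpha> then p \<alpha> else 0)"
    proof (cases "k = length \<alpha>")
      case False
      then have "length (drop k (\<alpha> @ \<beta>)) \<noteq> length \<beta>"
        unfolding length_drop length_append using \<open>k \<in> _\<close> by auto
      then have "drop k (\<alpha> @ \<beta>) \<noteq> \<beta>" by metis
      then show ?thesis using False by (simp add: nc_monom_def)
    qed (simp add: nc_monom_def)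
  qed
  then show ?thesis by simp
qed

lemma nc_mult_monom_eq_0: "w \<notin> range (\<lambda>\<alpha>. \<alpha> @ \<beta>) \<Longrightarrow> nc_mult p (nc_monom \<beta>) w = 0"
  unfolding nc_mult_def nc_monom_def
  by (intro sum.neutral) (auto, metis append_take_drop_id range_eqI)

lemma nc_mult_var_monom: "nc_mult (nc_var j) (nc_monom \<beta>) = nc_monom (j # \<beta>)"
proof
  fix w show "nc_mult (nc_var j) (nc_monom \<beta>) w = nc_monom (j # \<beta>) w"
  proof (cases "w \<in> range (\<lambda>\<alpha>. \<alpha> @ \<beta>)")
    case True
    then obtain \<alpha> where "w = \<alpha> @ \<beta>" by blast
    then show ?thesis
      by (simp add: nc_mult_monom_append) (auto simp: nc_var_def nc_monom_def Cons_eq_append_conv append_eq_Cons_conv)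
  next
    case False
    moreover from False have "w \<noteq> [j] @ \<beta>" by blast
    ultimately show ?thesis by (simp add: nc_mult_monom_eq_0) (simp add: nc_monom_def)
  qed
qed

lemma nc_word_var: "nc_word nc_var \<alpha> = nc_monom \<alpha>"
  by (induction \<alpha>) (simp_all add: nc_one_eq_monom nc_mult_var_monom)

text \<open>The condition under which each coefficient of \<open>nc_subst p f\<close> is a genuine
  finite sum. It holds for polynomial \<open>p\<close>, and for every \<open>p\<close> if
  \<open>f\<close> has no constant terms.\<close>

definition locally_finite :: "'n series \<Rightarrow> ('n \<Rightarrow> 'n series) \<Rightarrow> bool"
  where "locally_finite p f \<longleftrightarrow> (\<forall>v. finite {\<alpha>. p \<alpha> * nc_word f \<alpha> v \<noteq> 0})"

lemma infsum_eq_sum: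
  "finite S \<Longrightarrow> (\<And>x. x \<notin> S \<Longrightarrow> h x = 0) \<Longrightarrow> infsum h UNIV = (\<Sum>x\<in>S. h x)"
  using infsum_cong_neutral[of S UNIV h h] by simp

lemma nc_subst_eq_sum:
  "finite S \<Longrightarrow> (\<And>\<alpha>. \<alpha> \<notin> S \<Longrightarrow> p \<alpha> * nc_word f \<alpha> w = 0) \<Longrightarrow> nc_subst p f w = (\<Sum>\<alpha>\<in>S. p \<alpha> * nc_word f \<alpha> w)"
  unfolding nc_subst_def by (rule infsum_eq_sum)

lemma nc_subst_monom: "nc_subst (nc_monom \<beta>) f = nc_word f \<beta>"
  by (rule ext, subst nc_subst_eq_sum[of "{\<beta>}"]) (auto simp: nc_monom_def)

lemma nc_subst_lincomb:
  assumes B: "finite B" and P: "\<And>b. b \<in> B \<Longrightarrow> locally_finite (P b) f"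
  shows "nc_subst (\<lambda>v. \<Sum>b\<in>B. c b * P b v) f w = (\<Sum>b\<in>B. c b * nc_subst (P b) f w)"
proof -
  define S where "S = (\<Union>b\<in>B. {\<alpha>. P b \<alpha> * nc_word f \<alpha> w \<noteq> 0})"
  have S: "finite S" unfolding S_def using B P by (auto simp: locally_finite_def)
  have z: "P b \<alpha> * nc_word f \<alpha> w = 0" if "b \<in> B" "\<alpha> \<notin> S" for b \<alpha> using that by (auto simp: S_def)
  have "nc_subst (\<lambda>v. \<Sum>b\<in>B. c b * P b v) f w = (\<Sum>\<alpha>\<in>S. (\<Sum>b\<in>B. c b * P b \<alpha>) * nc_word f \<alpha> w)"
  proof (rule nc_subst_eq_sum[OF S])
    fix \<alpha> assume "\<alpha> \<notin> S"
    then show "(\<Sum>b\<in>B. c b * P b \<alpha>) * nc_word f \<alpha> w = 0"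
      unfolding sum_distrib_right using z[of _ \<alpha>] by (intro sum.neutral) (auto simp: mult.assoc)
  qed
  also have "\<dots> = (\<Sum>b\<in>B. c b * (\<Sum>\<alpha>\<in>S. P b \<alpha> * nc_word f \<alpha> w))"
    unfolding sum_distrib_left sum_distrib_right by (subst sum.swap) (simp add: mult.assoc)
  also have "\<dots> = (\<Sum>b\<in>B. c b * nc_subst (P b) f w)"
    by (intro sum.cong refl) (simp add: nc_subst_eq_sum[OF S z])
  finally show ?thesis .
qed

lemma nc_subst_diff:
  assumes "locally_finite p f" "locally_finite q f"
  shows "nc_subst (\<lambda>v. p v - q v) f w = nc_subst p f w - nc_subst q f w"
  using nc_subst_lincomb[of "{True, False}" "\<lambda>b. if b then p else q" f "\<lambda>b. if b then 1 else - 1" w] assms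
  by simp

text \<open>Multiplicativity against a monomial on the right is enough for comparing multiplication
  operators on basis vectors, and it avoids interchanging two infinite sums: \<alpha> \<mapsto>
  \<alpha>\<beta> reindexes the support.\<close>

lemma nc_subst_mult_monom:
  assumes p: "locally_finite p f"
  shows "nc_subst (nc_mult p (nc_monom \<beta>)) f = nc_mult (nc_subst p f) (nc_word f \<beta>)"
proof
  fix w
  define S where "S = (\<Union>k\<le>length w. {\<alpha>. p \<alpha> * nc_word f \<alpha> (take k w) \<noteq> 0})"
  have S: "finite S" unfolding S_def using p by (auto simp: locally_finite_def)
  have z: "p \<alpha> * nc_word f \<alpha> (take k w) = 0" if "k \<le> length w" "\<alpha> \<notin> S" for \<alpha> k
    using that by (auto simp: S_def)
  have e: "p \<alpha> * nc_word f (\<alpha> @ \<beta>) w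
      = (\<Sum>k\<le>length w. p \<alpha> * nc_word f \<alpha> (take k w) * nc_word f \<beta> (drop k w))" for \<alpha>
    unfolding nc_word_append nc_mult_def by (simp add: sum_distrib_left mult.assoc)
  have "nc_subst (nc_mult p (nc_monom \<beta>)) f w
      = (\<Sum>\<gamma>\<in>(\<lambda>\<alpha>. \<alpha> @ \<beta>) ` S. nc_mult p (nc_monom \<beta>) \<gamma> * nc_word f \<gamma> w)"
  proof (rule nc_subst_eq_sum)
    fix \<gamma> assume \<gamma>: "\<gamma> \<notin> (\<lambda>\<alpha>. \<alpha> @ \<beta>) ` S"
    show "nc_mult p (nc_monom \<beta>) \<gamma> * nc_word f \<gamma> w = 0"
    proof (cases "\<gamma> \<in> range (\<lambda>\<alpha>. \<alpha> @ \<beta>)")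
      case True
      then obtain \<alpha> where \<alpha>: "\<gamma> = \<alpha> @ \<beta>" "\<alpha> \<notin> S" using \<gamma> by blast
      show ?thesis
        unfolding \<alpha>(1) nc_mult_monom_append e by (intro sum.neutral) (simp add: z \<alpha>(2))
    qed (simp add: nc_mult_monom_eq_0)
  qed (simp add: S)
  also have "\<dots> = (\<Sum>\<alpha>\<in>S. p \<alpha> * nc_word f (\<alpha> @ \<beta>) w)"
    by (subst sum.reindex) (auto simp: inj_on_def nc_mult_monom_append)
  also have "\<dots> = (\<Sum>k\<le>length w. (\<Sum>\<alpha>\<in>S. p \<alpha> * nc_word f \<alpha> (take k w)) * nc_word f \<beta> (drop k w))"
    unfolding e sum_distrib_right by (rule sum.swap)
  also have "\<dots> = nc_mult (nc_subst p f) (nc_word f \<beta>) w"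
    unfolding nc_mult_def by (intro sum.cong refl) (simp add: nc_subst_eq_sum[OF S z])
  finally show "nc_subst (nc_mult p (nc_monom \<beta>)) f w = nc_mult (nc_subst p f) (nc_word f \<beta>) w" .
qed

section \<open>Substitution for polynomials\<close>

lemma locally_finite_polynomial: "nc_polynomial p \<Longrightarrow> locally_finite p f"
  unfolding locally_finite_def nc_polynomial_def
  by (auto elim: finite_subset[rotated])

lemma nc_polynomial_mult:
  assumes "nc_polynomial p" "nc_polynomial q"
  shows "nc_polynomial (nc_mult p q)"
  unfolding nc_polynomial_def
proof (rule finite_subset)
  show "finite ((\<lambda>(u, v). u @ v) ` ({u. p u \<noteq> 0} \<times> {v. q v \<noteq> 0}))"
    using assms by (simp add: nc_polynomial_def)
  show "{w. nc_mult p q w \<noteq> 0} \<subseteq> (\<lambda>(u, v). u @ v) ` ({u. p u \<noteq> 0} \<times> {v. q v \<noteq> 0})"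
  proof
    fix w assume "w \<in> {w. nc_mult p q w \<noteq> 0}"
    then obtain k where "p (take k w) * q (drop k w) \<noteq> 0"
      unfolding nc_mult_def mem_Collect_eq using sum.not_neutral_contains_not_neutral by blast
    then show "w \<in> (\<lambda>(u, v). u @ v) ` ({u. p u \<noteq> 0} \<times> {v. q v \<noteq> 0})"
      by (intro image_eqI[of _ _ "(take k w, drop k w)"]) auto
  qed
qed

lemma nc_polynomial_monom: "nc_polynomial (nc_monom \<beta>)"
  by (simp add: nc_polynomial_def nc_monom_def)

lemma nc_polynomial_word: "(\<And>i. nc_polynomial (f i)) \<Longrightarrow> nc_polynomial (nc_word f \<alpha>)"
  by (induction \<alpha>) (simp_all add: nc_one_eq_monom nc_polynomial_monom nc_polynomial_mult)

lemma nc_polynomial_expand: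
  assumes "nc_polynomial p"
  shows "p = (\<lambda>w. \<Sum>\<beta> | p \<beta> \<noteq> 0. p \<beta> * nc_monom \<beta> w)"
proof
  fix w
  have "(\<Sum>\<beta> | p \<beta> \<noteq> 0. p \<beta> * nc_monom \<beta> w) = (\<Sum>\<beta> | p \<beta> \<noteq> 0. if w = \<beta> then p \<beta> else 0)"
    by (intro sum.cong) (auto simp: nc_monom_def)
  then show "p w = (\<Sum>\<beta> | p \<beta> \<noteq> 0. p \<beta> * nc_monom \<beta> w)"
    using assms by (simp add: nc_polynomial_def)
qed

lemma nc_subst_polynomial:
  assumes "nc_polynomial p"
  shows "nc_subst p f = (\<lambda>w. \<Sum>\<beta> | p \<beta> \<noteq> 0. p \<beta> * nc_word f \<beta> w)"
  by (rule ext, rule nc_subst_eq_sum) (use assms in \<open>auto simp: nc_polynomial_def\<close>)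

lemma nc_subst_mult:
  assumes p: "nc_polynomial p" and q: "nc_polynomial q"
  shows "nc_subst (nc_mult p q) g = nc_mult (nc_subst p g) (nc_subst q g)"
proof
  fix w
  let ?B = "{\<beta>. q \<beta> \<noteq> 0}"
  have "nc_mult p q = nc_mult p (\<lambda>w. \<Sum>\<beta>\<in>?B. q \<beta> * nc_monom \<beta> w)"
    using nc_polynomial_expand[OF q] by simp
  also have "\<dots> = (\<lambda>w. \<Sum>\<beta>\<in>?B. q \<beta> * nc_mult p (nc_monom \<beta>) w)"
    by (rule ext) (rule nc_mult_lincomb_right)
  finally have "nc_subst (nc_mult p q) g w = (\<Sum>\<beta>\<in>?B. q \<beta> * nc_subst (nc_mult p (nc_monom \<beta>)) g w)"
    using q by (simp add: nc_subst_lincomb locally_finite_polynomial nc_polynomial_mult p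
        nc_polynomial_monom nc_polynomial_def[of q])
  also have "\<dots> = (\<Sum>\<beta>\<in>?B. q \<beta> * nc_mult (nc_subst p g) (nc_word g \<beta>) w)"
    by (simp add: nc_subst_mult_monom locally_finite_polynomial p)
  also have "\<dots> = nc_mult (nc_subst p g) (nc_subst q g) w"
    unfolding nc_subst_polynomial[OF q] by (rule nc_mult_lincomb_right[symmetric])
  finally show "nc_subst (nc_mult p q) g w = nc_mult (nc_subst p g) (nc_subst q g) w" .
qed

lemma nc_subst_word:
  assumes "\<And>i. nc_polynomial (f i)"
  shows "nc_subst (nc_word f \<alpha>) g = nc_word (\<lambda>i. nc_subst (f i) g) \<alpha>"
proof (induction \<alpha>)
  case Nil
  show ?case using nc_subst_monom[of "[]" g] by (simp add: nc_one_eq_monom)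
next
  case (Cons i \<alpha>)
  then show ?case by (simp add: nc_subst_mult assms nc_polynomial_word)
qed

text \<open>Substituting f into polynomials is undone by substituting g, hence injective. This is
  the use made of the fact that the f_\<alpha> are linearly independent.\<close>

lemma nc_subst_left_inverse:
  assumes a: "nc_polynomial a" and f: "\<And>i. nc_polynomial (f i)" and fg: "\<And>i. nc_subst (f i) g = nc_var i"
  shows "nc_subst (nc_subst a f) g = a"
proof
  fix w
  have "nc_subst (nc_subst a f) g w = (\<Sum>\<beta> | a \<beta> \<noteq> 0. a \<beta> * nc_subst (nc_word f \<beta>) g w)"
    unfolding nc_subst_polynomial[OF a] using a
    by (intro nc_subst_lincomb locally_finite_polynomial nc_polynomial_word f) (simp add: nc_polynomial_def)
  also have "\<dots> = a w"
    by (subst nc_polynomial_expand[OF a]) (simp add: nc_subst_word f fg nc_word_var)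
  finally show "nc_subst (nc_subst a f) g w = a w" .
qed

section \<open>Substitution of series without constant term\<close>

lemma nc_word_eq_0_if_short:
  assumes f0: "\<And>i. f i [] = 0"
  shows "length w < length \<alpha> \<Longrightarrow> nc_word f \<alpha> w = 0"
proof (induction \<alpha> arbitrary: w)
  case (Cons i \<alpha>)
  have "f i (take k w) * nc_word f \<alpha> (drop k w) = 0" if "k \<le> length w" for k
    using Cons that by (cases k) (simp_all add: f0)
  then show ?case unfolding nc_word.simps nc_mult_def by (intro sum.neutral) simp
qed simp

lemma locally_finite_if_constant_free:
  fixes f :: "'n::finite \<Rightarrow> 'n series"
  assumes "\<And>i. f i [] = 0"
  shows "locally_finite p f"
  unfolding locally_finite_def
proof
  fix v
  have "{\<alpha>. p \<alpha> * nc_word f \<alpha> v \<noteq> 0} \<subseteq> {\<alpha>. length \<alpha> < Suc (length v)}"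
    using nc_word_eq_0_if_short[of f v, OF assms] by (auto simp: not_less_eq[symmetric])
  then show "finite {\<alpha>. p \<alpha> * nc_word f \<alpha> v \<noteq> 0}"
    by (rule finite_subset) (rule finite_words_less)
qed

text \<open>In its lowest degree f_\<alpha> is the product of the linear parts: any cut of the word
  other than after one letter meets a constant term of f_i or leaves too short a tail.\<close>

lemma nc_word_same_length:
  assumes f0: "\<And>i. f i [] = 0" and "length v = length \<alpha>"
  shows "nc_word f (i # \<alpha>) (j # v) = f i [j] * nc_word f \<alpha> v"
proof -
  have "nc_word f (i # \<alpha>) (j # v) = (\<Sum>k\<le>length (j # v). if k = 1 then f i [j] * nc_word f \<alpha> v else 0)"
    unfolding nc_word.simps nc_mult_def
  proof (intro sum.cong refl)
    fix k assume k: "k \<in> {..length (j # v)}"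
    show "f i (take k (j # v)) * nc_word f \<alpha> (drop k (j # v)) = (if k = 1 then f i [j] * nc_word f \<alpha> v else 0)"
    proof (cases k)
      case (Suc m)
      then show ?thesis
        using assms k nc_word_eq_0_if_short[of f "drop m v" \<alpha>, OF f0] by (cases m) auto
    qed (simp add: f0)
  qed
  then show ?thesis by (simp del: sum.atMost_Suc nc_word.simps)
qed

text \<open>In degree \<open>k\<close> the substitution acts as the \<open>k\<close>-th tensor power of the Jacobian.\<close>

lemma homogeneous_subst_injective:
  fixes f :: "'n::finite \<Rightarrow> 'n series"
  assumes f0: "\<And>i. f i [] = 0" and det: "det (\<chi> i j. f i [j]) \<noteq> 0"
  shows "(\<And>w. length w = k \<Longrightarrow> (\<Sum>\<alpha> | length \<alpha> = k. a \<alpha> * nc_word f \<alpha> w) = 0) \<Longrightarrow> length \<alpha> = k \<Longrightarrow> a \<alpha> = 0"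
proof (induction k arbitrary: a \<alpha>)
  case 0
  show ?case using "0.prems"(1)[of "[]"] "0.prems"(2) by (simp add: nc_one_def)
next
  case (Suc k)
  define J :: "complex^'n^'n" where "J = (\<chi> i j. f i [j])"
  obtain J' where J': "J ** J' = mat 1"
    using det invertible_det_nz[of J] unfolding J_def[symmetric] invertible_def by blast
  obtain i \<gamma> where \<alpha>: "\<alpha> = i # \<gamma>" "length \<gamma> = k" using Suc.prems(2) by (cases \<alpha>) auto
  \<comment> \<open>Fixing the first letter j of the test word contracts the first index of
    \<open>a\<close> with column j of the Jacobian. The result satisfies the hypothesis one degree
    lower.\<close>
  have "(\<Sum>i\<in>UNIV. a (i # \<beta>) * f i [j]) = 0" if "length \<beta> = k" for j \<beta>
  proof (rule Suc.IH[OF _ that])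
    fix v :: "'n list" assume v: "length v = k"
    have "(\<Sum>\<alpha> | length \<alpha> = k. (\<Sum>i\<in>UNIV. a (i # \<alpha>) * f i [j]) * nc_word f \<alpha> v)
        = (\<Sum>\<alpha> | length \<alpha> = k. \<Sum>i\<in>UNIV. a (i # \<alpha>) * nc_word f (i # \<alpha>) (j # v))"
      using v by (intro sum.cong refl)
        (simp add: nc_word_same_length[of f, OF f0] sum_distrib_right mult.assoc del: nc_word.simps)
    also have "\<dots> = (\<Sum>\<alpha> | length \<alpha> = Suc k. a \<alpha> * nc_word f \<alpha> (j # v))"
      unfolding sum_words_Suc_Cons by (rule sum.swap)
    also have "\<dots> = 0" using v by (intro Suc.prems) simp
    finally show "(\<Sum>\<alpha> | length \<alpha> = k. (\<Sum>i\<in>UNIV. a (i # \<alpha>) * f i [j]) * nc_word f \<alpha> v) = 0" .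
  qed
  then have "(\<chi> i. a (i # \<gamma>)) v* J = 0"
    using \<alpha>(2) by (simp add: vec_eq_iff vector_matrix_mult_def J_def mult.commute)
  then have "(\<chi> i. a (i # \<gamma>)) v* (J ** J') = 0"
    by (simp add: vector_matrix_mul_assoc[symmetric])
  then show ?case by (simp add: J' vec_eq_iff \<alpha>)
qed

text \<open>The lowest nonzero degree of the difference would survive substitution: coefficients of
  lower degree vanish by induction, and f_\<alpha> of higher degree does not reach words of the
  current length.\<close>

lemma nc_subst_injective:
  fixes f :: "'n::finite \<Rightarrow> 'n series"
  assumes f0: "\<And>i. f i [] = 0" and det: "det (\<chi> i j. f i [j]) \<noteq> 0"
    and eq: "nc_subst a f = nc_subst b f"
  shows "a = b"
proof -
  define c where "c w = a w - b w" for w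
  have lf: "locally_finite p f" for p by (rule locally_finite_if_constant_free[of f, OF f0])
  have c0: "nc_subst c f w = 0" for w
    unfolding c_def[abs_def] nc_subst_diff[OF lf lf] eq by simp
  have "c \<alpha> = 0" for \<alpha>
  proof (induction "length \<alpha>" arbitrary: \<alpha> rule: less_induct)
    case less
    show ?case
    proof (rule homogeneous_subst_injective[of f, OF f0 det _ refl])
      fix w :: "'n list" assume w: "length w = length \<alpha>"
      have "nc_subst c f w = (\<Sum>\<alpha>' | length \<alpha>' = length \<alpha>. c \<alpha>' * nc_word f \<alpha>' w)"
      proof (rule nc_subst_eq_sum[OF finite_words_eq])
        fix \<alpha>' :: "'n list"
        assume "\<alpha>' \<notin> {\<alpha>'. length \<alpha>' = length \<alpha>}"
        then have "length \<alpha>' < length \<alpha> \<or> length w < length \<alpha>'" using w by auto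
        then show "c \<alpha>' * nc_word f \<alpha>' w = 0"
          using less nc_word_eq_0_if_short[of f w \<alpha>', OF f0] by auto
      qed
      then show "(\<Sum>\<alpha>' | length \<alpha>' = length \<alpha>. c \<alpha>' * nc_word f \<alpha>' w) = 0" by (simp add: c0)
    qed
  qed
  then show ?thesis by (simp add: c_def fun_eq_iff)
qed

section \<open>The three cases of the model property\<close>

lemma nc_mult_one_right: "nc_mult p nc_one = p"
  using nc_mult_monom_append[of p "[]"] by (simp add: nc_one_eq_monom fun_eq_iff)

text \<open>After substitution of f both sides become q f_\<beta>, and substitution is
  injective.\<close>

lemma model_S_left_mult_op:
  fixes f :: "'n::finite \<Rightarrow> 'n series"
  assumes f0: "\<And>i. f i [] = 0" and det: "det (\<chi> i j. f i [j]) \<noteq> 0"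
    and L: "series_mult_op f q L" and p: "nc_subst p f = q"
  shows "left_mult_op p L"
proof (rule left_mult_opI)
  show "bounded_clinear L" using L by (simp add: series_mult_op_def)
  fix \<beta>
  have "locally_finite p f" by (rule locally_finite_if_constant_free[of f, OF f0])
  then have "nc_subst (Rep_l2 (L (ket \<beta>))) f = nc_subst (nc_mult p (Rep_l2 (ket \<beta>))) f"
    using L by (simp add: series_mult_op_def Rep_ket_monom nc_subst_monom nc_subst_mult_monom p)
  then show "Rep_l2 (L (ket \<beta>)) = nc_mult p (Rep_l2 (ket \<beta>))"
    by (rule nc_subst_injective[of f, OF f0 det])
qed

lemma op_word_left_mult:
  assumes "\<And>i. left_mult_op (g i) (X i)"
  shows "Rep_l2 (op_word X \<alpha> x) = nc_mult (nc_word g \<alpha>) (Rep_l2 x)"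
  using assms
  by (induction \<alpha>) (simp_all add: nc_mult_one_left nc_mult_assoc left_mult_op_def)

lemma sum_nc_homog_eq: "(\<Sum>k<N. nc_homog c k X x) = (\<Sum>\<alpha> | length \<alpha> < N. c \<alpha> *\<^sub>C op_word X \<alpha> x)"
  by (induction N) (simp_all add: sum_words_less_Suc nc_homog_def)

lemma sum_nc_homog_polynomial_tendsto:
  fixes c :: "'n::finite series"
  assumes "nc_polynomial c"
  shows "(\<lambda>N. \<Sum>k<N. nc_homog c k X x) \<longlonglongrightarrow> (\<Sum>\<alpha> | c \<alpha> \<noteq> 0. c \<alpha> *\<^sub>C op_word X \<alpha> x)"
proof (rule tendsto_eventually)
  have fin: "finite {\<alpha>. c \<alpha> \<noteq> 0}" using assms by (simp add: nc_polynomial_def)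
  have "(\<Sum>k<N. nc_homog c k X x) = (\<Sum>\<alpha> | c \<alpha> \<noteq> 0. c \<alpha> *\<^sub>C op_word X \<alpha> x)"
    if "N > Max (insert 0 (length ` {\<alpha>. c \<alpha> \<noteq> 0}))" for N
    unfolding sum_nc_homog_eq
    using that fin by (intro sum.mono_neutral_right finite_words_less) auto
  then show "\<forall>\<^sub>F N in sequentially. (\<Sum>k<N. nc_homog c k X x) = (\<Sum>\<alpha> | c \<alpha> \<noteq> 0. c \<alpha> *\<^sub>C op_word X \<alpha> x)"
    by (rule eventually_mono[OF eventually_gt_at_top])
qed

text \<open>Since f_j is a polynomial, f_j(M_Z) is a finite combination of multiplications by the
  words in g, hence multiplication by the composition of f_j with g, which is Z_j.\<close>

lemma model_A_facts:
  fixes f :: "'n::finite \<Rightarrow> 'n series"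
  assumes "model_A f g MZ"
  shows "left_mult_op (g i) (MZ i)" and "value_SOT f MZ creation"
proof -
  have f: "\<And>i. nc_polynomial (f i)" and g: "\<And>i. nc_polynomial (g i)"
    and fg: "\<And>i. nc_subst (f i) g = nc_var i" and gf: "\<And>i. nc_subst (g i) f = nc_var i"
    and MZ: "\<And>i. bounded_clinear (MZ i)"
    and poly: "\<And>i x. nc_polynomial (Rep_l2 x) \<Longrightarrow> nc_polynomial (Rep_l2 (MZ i x)) \<and>
        nc_subst (Rep_l2 (MZ i x)) f = nc_mult (nc_var i) (nc_subst (Rep_l2 x) f)"
    using assms by (auto simp: model_A_def)
  show left: "left_mult_op (g i) (MZ i)" for i
  proof (rule left_mult_opI[OF MZ])
    fix \<beta>
    have "nc_subst (Rep_l2 (MZ i (ket \<beta>))) f = nc_subst (nc_mult (g i) (nc_monom \<beta>)) f"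
      using poly[of "ket \<beta>" i]
      by (simp add: Rep_ket_monom nc_polynomial_monom nc_subst_monom nc_subst_mult_monom
          locally_finite_polynomial g gf)
    moreover have "nc_polynomial (Rep_l2 (MZ i (ket \<beta>)))"
      using poly[of "ket \<beta>" i] by (simp add: Rep_ket_monom nc_polynomial_monom)
    moreover have "nc_polynomial (nc_mult (g i) (nc_monom \<beta>))"
      by (simp add: nc_polynomial_mult g nc_polynomial_monom)
    ultimately show "Rep_l2 (MZ i (ket \<beta>)) = nc_mult (g i) (Rep_l2 (ket \<beta>))"
      using nc_subst_left_inverse[of _ f g, OF _ f fg] by (metis Rep_ket_monom)
  qed
  have "(\<Sum>\<alpha> | f j \<alpha> \<noteq> 0. f j \<alpha> *\<^sub>C op_word MZ \<alpha> x) = creation j x" for j x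
  proof (rule l2_eqI)
    fix w
    have "Rep_l2 (\<Sum>\<alpha> | f j \<alpha> \<noteq> 0. f j \<alpha> *\<^sub>C op_word MZ \<alpha> x) w
        = (\<Sum>\<alpha> | f j \<alpha> \<noteq> 0. f j \<alpha> * nc_mult (nc_word g \<alpha>) (Rep_l2 x) w)"
      by (simp add: Rep_l2_sum Rep_scaleC_l2 op_word_left_mult[of g, OF left] scaleC_complex_def)
    also have "\<dots> = nc_mult (nc_subst (f j) g) (Rep_l2 x) w"
      unfolding nc_subst_polynomial[OF f] by (rule nc_mult_lincomb_left[symmetric])
    also have "\<dots> = Rep_l2 (creation j x) w"
      using left_mult_op_creation[of j] by (simp add: fg left_mult_op_def)
    finally show "Rep_l2 (\<Sum>\<alpha> | f j \<alpha> \<noteq> 0. f j \<alpha> *\<^sub>C op_word MZ \<alpha> x) w = Rep_l2 (creation j x) w" .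
  qed
  then show "value_SOT f MZ creation"
    unfolding value_SOT_def sot_sums_def sot_lim_def
    using sum_nc_homog_polynomial_tendsto[OF f, of _ MZ] by (simp add: bounded_clinear_creation)
qed

section \<open>Evaluation on operator balls, for the free holomorphic case\<close>

lemma norm_sums_unique:
  assumes "\<And>i. bounded_clinear (X i)" "norm_sums (\<lambda>k. nc_homog c k X) S" "norm_sums (\<lambda>k. nc_homog c k X) S'"
  shows "S = S'"
  using sum_nc_homog_tendsto[of X, OF assms(1,2)] sum_nc_homog_tendsto[of X, OF assms(1,3)]
  by (intro ext) (rule LIMSEQ_unique)

lemma row_norm_nonneg:
  fixes X :: "'n::finite \<Rightarrow> 'h::chilbert_space \<Rightarrow> 'h"
  assumes "\<And>i. bounded_clinear (X i)"
  shows "0 \<le> row_norm X"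
proof -
  have "bounded_clinear (\<lambda>x. \<Sum>i\<in>UNIV. X i (cadj (X i) x))"
    by (intro bounded_clinear_sum_op bounded_clinear_compose[OF assms] bounded_clinear_cadj assms)
  then show ?thesis by (simp add: row_norm_def onorm_pos_le bounded_clinear_def)
qed

lemma hol_eval_tendsto:
  assumes Y: "Y \<in> op_ball 1" and c: "square_summable c"
  shows "(\<lambda>N. \<Sum>k<N. nc_homog c k Y x) \<longlonglongrightarrow> hol_eval c Y x"
proof -
  have Yb: "bounded_clinear (Y i)" for i using Y by (simp add: op_ball_def)
  have "row_norm Y < 1" using Y by (simp add: op_ball_def)
  then obtain S where S: "norm_sums (\<lambda>k. nc_homog c k Y) S"
    using norm_sums_exists[of Y "row_norm Y" c, OF Yb row_bound_if_row_norm_le[of Y, OF Yb order_refl]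
        row_norm_nonneg[of Y, OF Yb] _ c] by blast
  then have "hol_eval c Y = S"
    unfolding hol_eval_def using norm_sums_unique[of Y, OF Yb] by blast
  then show ?thesis using sum_nc_homog_tendsto[of Y, OF Yb S] by simp
qed

lemma hol_eval_monom:
  assumes Y: "Y \<in> op_ball 1"
  shows "hol_eval (nc_monom \<beta>) Y = op_word Y \<beta>"
proof
  fix x
  have "square_summable (nc_monom \<beta>)" using square_summable_Rep_l2[of "ket \<beta>"] by (simp add: Rep_ket_monom)
  moreover have "{\<alpha>. nc_monom \<beta> \<alpha> \<noteq> 0} = {\<beta>}" by (auto simp: nc_monom_def)
  ultimately
  show "hol_eval (nc_monom \<beta>) Y x = op_word Y \<beta> x"
    using sum_nc_homog_polynomial_tendsto[OF nc_polynomial_monom, of \<beta> Y x]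
      hol_eval_tendsto[OF Y, of "nc_monom \<beta>" x]
    by (intro LIMSEQ_unique[where X="\<lambda>N. \<Sum>k<N. nc_homog (nc_monom \<beta>) k Y x"]) (simp_all add: nc_monom_def)
qed

lemma square_summable_mult_monom:
  assumes "square_summable p"
  shows "square_summable (nc_mult p (nc_monom \<beta>))"
proof -
  have "(\<lambda>w. (norm (nc_mult p (nc_monom \<beta>) w))\<^sup>2) summable_on range (\<lambda>\<alpha>. \<alpha> @ \<beta>)"
    using assms by (subst summable_on_reindex)
      (auto simp: inj_on_def o_def nc_mult_monom_append square_summable_def)
  then show ?thesis
    unfolding square_summable_def
    by (rule summable_on_cong_neutral[THEN iffD1, rotated -1]) (auto simp: nc_mult_monom_eq_0)
qed

text \<open>The terms of p Z_\<beta> sit on the words \<alpha>\<beta>, so its partial sums are those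
  of p at the vector Y_\<beta> x, with the index shifted by |\<beta>|.\<close>

lemma hol_eval_mult_monom:
  assumes Y: "Y \<in> op_ball 1" and p: "square_summable p"
  shows "hol_eval (nc_mult p (nc_monom \<beta>)) Y = hol_eval p Y \<circ> op_word Y \<beta>"
proof
  fix x
  let ?q = "nc_mult p (nc_monom \<beta>)"
  have "(\<Sum>k<N + length \<beta>. nc_homog ?q k Y x) = (\<Sum>k<N. nc_homog p k Y (op_word Y \<beta> x))" for N
  proof -
    have "(\<Sum>\<alpha> | length \<alpha> < N + length \<beta>. ?q \<alpha> *\<^sub>C op_word Y \<alpha> x)
        = (\<Sum>\<gamma>\<in>(\<lambda>\<alpha>. \<alpha> @ \<beta>) ` {\<alpha>. length \<alpha> < N}. ?q \<gamma> *\<^sub>C op_word Y \<gamma> x)"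
    proof (rule sum.mono_neutral_right[OF finite_words_less])
      show "\<forall>\<gamma>\<in>{\<alpha>. length \<alpha> < N + length \<beta>} - (\<lambda>\<alpha>. \<alpha> @ \<beta>) ` {\<alpha>. length \<alpha> < N}. ?q \<gamma> *\<^sub>C op_word Y \<gamma> x = 0"
      proof
        fix \<gamma> assume "\<gamma> \<in> {\<alpha>. length \<alpha> < N + length \<beta>} - (\<lambda>\<alpha>. \<alpha> @ \<beta>) ` {\<alpha>. length \<alpha> < N}"
        then have "\<gamma> \<notin> range (\<lambda>\<alpha>. \<alpha> @ \<beta>)" by auto
        then show "?q \<gamma> *\<^sub>C op_word Y \<gamma> x = 0" by (simp add: nc_mult_monom_eq_0)
      qed
    qed auto
    also have "\<dots> = (\<Sum>\<alpha> | length \<alpha> < N. p \<alpha> *\<^sub>C op_word Y \<alpha> (op_word Y \<beta> x))"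
      by (subst sum.reindex) (auto simp: inj_on_def nc_mult_monom_append op_word_append)
    finally show ?thesis unfolding sum_nc_homog_eq .
  qed
  moreover have "(\<lambda>N. \<Sum>k<N + length \<beta>. nc_homog ?q k Y x) \<longlonglongrightarrow> hol_eval ?q Y x"
    by (rule LIMSEQ_ignore_initial_segment[OF hol_eval_tendsto[OF Y square_summable_mult_monom[OF p]]])
  ultimately show "hol_eval ?q Y x = (hol_eval p Y \<circ> op_word Y \<beta>) x"
    using hol_eval_tendsto[OF Y p, of "op_word Y \<beta> x"] LIMSEQ_unique by auto
qed

text \<open>The coefficient blocks are bounded, so a geometric series dominates. This makes
  square-summable series admissible in the nondegeneracy hypothesis on f.\<close>

lemma nc_radius_ge_one:
  assumes c: "square_summable c"
  shows "1 \<le> nc_radius c"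
  unfolding nc_radius_def
proof (rule conv_radius_geI_ex')
  define B where "B = sqrt (infsum (\<lambda>\<alpha>. (norm (c \<alpha>))\<^sup>2) UNIV)"
  fix r :: real assume r: "0 < r" "ereal r < 1"
  have le: "sqrt (\<Sum>\<alpha> | length \<alpha> = k. (norm (c \<alpha>))\<^sup>2) \<le> B" for k
    unfolding B_def using c
    by (intro real_sqrt_le_mono finite_sum_le_infsum finite_words_eq) (auto simp: square_summable_def)
  have "summable (\<lambda>k. B * r ^ k)" using r by (intro summable_mult summable_geometric) simp
  then show "summable (\<lambda>k. sqrt (\<Sum>\<alpha> | length \<alpha> = k. (norm (c \<alpha>))\<^sup>2) * of_real r ^ k)"
    by (rule summable_comparison_test'[where N=0])
      (use le r in \<open>auto simp: abs_mult sum_nonneg intro!: mult_right_mono\<close>)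
qed

lemma nc_homog_diff: "nc_homog (\<lambda>w. c w - d w) k X x = nc_homog c k X x - nc_homog d k X x"
  by (simp add: nc_homog_def sum_subtractf scaleC_diff_left)

text \<open>The two candidate coefficient families have the same composition with f on the ball.
  Their difference is square-summable, so nondegeneracy forces it to vanish.\<close>

lemma model_F_left_mult_op:
  fixes f :: "'n::finite \<Rightarrow> 'n series"
  assumes ball: "\<And>X. X \<in> op_ball \<gamma> \<Longrightarrow> hol_tuple f X \<in> op_ball 1"
    and nonzero: "\<And>G. nc_radius G \<ge> 1 \<Longrightarrow> G \<noteq> (\<lambda>_. 0) \<Longrightarrow>
      \<exists>X\<in>op_ball \<gamma>. hol_eval G (hol_tuple f X) \<noteq> (\<lambda>_. 0)"
    and L: "fun_mult_op \<gamma> f \<phi> L" and p: "square_summable p"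
    and \<phi>: "\<And>X. X \<in> op_ball \<gamma> \<Longrightarrow> hol_eval p (hol_tuple f X) = \<phi> X"
  shows "left_mult_op p L"
proof (rule left_mult_opI)
  show "bounded_clinear L" using L by (simp add: fun_mult_op_def)
  fix \<beta>
  define a where "a = Rep_l2 (L (ket \<beta>))"
  define b where "b = nc_mult p (nc_monom \<beta>)"
  have a: "square_summable a" unfolding a_def by (rule square_summable_Rep_l2)
  have b: "square_summable b" unfolding b_def by (rule square_summable_mult_monom[OF p])
  have "(\<lambda>w. (norm (a w + (-1) *\<^sub>R b w))\<^sup>2) summable_on UNIV"
    using a b unfolding square_summable_def by (intro l2_add_closed l2_scaleR_closed)
  then have ab: "square_summable (\<lambda>w. a w - b w)" by (simp add: square_summable_def)
  have "hol_eval (\<lambda>w. a w - b w) (hol_tuple f X) = (\<lambda>_. 0)" if X: "X \<in> op_ball \<gamma>" for X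
  proof
    fix x
    let ?Y = "hol_tuple f X"
    note Y = ball[OF X]
    have "hol_eval a ?Y = hol_eval b ?Y"
      using L X unfolding fun_mult_op_def a_def b_def hol_eval_mult_monom[OF Y p] \<phi>[OF X]
      by (simp add: Rep_ket_monom hol_eval_monom[OF Y])
    moreover have "hol_eval (\<lambda>w. a w - b w) ?Y x = hol_eval a ?Y x - hol_eval b ?Y x"
      using hol_eval_tendsto[OF Y ab, of x]
        tendsto_diff[OF hol_eval_tendsto[OF Y a, of x] hol_eval_tendsto[OF Y b, of x]]
      by (intro LIMSEQ_unique) (simp_all add: nc_homog_diff sum_subtractf)
    ultimately show "hol_eval (\<lambda>w. a w - b w) ?Y x = 0" by simp
  qed
  then have "(\<lambda>w. a w - b w) = (\<lambda>_. 0)" using nonzero[OF nc_radius_ge_one[OF ab]] by blast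
  then have "a = b" by (auto simp: fun_eq_iff)
  then show "Rep_l2 (L (ket \<beta>)) = nc_mult p (Rep_l2 (ket \<beta>))"
    by (simp add: a_def b_def Rep_ket_monom)
qed

text \<open>The model property fixes f(M_Z) only as multiplication by f_j, whose coefficient family
  is that of Z_j. A symbol determines its operator, so this is the creation operator.\<close>

lemma value_creation_if_nc_calc:
  assumes "MZ \<in> conv_SOT f \<union> conv_rad f" "\<And>j. left_mult_op (nc_var j) (nc_calc f MZ j)"
  shows "value_SOT f MZ creation \<or> value_rad f MZ creation"
proof -
  from assms(1) obtain F where F: "value_SOT f MZ F \<or> value_rad f MZ F"
    and MZ: "\<And>i. bounded_clinear (MZ i)"
    by (auto simp: conv_SOT_def conv_rad_def)
  have "nc_calc f MZ = F" by (rule nc_calc_eq[OF MZ F])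
  moreover have "nc_calc f MZ j = creation j" for j
    by (rule left_mult_op_unique[OF assms(2) left_mult_op_creation])
  ultimately have "F = creation" by auto
  then show ?thesis using F by simp
qed

text \<open>These two facts are all that the model theorem uses. They concern coefficient families
  only and no longer mention which of the three realizations was given.\<close>

lemma model_property_facts:
  fixes f :: "'n::finite \<Rightarrow> 'n series"
  assumes "model_property f g MZ"
  shows "(\<forall>i. left_mult_op (g i) (MZ i)) \<and> (value_SOT f MZ creation \<or> value_rad f MZ creation)"
proof -
  consider "model_A f g MZ" | "model_S f g MZ" | "model_F f g MZ"
    using assms by (auto simp: model_property_def)
  then show ?thesis
  proof cases
    case 1 then show ?thesis using model_A_facts by blast
  next
    case 2
    then have f0: "\<And>i. f i [] = 0" and det: "det (\<chi> i j. f i [j]) \<noteq> 0"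
      and gf: "\<And>i. nc_subst (g i) f = nc_var i" and MZ: "\<And>i. series_mult_op f (nc_var i) (MZ i)"
      and conv: "MZ \<in> conv_SOT f \<union> conv_rad f" and calc: "\<And>j. series_mult_op f (f j) (nc_calc f MZ j)"
      by (auto simp: model_S_def)
    have "nc_subst (nc_var j) f = f j" for j
      by (simp add: nc_var_eq_monom nc_subst_monom nc_mult_one_right)
    then have "left_mult_op (nc_var j) (nc_calc f MZ j)" for j
      by (rule model_S_left_mult_op[of f, OF f0 det calc])
    with model_S_left_mult_op[of f, OF f0 det MZ gf] value_creation_if_nc_calc[OF conv]
    show ?thesis by blast
  next
    case 3
    then obtain \<gamma> where ball: "\<And>X. X \<in> op_ball \<gamma> \<Longrightarrow> hol_tuple f X \<in> op_ball 1"
      and nz: "\<And>G. nc_radius G \<ge> 1 \<Longrightarrow> G \<noteq> (\<lambda>_. 0) \<Longrightarrow>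
        \<exists>X\<in>op_ball \<gamma>. hol_eval G (hol_tuple f X) \<noteq> (\<lambda>_. 0)"
      and g: "\<And>i. square_summable (g i)"
        "\<And>i X. X \<in> op_ball \<gamma> \<Longrightarrow> hol_eval (g i) (hol_tuple f X) = X i"
      and MZ: "\<And>i. fun_mult_op \<gamma> f (\<lambda>X. X i) (MZ i)"
      and conv: "MZ \<in> conv_SOT f \<union> conv_rad f"
      and calc: "\<And>j. fun_mult_op \<gamma> f (hol_eval (f j)) (nc_calc f MZ j)"
      unfolding model_F_def by blast
    have var: "square_summable (nc_var j)" for j :: 'n
      using square_summable_Rep_l2[of "ket [j]"] by (simp add: Rep_ket_monom nc_var_eq_monom)
    have eval: "hol_eval (nc_var j) (hol_tuple f X) = hol_eval (f j) X" if "X \<in> op_ball \<gamma>" for j X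
      using hol_eval_monom[OF ball[OF that], of "[j]"] by (simp add: nc_var_eq_monom hol_tuple_def)
    have "left_mult_op (nc_var j) (nc_calc f MZ j)" for j
      by (rule model_F_left_mult_op[OF ball nz calc var eval])
    moreover have "left_mult_op (g i) (MZ i)" for i
      by (rule model_F_left_mult_op[OF ball nz MZ g(1) g(2)])
    ultimately show ?thesis using value_creation_if_nc_calc[OF conv] by blast
  qed
qed

section \<open>The model theorem\<close>

lemma orth_proj_range:
  fixes U :: "'h::chilbert_space \<Rightarrow> 'k::complex_inner"
  assumes U: "bounded_clinear U" and iso: "\<And>x y. cinner (U x) (U y) = cinner x y"
  shows "orth_proj (range U) z = U (cadj U z)"
  unfolding orth_proj_def
proof (rule the_equality)
  show "U (cadj U z) \<in> range U \<and> (\<forall>m\<in>range U. cinner (z - U (cadj U z)) m = 0)"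
    by (auto simp: cinner_diff_left iso cinner_cadj_left[OF U])
  fix y assume y: "y \<in> range U \<and> (\<forall>m\<in>range U. cinner (z - y) m = 0)"
  then obtain h where h: "y = U h" by blast
  have "cadj U z = h"
  proof (rule cinner_ext_left)
    show "cinner (cadj U z) h' = cinner h h'" for h'
      using y by (simp add: h cinner_diff_left iso cinner_cadj_left[OF U])
  qed
  then show "y = U (cadj U z)" by (simp add: h)
qed

lemma adjoint_intertwine:
  fixes U :: "'h::chilbert_space \<Rightarrow> 'k::chilbert_space"
  assumes U: "bounded_clinear U" and A: "bounded_clinear A" and B: "bounded_clinear B"
    and AB: "\<And>y. A (cadj U y) = cadj U (B y)"
  shows "U (cadj A x) = cadj B (U x)"
proof (rule cinner_ext_left)
  fix y
  have "cinner (U (cadj A x)) y = cinner x (A (cadj U y))"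
    by (simp add: cinner_cadj_right[OF U, symmetric] cinner_cadj_left[OF A])
  also have "\<dots> = cinner (cadj B (U x)) y"
    by (simp add: AB cinner_cadj_right[OF U] cinner_cadj_left[OF B])
  finally show "cinner (U (cadj A x)) y = cinner (cadj B (U x)) y" .
qed

lemma norm_isometry:
  "(\<And>x y. cinner (U x) (U y) = cinner x y) \<Longrightarrow> norm (U x) = norm x"
  by (metis norm_eq_square norm_ge_zero norm_square_eq_Re_cinner power2_eq_iff_nonneg)

lemma value_bounded_clinear: "value_SOT f X F \<or> value_rad f X F \<Longrightarrow> bounded_clinear (F j)"
  by (auto simp: value_SOT_def value_rad_def sot_sums_def sot_lim_def)

context
  fixes f g :: "'n::finite \<Rightarrow> 'n series"
    and MZ :: "'n \<Rightarrow> ('n list, complex) l2 \<Rightarrow> ('n list, complex) l2"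
  assumes left: "\<And>i. left_mult_op (g i) (MZ i)"
    and f_MZ: "value_SOT f MZ creation \<or> value_rad f MZ creation"
begin

lemma MZ_bounded: "bounded_clinear (MZ i)"
  using left by (simp add: left_mult_op_def)

lemma value_f_tens_MZ:
  "value_SOT f (\<lambda>i. tens_op (MZ i)) (creation :: _ \<Rightarrow> ('n list, 'd::chilbert_space) l2 \<Rightarrow> _) \<or>
   value_rad f (\<lambda>i. tens_op (MZ i)) (creation :: _ \<Rightarrow> ('n list, 'd) l2 \<Rightarrow> _)"
  using value_tens_op[of MZ, OF MZ_bounded f_MZ] by (simp add: tens_op_creation)

lemma value_g_creation:
  "value_SOT g (creation :: _ \<Rightarrow> ('n list, 'd::chilbert_space) l2 \<Rightarrow> _) (\<lambda>i. tens_op (MZ i)) \<or>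
   value_rad g (creation :: _ \<Rightarrow> ('n list, 'd) l2 \<Rightarrow> _) (\<lambda>i. tens_op (MZ i))"
  using value_tens_op[of creation, OF bounded_clinear_creation disjI2[OF value_rad_creation[OF left]]]
  by (simp add: tens_op_creation)

lemma pure_if_compression:
  fixes T :: "'n \<Rightarrow> 'h::chilbert_space \<Rightarrow> 'h" and D :: "'d::chilbert_space set"
  assumes T: "\<And>i. bounded_clinear (T i)" and comp: "model_compression MZ D T"
  shows "T \<in> nc_domain f g \<and> pure_tuple f T"
proof -
  define B where "B i = (tens_op (MZ i) :: ('n list, 'd) l2 \<Rightarrow> _)" for i
  have B: "bounded_clinear (B i)" for i unfolding B_def by (rule bounded_clinear_tens_op[OF MZ_bounded])
  have C: "bounded_clinear (creation i :: ('n list, 'd) l2 \<Rightarrow> _)" for i :: 'n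
    by (rule bounded_clinear_creation)
  obtain U where U: "bounded_clinear U" "\<And>x y. cinner (U x) (U y) = cinner x y"
    and co: "\<And>i. co_invariant (range U) (B i)"
    and TU: "\<And>i. T i = cadj U \<circ> (orth_proj (range U) \<circ> B i) \<circ> U"
    using comp unfolding model_compression_def unitarily_equivalent_on_def B_def by blast
  define W where "W = cadj U"
  have W: "bounded_clinear W" unfolding W_def by (rule bounded_clinear_cadj[OF U(1)])
  have WU: "W (U x) = x" for x
    unfolding W_def by (rule cinner_ext_left) (simp add: cinner_cadj_left[OF U(1)] U(2))
  have T_eq: "T i x = W (B i (U x))" for i x
    by (simp add: TU orth_proj_range[OF U] WU[unfolded W_def] W_def)
  \<comment> \<open>The compression gives T_i = W B_i U. Co-invariance strengthens this to T_i W = W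
    B_i: the adjoint of B_i maps the range of \<open>U\<close> into itself, and against vectors of
    that range \<open>y\<close> and its projection \<open>U (W y)\<close> pair equally.\<close>
  have TW: "T i (W y) = W (B i y)" for i y
  proof (rule cinner_ext_left)
    fix z
    obtain h where h: "cadj (B i) (U z) = U h"
      using co[of i] unfolding co_invariant_def by blast
    have "cinner (T i (W y)) z = cinner (U (W y)) (U h)"
      unfolding T_eq W_def by (simp add: cinner_cadj_left[OF U(1)] cinner_cadj_right[OF B, symmetric] h)
    also have "\<dots> = cinner y (cadj (B i) (U z))"
      unfolding h U(2) W_def by (rule cinner_cadj_left[OF U(1)])
    also have "\<dots> = cinner (W (B i y)) z"
      unfolding W_def by (simp add: cinner_cadj_left[OF U(1)] cinner_cadj_right[OF B])
    finally show "cinner (T i (W y)) z = cinner (W (B i y)) z" .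
  qed
  \<comment> \<open>The candidate for f(T): the compression of S \<otimes> I, which is the value of
    f at the amplified model.\<close>
  define F where "F j x = W (creation j (U x))" for j x
  have valB: "value_SOT f B creation \<or> value_rad f B creation"
    unfolding B_def[abs_def] by (rule value_f_tens_MZ)
  note compr = value_compress[where W=W and V=U and X=B and T=T, OF W U(1) WU B T TW valB]
  have f_T: "value_SOT f T F \<or> value_rad f T F" using compr(1) by (simp add: F_def[abs_def])
  have FW: "F j (W y) = W (creation j y)" for j y using compr(2) by (simp add: F_def)
  have F: "bounded_clinear (F j)" for j by (rule value_bounded_clinear[OF f_T])
  have calc: "nc_calc f T = F" by (rule nc_calc_eq[OF T f_T])
  \<comment> \<open>The second application of the compression argument: now g, along the relation F
    W = W S just obtained. The compressed value is T itself.\<close>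
  have "value_SOT g creation B \<or> value_rad g creation B"
    unfolding B_def[abs_def] by (rule value_g_creation)
  from value_compress(1)[where W=W and V=U and X=creation and T=F, OF W U(1) WU C F FW this]
  have g_F: "value_SOT g F T \<or> value_rad g F T"
    by (simp add: T_eq[abs_def, symmetric])
  have adj: "U (cadj (op_word F \<alpha>) x) = cadj (op_word creation \<alpha>) (U x)" for \<alpha> x
    using op_word_intertwine[where W=W and V=U and X=creation and T=F, OF W U(1) WU C F FW, of \<alpha>]
    by (intro adjoint_intertwine U(1) bounded_clinear_op_word F C) (simp add: W_def)
  \<comment> \<open>\<open>U\<close> is isometric and intertwines the adjoints of words, so the
    energies of \<open>F\<close> are those of the creation operators along the range of
    \<open>U\<close>.\<close>
  have energy: "word_energy F k x = word_energy creation k (U x)" for k x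
    unfolding word_energy_def adj[symmetric] norm_isometry[of U, OF U(2)] ..
  have "U (cadj (F j) x) = backshift j (U x)" for j x
    using adjoint_intertwine[OF U(1) F C, of j j x] FW by (simp add: W_def cadj_creation)
  then have "norm (cadj (F j) x) = norm (backshift j (U x))" for j x
    by (metis norm_isometry[of U, OF U(2)])
  then have row: "row_bound F 1"
    using norm_isometry[of U, OF U(2)] by (simp add: row_bound_def sum_norm_backshift)
  have "T \<in> conv_SOT f \<union> conv_rad f" using T f_T by (auto simp: conv_SOT_def conv_rad_def)
  then have "T \<in> nc_domain f g"
    using T g_F row_norm_le_one[of F, OF F row] by (simp add: nc_domain_def inverse_at_def calc)
  moreover have "pure_tuple f T"
    unfolding pure_tuple_def calc sot_lim_zero_iff_word_energy[of F, OF F row] energy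
    by (intro allI word_energy_creation_tendsto)
  ultimately show ?thesis ..
qed

text \<open>The coefficient space is the whole space on which T acts: the kernel takes its
  coordinates in the range of the defect operator, and the full space contains it.\<close>

lemma compression_if_pure:
  fixes T :: "'n \<Rightarrow> 'h::chilbert_space \<Rightarrow> 'h"
  assumes T: "\<And>i. bounded_clinear (T i)" and dom: "T \<in> nc_domain f g" and pure: "pure_tuple f T"
  shows "model_compression MZ (UNIV :: 'h set) T"
proof -
  define B where "B i = (tens_op (MZ i) :: ('n list, 'h) l2 \<Rightarrow> _)" for i
  have B: "bounded_clinear (B i)" for i unfolding B_def by (rule bounded_clinear_tens_op[OF MZ_bounded])
  have C: "bounded_clinear (creation i :: ('n list, 'h) l2 \<Rightarrow> _)" for i :: 'n
    by (rule bounded_clinear_creation)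
  define F where "F = nc_calc f T"
  obtain F' where F': "value_SOT f T F' \<or> value_rad f T F'"
    using dom by (auto simp: nc_domain_def inverse_at_def conv_SOT_def conv_rad_def)
  then have f_T: "value_SOT f T F \<or> value_rad f T F"
    unfolding F_def nc_calc_eq[of T, OF T F'] .
  have F: "bounded_clinear (F j)" for j by (rule value_bounded_clinear[OF f_T])
  have g_F: "value_SOT g F T \<or> value_rad g F T" and "row_norm F \<le> 1"
    using dom by (auto simp: nc_domain_def inverse_at_def F_def)
  then have row: "row_bound F 1" by (intro row_bound_if_row_norm_le F)
  have "(\<lambda>k. word_energy F k x) \<longlonglongrightarrow> 0" for x
    using pure unfolding pure_tuple_def F_def[symmetric] sot_lim_zero_iff_word_energy[of F, OF F row] by blast
  then obtain K :: "'h \<Rightarrow> ('n list, 'h) l2"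
    where K: "bounded_clinear K" "\<And>x y. cinner (K x) (K y) = cinner x y"
      "\<And>i x. K (cadj (F i) x) = backshift i (K x)"
    using poisson_kernel_exists[of F, OF F row] by metis
  define W where "W = cadj K"
  have W: "bounded_clinear W" unfolding W_def by (rule bounded_clinear_cadj[OF K(1)])
  have WK: "W (K x) = x" for x unfolding W_def by (rule poisson_left_inverse[of F, OF F K])
  have FW: "F i (W y) = W (creation i y)" for i y
    unfolding W_def by (rule poisson_intertwine[of F, OF F K])
  have val: "value_SOT g creation B \<or> value_rad g creation B"
    unfolding B_def[abs_def] by (rule value_g_creation)
  note compr = value_compress[where W=W and V=K and X=creation and T=F, OF W K(1) WK C F FW val]
  \<comment> \<open>The domain condition says that g at \<open>F\<close> has the value T, and
    compression computes another value of g at \<open>F\<close>. Uniqueness of values, across the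
    two modes of convergence, identifies them.\<close>
  have T_eq: "T = (\<lambda>i x. W (B i (K x)))"
    by (rule value_unique[OF F g_F compr(1)])
  then have TW: "T i (W y) = W (B i y)" for i y using compr(2) by simp
  \<comment> \<open>An isometric image of a complete space is complete, hence closed.\<close>
  have "U = range K \<Longrightarrow> complete U" for U
    using complete_isometric_image[of 1 UNIV K] K(1) norm_isometry[of K, OF K(2)]
    by (simp add: bounded_clinear_def complete_UNIV)
  then have "closed (range K)" by (intro complete_imp_closed) simp
  moreover have "csubspace (range K)"
    unfolding csubspace_def
    using bounded_clinear_zero[OF K(1)]
    by (auto simp: bounded_clinear_add[OF K(1), symmetric] bounded_clinear_scaleC[OF K(1), symmetric]
        intro: range_eqI[of _ _ 0])
  moreover have "co_invariant (range K) (B i)" for i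
    using adjoint_intertwine[OF K(1) T[of i] B[of i]] TW[of i]
    by (auto simp: co_invariant_def W_def) (metis rangeI)
  moreover have "T i = cadj K \<circ> (orth_proj (range K) \<circ> B i) \<circ> K" for i
    using WK fun_cong[OF T_eq] by (simp add: fun_eq_iff orth_proj_range[OF K(1,2)] W_def)
  then have "unitarily_equivalent_on T (range K) (\<lambda>i. orth_proj (range K) \<circ> B i)"
    unfolding unitarily_equivalent_on_def using K(1,2) by blast
  ultimately show ?thesis
    unfolding model_compression_def closed_csubspace_def B_def tensor_space_UNIV by blast
qed

end

text \<open>The first conjunct names the type of the space of T as large enough to hold a suitable
  coefficient space. The second gives the converse implication for a coefficient space in an
  arbitrary Hilbert space type.\<close>

theorem theorem4p1:
  fixes f g :: "'n::finite \<Rightarrow> 'n series"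
    and MZ :: "'n \<Rightarrow> ('n list, complex) l2 \<Rightarrow> ('n list, complex) l2"
    and T :: "'n \<Rightarrow> 'h::chilbert_space \<Rightarrow> 'h"
  assumes "model_property f g MZ"
    and "\<forall>i. bounded_clinear (T i)"
  shows "(T \<in> nc_domain f g \<and> pure_tuple f T \<longleftrightarrow>
           (\<exists>D :: 'h set. closed_csubspace D \<and> model_compression MZ D T)) \<and>
         ((\<exists>D :: 'd::chilbert_space set. closed_csubspace D \<and> model_compression MZ D T) \<longrightarrow>
           T \<in> nc_domain f g \<and> pure_tuple f T)"
proof -
  note facts = model_property_facts[OF assms(1)]
  have left: "\<And>i. left_mult_op (g i) (MZ i)" and f_MZ: "value_SOT f MZ creation \<or> value_rad f MZ creation"
    using facts by auto
  have T: "\<And>i. bounded_clinear (T i)" using assms(2) by blast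
  have "closed_csubspace (UNIV :: 'h set)" by (simp add: closed_csubspace_def csubspace_def)
  moreover have "model_compression MZ (UNIV :: 'h set) T" if "T \<in> nc_domain f g" "pure_tuple f T"
    by (rule compression_if_pure[of g MZ f T, OF left f_MZ T that])
  moreover have "T \<in> nc_domain f g \<and> pure_tuple f T" if "model_compression MZ D T" for D :: "'h set"
    by (rule pure_if_compression[of g MZ f T, OF left f_MZ T that])
  moreover have "T \<in> nc_domain f g \<and> pure_tuple f T" if "model_compression MZ D T" for D :: "'d set"
    by (rule pure_if_compression[of g MZ f T, OF left f_MZ T that])
  ultimately show ?thesis by blast
qed

end
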